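(* Let $\Bbbk$ be an algebraically closed field, $V$ a $d$-dimensional $\Bbbk$-vector space, and $G$ a finite group acting linearly on $V$. Let $r\geq 1$ be an integer. If there exists a separating set $E\subset \Bbbk[V]^G$ of size $d+r-1$, then for every subset $U\subseteq V$ the isotropy subgroup $G_U$ is generated by elements $\sigma\in G_U$ whose fixed subspace $V^\sigma$ has codimension at most $r$ in $V$. In particular, $G$ itself is generated by elements $\sigma$ whose fixed subspace $V^\sigma$ has codimension at most $r$ in $V$.
   Context: $\Bbbk[V]=\operatorname{Sym}(V^* )$ is the ring of polynomial functions on $V$, with the induced action $(g\cdot f)(v)=f(g^{-1}v)$, and $\Bbbk[V]^G=\{f\in \Bbbk[V] : g\cdot f=f \text{ for all } g\in G\}$ is the ring of invariants. A separating set is a subset $E\subset\Bbbk[V]^G$ such that whenever $v,w\in V$ have distinct orbits $G\cdot v\neq G\cdot w$, there is $h\in E$ with $h(v)\neq h(w)$. For a subset $U\subseteq V$, the isotropy subgroup is $G_U=\{\sigma\in G : \sigma\cdot u=u\ \ \forall u\in U\}$. For $\sigma\in G$, $V^\sigma=\{v\in V:\sigma\cdot v=v\}$. *)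

theory Defs
  imports
    "HOL-Computational_Algebra.Polynomial"
    "HOL-Algebra.Group_Action"
    "HOL-Algebra.Generated_Groups"
begin

text \<open>
  The ring of polynomial functions on the vector space given by \<open>scale\<close>, realised as the
  algebra of functions generated by the constants and the linear forms. Over an infinite field
  (in particular an algebraically closed one) and in finite dimension, this is \<open>Sym(V\<^sup>*)\<close>.
\<close>

inductive_set polynomial_functions ::
    "('k :: field \<Rightarrow> 'v :: ab_group_add \<Rightarrow> 'v) \<Rightarrow> ('v \<Rightarrow> 'k) set"
  for scale :: "'k \<Rightarrow> 'v \<Rightarrow> 'v" where
  const: "(\<lambda>_. c) \<in> polynomial_functions scale"
| linear_form: "Vector_Spaces.linear scale (*) l \<Longrightarrow> l \<in> polynomial_functions scale"
| add: "\<lbrakk>p \<in> polynomial_functions scale; q \<in> polynomial_functions scale\<rbrakk> \<Longrightarrow>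
          (\<lambda>v. p v + q v) \<in> polynomial_functions scale"
| mult: "\<lbrakk>p \<in> polynomial_functions scale; q \<in> polynomial_functions scale\<rbrakk> \<Longrightarrow>
          (\<lambda>v. p v * q v) \<in> polynomial_functions scale"

definition linear_group_action ::
    "('g, 'b) monoid_scheme \<Rightarrow> ('k :: field \<Rightarrow> 'v :: ab_group_add \<Rightarrow> 'v) \<Rightarrow>
     ('g \<Rightarrow> 'v \<Rightarrow> 'v) \<Rightarrow> bool" where
  "linear_group_action G scale \<phi> \<longleftrightarrow>
     group_action G UNIV \<phi> \<and> (\<forall>g\<in>carrier G. Vector_Spaces.linear scale scale (\<phi> g))"

definition function_action ::
    "('g, 'b) monoid_scheme \<Rightarrow> ('g \<Rightarrow> 'v \<Rightarrow> 'v) \<Rightarrow> 'g \<Rightarrow> ('v \<Rightarrow> 'k) \<Rightarrow> 'v \<Rightarrow> 'k" where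
  "function_action G \<phi> g f = (\<lambda>v. f (\<phi> (inv\<^bsub>G\<^esub> g) v))"

definition invariant_ring ::
    "('g, 'b) monoid_scheme \<Rightarrow> ('k :: field \<Rightarrow> 'v :: ab_group_add \<Rightarrow> 'v) \<Rightarrow>
     ('g \<Rightarrow> 'v \<Rightarrow> 'v) \<Rightarrow> ('v \<Rightarrow> 'k) set" where
  "invariant_ring G scale \<phi> =
     {f \<in> polynomial_functions scale. \<forall>g\<in>carrier G. function_action G \<phi> g f = f}"

definition separating_set ::
    "('g, 'b) monoid_scheme \<Rightarrow> ('k :: field \<Rightarrow> 'v :: ab_group_add \<Rightarrow> 'v) \<Rightarrow>
     ('g \<Rightarrow> 'v \<Rightarrow> 'v) \<Rightarrow> ('v \<Rightarrow> 'k) set \<Rightarrow> bool" where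
  "separating_set G scale \<phi> E \<longleftrightarrow>
     E \<subseteq> invariant_ring G scale \<phi> \<and>
     (\<forall>v w. orbit G \<phi> v \<noteq> orbit G \<phi> w \<longrightarrow> (\<exists>h\<in>E. h v \<noteq> h w))"

definition isotropy_subgroup ::
    "('g, 'b) monoid_scheme \<Rightarrow> ('g \<Rightarrow> 'v \<Rightarrow> 'v) \<Rightarrow> 'v set \<Rightarrow> 'g set" where
  "isotropy_subgroup G \<phi> U = {\<sigma> \<in> carrier G. \<forall>u\<in>U. \<phi> \<sigma> u = u}"

definition fixed_subspace :: "('g \<Rightarrow> 'v \<Rightarrow> 'v) \<Rightarrow> 'g \<Rightarrow> 'v set" where
  "fixed_subspace \<phi> \<sigma> = {v. \<phi> \<sigma> v = v}"

text \<open>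
  Meaningful for subspaces of a finite-dimensional space, where the subtraction of natural
  numbers does not truncate.
\<close>

definition codimension ::
    "('k :: field \<Rightarrow> 'v :: ab_group_add \<Rightarrow> 'v) \<Rightarrow> 'v set \<Rightarrow> nat" where
  "codimension scale W = vector_space.dim scale UNIV - vector_space.dim scale W"

end

theory Submission
  imports Defs "HOL-Library.Poly_Mapping" "HOL-Computational_Algebra.Fraction_Field"
begin

text \<open>
  Let \<open>K\<close> be the isotropy group, \<open>H \<subseteq> K\<close> the subgroup generated by the elements with fixed space of
  codimension at most \<open>r\<close>, and suppose \<open>H \<noteq> K\<close>. Choose a point \<open>u\<close> with stabiliser exactly \<open>K\<close>
  and \<open>d - r - 1\<close> linear forms whose common kernel \<open>L\<close> meets the fixed space of every element of
  \<open>K - H\<close> only in 0. In \<open>V \<times> V\<close>, translated so that \<open>(u, u)\<close> is the origin, the equations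
  \<open>f v = f w\<close> for \<open>f \<in> E\<close> and the linear forms in \<open>v\<close> are at most \<open>2 * d - 2\<close> in number, and near
  the origin they define the union of the graphs over \<open>L\<close> of the elements of \<open>K\<close>. The graphs of the
  elements of \<open>H\<close> and those of \<open>K - H\<close> meet only in the origin, which contradicts the
  Hartshorne-Grothendieck connectedness theorem: in dimension \<open>n\<close>, a punctured neighbourhood in a zero
  set of \<open>n - 2\<close> polynomials is connected.

  The required case of the connectedness theorem follows from a Mayer-Vietoris argument in Cech
  cohomology. Let \<open>A\<close> and \<open>B\<close> be the two pieces, each containing a line, say a coordinate axis. The
  class of \<open>1 / (x\<^sub>1 \<cdots> x\<^sub>n)\<close> on the punctured space vanishes on the complement of each axis, which is
  covered by \<open>n - 1\<close> coordinate charts, so it comes from a class of degree \<open>n - 2\<close> on the complement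
  of \<open>A \<union> B\<close>. This complement is covered by \<open>n - 2\<close> charts, so that class is zero, although
  \<open>1 / (x\<^sub>1 \<cdots> x\<^sub>n)\<close> is not.
\<close>

section \<open>Cech cohomology\<close>

text \<open>The bound r enters through one count: an element of \<open>K - H\<close> fixes a space
  of dimension at most d - r - 1, and that number of forms together with d + r - 1 invariants stays
  two below dim (V x V). Since d - r - 1 < d, there is still a nonzero v0 in L; if g0 is in
  \<open>K - H\<close>, the lines through (v0, v0) and (v0, g0 v0) lie in the two pieces and become
  the two axes. The equations are not homogeneous, and the graphs of elements outside
  \<open>K\<close> are solutions as well, though only away from the origin. Hence the work in the
  local ring at the origin, where a polynomial that vanishes on those graphs but not at the origin
  is a unit. Knowledge of zero sets determines equations only up to radicals. Cech cohomology
  tolerates this: charts can be added or dropped as soon as powers of their functions lie in the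
  right ideals. No depth or dimension theory is involved: groups vanish because there are too few
  charts, and the top class survives by comparison of a single coefficient.\<close>

text \<open>
  Cochains live on finite sets of labels and take values in one field \<open>'a\<close>; the sections over the
  intersection of the charts labelled by \<open>S\<close> are the elements with denominator a power of \<open>prod f S\<close>.
  The empty set is allowed, so this is the extended complex, which computes local cohomology. Families
  of label sets encode subcomplexes and quotient complexes.
\<close>

locale cech =
  fixes R :: "'a::field set" and f :: "'i::linorder \<Rightarrow> 'a"
  assumes one_closed: "1 \<in> R"
    and add_closed: "x \<in> R \<Longrightarrow> y \<in> R \<Longrightarrow> x + y \<in> R"
    and uminus_closed: "x \<in> R \<Longrightarrow> - x \<in> R"
    and mult_closed: "x \<in> R \<Longrightarrow> y \<in> R \<Longrightarrow> x * y \<in> R"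
    and f_closed: "f i \<in> R"
    and f_nonzero: "f i \<noteq> 0"
begin

section \<open>Denominators that are products of chart functions\<close>

lemma zero_closed: "0 \<in> R"
  using add_closed[OF one_closed uminus_closed[OF one_closed]] by simp

lemma power_closed: "x \<in> R \<Longrightarrow> x ^ n \<in> R"
  by (induction n) (auto simp: one_closed mult_closed)

lemma prod_closed: "(\<And>i. i \<in> I \<Longrightarrow> g i \<in> R) \<Longrightarrow> prod g I \<in> R"
  by (induction I rule: infinite_finite_induct) (auto simp: one_closed mult_closed)

text \<open>All localizations lie in the same field, so restriction maps are inclusions and need no
  notation. For infinite \<open>S\<close> the product is 1 and the value is
  \<open>R\<close>.\<close>

definition localization :: "'i set \<Rightarrow> 'a set" where
  "localization S = {y. \<exists>N. prod f S ^ N * y \<in> R}"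

lemma localizationI: "prod f S ^ N * y \<in> R \<Longrightarrow> y \<in> localization S"
  unfolding localization_def by blast

lemma prod_f_closed: "prod f S \<in> R"
  by (rule prod_closed) (rule f_closed)

lemma prod_f_nonzero: "prod f S \<noteq> 0"
  by (induction S rule: infinite_finite_induct) (auto simp: f_nonzero)

lemma localization_mono_exp:
  assumes "prod f S ^ N * y \<in> R" "N \<le> M"
  shows "prod f S ^ M * y \<in> R"
proof -
  have "prod f S ^ M * y = prod f S ^ (M - N) * (prod f S ^ N * y)"
    unfolding mult.assoc[symmetric] power_add[symmetric] using assms(2) by simp
  moreover have "prod f S ^ (M - N) * (prod f S ^ N * y) \<in> R"
    using mult_closed[OF power_closed[OF prod_f_closed] assms(1)] .
  ultimately show ?thesis by argo
qed

lemma localization_zero: "0 \<in> localization S"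
  by (rule localizationI[of _ 0]) (simp add: zero_closed)

lemma localization_add:
  assumes "y \<in> localization S" "z \<in> localization S"
  shows "y + z \<in> localization S"
proof -
  obtain N M where NM: "prod f S ^ N * y \<in> R" "prod f S ^ M * z \<in> R"
    using assms unfolding localization_def by blast
  then have "prod f S ^ max N M * y \<in> R" "prod f S ^ max N M * z \<in> R"
    by (auto intro: localization_mono_exp)
  then have "prod f S ^ max N M * (y + z) \<in> R"
    by (simp add: distrib_left add_closed)
  then show ?thesis by (rule localizationI)
qed

lemma localization_uminus: "y \<in> localization S \<Longrightarrow> - y \<in> localization S"
  unfolding localization_def using uminus_closed by fastforce

lemma localization_diff: "y \<in> localization S \<Longrightarrow> z \<in> localization S \<Longrightarrow> y - z \<in> localization S"
  using localization_add[OF _ localization_uminus, of y S z] by simp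

lemma localization_mult:
  assumes "y \<in> localization S" "z \<in> localization S"
  shows "y * z \<in> localization S"
proof -
  obtain N M where NM: "prod f S ^ N * y \<in> R" "prod f S ^ M * z \<in> R"
    using assms unfolding localization_def by blast
  have "prod f S ^ (N + M) * (y * z) = (prod f S ^ N * y) * (prod f S ^ M * z)"
    by (simp add: power_add mult_ac)
  then show ?thesis using mult_closed[OF NM] localizationI by metis
qed

lemma localization_sum: "(\<And>i. i \<in> I \<Longrightarrow> g i \<in> localization S) \<Longrightarrow> sum g I \<in> localization S"
  by (induction I rule: infinite_finite_induct) (auto simp: localization_zero localization_add)

lemma localization_base: "y \<in> R \<Longrightarrow> y \<in> localization S"
  by (rule localizationI[of _ 0]) simp

lemma localization_mono:
  assumes "y \<in> localization S" "S \<subseteq> T" "finite T"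
  shows "y \<in> localization T"
proof -
  obtain N where N: "prod f S ^ N * y \<in> R"
    using assms unfolding localization_def by blast
  have "prod f T = prod f (T - S) * prod f S"
    using assms by (metis prod.subset_diff)
  then have "prod f T ^ N * y = prod f (T - S) ^ N * (prod f S ^ N * y)"
    by (simp add: power_mult_distrib mult_ac)
  then show ?thesis
    using N mult_closed power_closed prod_f_closed localizationI by metis
qed

section \<open>Signs and the coboundary\<close>

definition pos_sign :: "'i \<Rightarrow> 'i set \<Rightarrow> 'a" where
  "pos_sign i S = (- 1) ^ card {j \<in> S. j < i}"

lemma pos_sign_insert:
  assumes "finite S" "j \<notin> S"
  shows "pos_sign i (insert j S) = (if j < i then - pos_sign i S else pos_sign i S)"
proof -
  have "{k \<in> insert j S. k < i} = (if j < i then insert j {k \<in> S. k < i} else {k \<in> S. k < i})"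
    by auto
  then show ?thesis
    using assms by (simp add: pos_sign_def)
qed

lemma pos_sign_square: "pos_sign i S * pos_sign i S = 1"
  by (simp add: pos_sign_def power_mult_distrib[symmetric])

lemma pos_sign_square': "pos_sign i S * (pos_sign i S * x) = x"
  by (simp add: mult.assoc[symmetric] pos_sign_square)

lemma pos_sign_closed: "pos_sign i S \<in> R"
  by (simp add: pos_sign_def power_closed uminus_closed one_closed)

definition coboundary :: "('i set \<Rightarrow> 'a) \<Rightarrow> 'i set \<Rightarrow> 'a" where
  "coboundary c S = (\<Sum>i\<in>S. pos_sign i S * c (S - {i}))"

lemma coboundary_coboundary:
  assumes "finite S"
  shows "coboundary (coboundary c) S = 0"
proof -
  define g where "g = (\<lambda>(i, j). pos_sign i S * (pos_sign j (S - {i}) * c (S - {i} - {j})))"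
  \<comment> \<open>Both orders of removal end in the same set, but only the larger index counts the
    other one among its predecessors; hence opposite signs.\<close>
  have anti: "g (j, i) = - g (i, j)" if "i \<in> S" "j \<in> S" "i < j" for i j
  proof -
    define T where "T = S - {i, j}"
    have S: "S = insert i (insert j T)" "finite T" "i \<notin> T" "j \<notin> T" "i \<noteq> j"
      using that assms by (auto simp: T_def)
    have "S - {i} = insert j T" "S - {j} = insert i T" "S - {i} - {j} = T" "S - {j} - {i} = T"
      using that by (auto simp: T_def)
    moreover have "pos_sign i S = pos_sign i T" "pos_sign j S = - pos_sign j T"
      "pos_sign i (insert i T) = pos_sign i T" "pos_sign j (insert j T) = pos_sign j T"
      using S(2-5) that(3) by (auto simp: S(1) pos_sign_insert)
    ultimately show ?thesis by (simp add: g_def mult_ac)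
  qed
  have "coboundary (coboundary c) S = (\<Sum>i\<in>S. \<Sum>j\<in>S - {i}. g (i, j))"
    unfolding coboundary_def g_def by (simp add: sum_distrib_left)
  also have "\<dots> = sum g (SIGMA i:S. S - {i})"
    using assms by (subst sum.Sigma) auto
  also have "(SIGMA i:S. S - {i}) = {(i, j) \<in> S \<times> S. i < j} \<union> {(i, j) \<in> S \<times> S. j < i}"
    by auto
  also have "sum g \<dots> = sum g {(i, j) \<in> S \<times> S. i < j} + sum g {(i, j) \<in> S \<times> S. j < i}"
  proof (rule sum.union_disjoint)
    show "finite {(i, j) \<in> S \<times> S. i < j}"
      by (rule finite_subset[of _ "S \<times> S"]) (auto simp: assms)
    show "finite {(i, j) \<in> S \<times> S. j < i}"
      by (rule finite_subset[of _ "S \<times> S"]) (auto simp: assms)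
    show "{(i, j) \<in> S \<times> S. i < j} \<inter> {(i, j) \<in> S \<times> S. j < i} = {}"
      by (auto dest: less_asym)
  qed
  also have "sum g {(i, j) \<in> S \<times> S. j < i} = sum (\<lambda>x. - g x) {(i, j) \<in> S \<times> S. i < j}"
    by (rule sum.reindex_bij_witness[of _ prod.swap prod.swap]) (auto simp: anti)
  finally show ?thesis by (simp add: sum_negf)
qed

lemma coboundary_diff: "coboundary (\<lambda>S. c S - e S) S = coboundary c S - coboundary e S"
  by (simp add: coboundary_def right_diff_distrib sum_subtractf)

lemma coboundary_add: "coboundary (\<lambda>S. c S + e S) S = coboundary c S + coboundary e S"
  by (simp add: coboundary_def distrib_left sum.distrib)

lemma coboundary_localization:
  assumes "\<And>S. c S \<in> localization S"
  shows "coboundary c S \<in> localization S"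
proof (cases "finite S")
  case True
  then show ?thesis
    unfolding coboundary_def using assms
    by (intro localization_sum localization_mult localization_base[OF pos_sign_closed])
       (blast intro: localization_mono)
qed (simp add: coboundary_def localization_zero)

section \<open>Cochains on families of label sets\<close>

definition cochain :: "'i set set \<Rightarrow> nat \<Rightarrow> ('i set \<Rightarrow> 'a) \<Rightarrow> bool" where
  "cochain \<S> p c \<longleftrightarrow> (\<forall>S. c S \<in> localization S) \<and> (\<forall>S. S \<in> \<S> \<and> card S = p \<or> c S = 0)"

text \<open>Values of the coboundary off \<open>\<S>\<close> are discarded: the differential is that
  of a subquotient of the full complex.\<close>

definition cocycle :: "'i set set \<Rightarrow> nat \<Rightarrow> ('i set \<Rightarrow> 'a) \<Rightarrow> bool" where
  "cocycle \<S> p c \<longleftrightarrow> cochain \<S> p c \<and> (\<forall>S\<in>\<S>. coboundary c S = 0)"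

definition bounded_by :: "'i set set \<Rightarrow> nat \<Rightarrow> ('i set \<Rightarrow> 'a) \<Rightarrow> ('i set \<Rightarrow> 'a) \<Rightarrow> bool" where
  "bounded_by \<S> p c e \<longleftrightarrow> cochain \<S> p e \<and> (\<forall>S\<in>\<S>. coboundary e S = c S)"

text \<open>Degree is the number of labels, and \<open>p\<close> is the degree of the solutions. The
  group that vanishes therefore sits in degree \<open>Suc p\<close>.\<close>

definition acyclic_at :: "'i set set \<Rightarrow> nat \<Rightarrow> bool" where
  "acyclic_at \<S> p \<longleftrightarrow> (\<forall>c. cocycle \<S> (Suc p) c \<longrightarrow> (\<exists>e. bounded_by \<S> p c e))"

lemma cocycleI: "cochain \<S> p c \<Longrightarrow> (\<And>S. S \<in> \<S> \<Longrightarrow> coboundary c S = 0) \<Longrightarrow> cocycle \<S> p c"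
  by (simp add: cocycle_def)

lemma bounded_byI:
  "cochain \<S> p e \<Longrightarrow> (\<And>S. S \<in> \<S> \<Longrightarrow> coboundary e S = c S) \<Longrightarrow> bounded_by \<S> p c e"
  by (simp add: bounded_by_def)

lemma cocycle_cochain: "cocycle \<S> p c \<Longrightarrow> cochain \<S> p c"
  by (simp add: cocycle_def)

lemma cocycle_coboundary: "cocycle \<S> p c \<Longrightarrow> S \<in> \<S> \<Longrightarrow> coboundary c S = 0"
  by (simp add: cocycle_def)

lemma bounded_by_cochain: "bounded_by \<S> p c e \<Longrightarrow> cochain \<S> p e"
  by (simp add: bounded_by_def)

lemma bounded_by_coboundary: "bounded_by \<S> p c e \<Longrightarrow> S \<in> \<S> \<Longrightarrow> coboundary e S = c S"
  by (simp add: bounded_by_def)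

lemma acyclic_atI: "(\<And>c. cocycle \<S> (Suc p) c \<Longrightarrow> \<exists>e. bounded_by \<S> p c e) \<Longrightarrow> acyclic_at \<S> p"
  by (simp add: acyclic_at_def)

lemma acyclic_atD: "acyclic_at \<S> p \<Longrightarrow> cocycle \<S> (Suc p) c \<Longrightarrow> \<exists>e. bounded_by \<S> p c e"
  by (simp add: acyclic_at_def)

section \<open>Subfamilies and the long exact sequence\<close>

definition restr :: "'i set set \<Rightarrow> ('i set \<Rightarrow> 'a) \<Rightarrow> 'i set \<Rightarrow> 'a" where
  "restr \<S> c S = (if S \<in> \<S> then c S else 0)"

lemma cochain_restr: "cochain \<S> p c \<Longrightarrow> cochain \<D> p (restr \<D> c)"
  unfolding cochain_def restr_def by (auto simp: localization_zero)

lemma cochain_mono: "cochain \<D> p c \<Longrightarrow> \<D> \<subseteq> \<S> \<Longrightarrow> cochain \<S> p c"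
  unfolding cochain_def by blast

lemma cochain_diff: "cochain \<S> p c \<Longrightarrow> cochain \<S> p e \<Longrightarrow> cochain \<S> p (\<lambda>S. c S - e S)"
  unfolding cochain_def by (metis localization_diff diff_0_right)

lemma cochain_add: "cochain \<S> p c \<Longrightarrow> cochain \<S> p e \<Longrightarrow> cochain \<S> p (\<lambda>S. c S + e S)"
  unfolding cochain_def by (metis localization_add add_0_right)

lemma cochain_outside: "cochain \<S> p c \<Longrightarrow> S \<notin> \<S> \<Longrightarrow> c S = 0"
  unfolding cochain_def by blast

lemma cochain_card: "cochain \<S> p c \<Longrightarrow> card S \<noteq> p \<Longrightarrow> c S = 0"
  unfolding cochain_def by blast

lemma cochain_vanishing: "cochain \<S> p c \<Longrightarrow> (\<And>S. S \<in> \<D> \<Longrightarrow> c S = 0) \<Longrightarrow> cochain (\<S> - \<D>) p c"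
  unfolding cochain_def by blast

lemma cochain_localization: "cochain \<S> p c \<Longrightarrow> c S \<in> localization S"
  unfolding cochain_def by blast

lemma cochain_restr_coboundary:
  assumes "cochain \<D> p c" "\<And>S. S \<in> \<S> \<Longrightarrow> finite S"
  shows "cochain \<S> (Suc p) (restr \<S> (coboundary c))"
proof -
  have "coboundary c S = 0" if "finite S" "card S \<noteq> Suc p" for S
    unfolding coboundary_def
  proof (intro sum.neutral ballI)
    fix i assume "i \<in> S"
    then have "card (S - {i}) \<noteq> p"
      using card_Suc_Diff1[OF that(1)] that(2) by metis
    then show "pos_sign i S * c (S - {i}) = 0"
      using cochain_card[OF assms(1), of "S - {i}"] by simp
  qed
  then show ?thesis
    unfolding cochain_def
  proof (intro conjI allI)
    fix S show "restr \<S> (coboundary c) S \<in> localization S"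
      using coboundary_localization[OF cochain_localization[OF assms(1)]]
      by (simp add: restr_def localization_zero)
    show "S \<in> \<S> \<and> card S = Suc p \<or> restr \<S> (coboundary c) S = 0"
      using \<open>\<And>S. finite S \<Longrightarrow> card S \<noteq> Suc p \<Longrightarrow> coboundary c S = 0\<close>[of S] assms(2)[of S]
      by (auto simp: restr_def)
  qed
qed

text \<open>This makes the coboundary, cut down to the family, square to zero: if a set and a face
  with two labels fewer are present, so are the faces in between.\<close>

definition convex_family :: "'i set set \<Rightarrow> bool" where
  "convex_family \<S> \<longleftrightarrow> (\<forall>S\<in>\<S>. finite S \<and> (\<forall>i j. S - {i} - {j} \<in> \<S> \<longrightarrow> S - {i} \<in> \<S>))"

lemma convex_family_finite: "convex_family \<S> \<Longrightarrow> S \<in> \<S> \<Longrightarrow> finite S"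
  unfolding convex_family_def by blast

lemma coboundary_restr_coboundary:
  assumes "convex_family \<S>" "cochain \<S> p c" "S \<in> \<S>"
  shows "coboundary (restr \<S> (coboundary c)) S = 0"
proof -
  have "restr \<S> (coboundary c) (S - {i}) = coboundary c (S - {i})" for i
  proof (cases "S - {i} \<in> \<S>")
    case False
    then have "S - {i} - {j} \<notin> \<S>" for j
      using assms(1,3) unfolding convex_family_def by blast
    then show ?thesis
      using False cochain_outside[OF assms(2)] by (simp add: restr_def coboundary_def)
  qed (simp add: restr_def)
  then have "coboundary (restr \<S> (coboundary c)) S = coboundary (coboundary c) S"
    by (simp add: coboundary_def[of _ S])
  then show ?thesis
    using coboundary_coboundary[OF convex_family_finite[OF assms(1,3)]] by simp
qed

text \<open>The coboundary only adds labels, so cochains on \<open>\<D>\<close> form a quotient of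
  those on \<open>\<S>\<close>, with the cochains on \<open>\<S> - \<D>\<close> as kernel. The
  lemmas on gluing, extension, \<open>acyclic_at_down\<close> and \<open>acyclic_at_up\<close> are
  pieces of the resulting long exact sequence.\<close>

definition down_in :: "'i set set \<Rightarrow> 'i set set \<Rightarrow> bool" where
  "down_in \<D> \<S> \<longleftrightarrow> \<D> \<subseteq> \<S> \<and> (\<forall>S\<in>\<D>. \<forall>i\<in>S. S - {i} \<in> \<S> \<longrightarrow> S - {i} \<in> \<D>)"

lemma down_in_subset: "down_in \<D> \<S> \<Longrightarrow> \<D> \<subseteq> \<S>"
  by (simp add: down_in_def)

lemma down_in_remove: "down_in \<D> \<S> \<Longrightarrow> S \<in> \<D> \<Longrightarrow> i \<in> S \<Longrightarrow> S - {i} \<in> \<S> \<Longrightarrow> S - {i} \<in> \<D>"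
  by (simp add: down_in_def)

lemma down_in_Un: "down_in \<D> \<S> \<Longrightarrow> down_in \<E> \<S> \<Longrightarrow> down_in (\<D> \<union> \<E>) \<S>"
  by (auto simp: down_in_def)

lemma coboundary_restr_down:
  assumes "down_in \<D> \<S>" "cochain \<S> p c" "S \<in> \<D>"
  shows "coboundary (restr \<D> c) S = coboundary c S"
proof -
  have "restr \<D> c (S - {i}) = c (S - {i})" if "i \<in> S" for i
  proof (cases "S - {i} \<in> \<D>")
    case False
    then have "S - {i} \<notin> \<S>"
      using down_in_remove[OF assms(1,3) that] by blast
    then show ?thesis
      using cochain_outside[OF assms(2)] by (simp add: restr_def)
  qed (simp add: restr_def)
  then show ?thesis unfolding coboundary_def by simp
qed

lemma coboundary_up_zero:
  assumes "down_in \<D> \<S>" "cochain (\<S> - \<D>) p c" "S \<in> \<D>"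
  shows "coboundary c S = 0"
proof -
  have "c (S - {i}) = 0" if "i \<in> S" for i
    using down_in_remove[OF assms(1,3) that] cochain_outside[OF assms(2), of "S - {i}"] by blast
  then show ?thesis unfolding coboundary_def by simp
qed

lemma cocycle_restr_down:
  assumes "down_in \<D> \<S>" "cocycle \<S> p c"
  shows "cocycle \<D> p (restr \<D> c)"
  using coboundary_restr_down[OF assms(1) cocycle_cochain[OF assms(2)]]
    cocycle_coboundary[OF assms(2)] down_in_subset[OF assms(1)]
  by (intro cocycleI cochain_restr[OF cocycle_cochain[OF assms(2)]]) auto

text \<open>A cochain that \<open>e\<close> bounds on \<open>\<D>\<close> is moved by this
  correction into the kernel of restriction to \<open>\<D>\<close>.\<close>

lemma cochain_minus_coboundary:
  assumes "convex_family \<S>" "cochain \<S> (Suc p) c" "cochain \<S> p e"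
    and "\<And>S. S \<in> \<D> \<Longrightarrow> S \<in> \<S> \<and> coboundary e S = c S"
  shows "cochain (\<S> - \<D>) (Suc p) (\<lambda>S. c S - restr \<S> (coboundary e) S)"
  by (intro cochain_vanishing cochain_diff assms(2)
      cochain_restr_coboundary[OF assms(3) convex_family_finite[OF assms(1)]])
     (simp_all add: restr_def assms)

text \<open>Exactness at the middle term for a single class: only the restriction of
  \<open>c\<close> has to be bounded on \<open>\<D>\<close>, not every cocycle there. The
  Mayer-Vietoris argument relies on this finer form.\<close>

lemma bounded_by_extension:
  assumes down: "down_in \<D> \<S>" and U: "acyclic_at (\<S> - \<D>) p" and conv: "convex_family \<S>"
    and c: "cocycle \<S> (Suc p) c" and e: "bounded_by \<D> p (restr \<D> c) e"
  shows "\<exists>e. bounded_by \<S> p c e"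
proof -
  note DS = down_in_subset[OF down]
  have eS: "cochain \<S> p e" by (rule cochain_mono[OF bounded_by_cochain[OF e] DS])
  have eD: "coboundary e S = c S" if "S \<in> \<D>" for S
    using bounded_by_coboundary[OF e that] that by (simp add: restr_def)
  define c' where "c' = (\<lambda>S. c S - restr \<S> (coboundary e) S)"
  have "cocycle (\<S> - \<D>) (Suc p) c'"
  proof (rule cocycleI)
    show "cochain (\<S> - \<D>) (Suc p) c'"
      unfolding c'_def using DS eD
      by (intro cochain_minus_coboundary conv cocycle_cochain[OF c] eS) auto
    show "coboundary c' S = 0" if "S \<in> \<S> - \<D>" for S
      using that cocycle_coboundary[OF c] coboundary_restr_coboundary[OF conv eS]
      by (simp add: c'_def coboundary_diff)
  qed
  then obtain e' where e': "bounded_by (\<S> - \<D>) p c' e'"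
    using acyclic_atD[OF U] by blast
  have "bounded_by \<S> p c (\<lambda>S. e S + e' S)"
  proof (rule bounded_byI)
    show "cochain \<S> p (\<lambda>S. e S + e' S)"
      by (rule cochain_add[OF eS cochain_mono[OF bounded_by_cochain[OF e'] Diff_subset]])
    fix S assume S: "S \<in> \<S>"
    show "coboundary (\<lambda>S. e S + e' S) S = c S"
    proof (cases "S \<in> \<D>")
      case True
      then show ?thesis
        using coboundary_up_zero[OF down bounded_by_cochain[OF e'] True] eD[OF True]
        by (simp add: coboundary_add)
    next
      case False
      then show ?thesis
        using bounded_by_coboundary[OF e', of S] S by (simp add: coboundary_add c'_def restr_def)
    qed
  qed
  then show ?thesis by blast
qed

lemma acyclic_at_glue:
  assumes down: "down_in \<D> \<S>" and D: "acyclic_at \<D> p" and U: "acyclic_at (\<S> - \<D>) p"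
    and conv: "convex_family \<S>"
  shows "acyclic_at \<S> p"
proof (rule acyclic_atI)
  fix c assume c: "cocycle \<S> (Suc p) c"
  obtain e where "bounded_by \<D> p (restr \<D> c) e"
    using acyclic_atD[OF D cocycle_restr_down[OF down c]] by blast
  then show "\<exists>e. bounded_by \<S> p c e"
    by (rule bounded_by_extension[OF down U conv c])
qed

lemma bounded_by_restr_down:
  assumes "down_in \<D> \<S>" "bounded_by \<S> p c e"
  shows "bounded_by \<D> p (restr \<D> c) (restr \<D> e)"
proof (rule bounded_byI)
  show "cochain \<D> p (restr \<D> e)" by (rule cochain_restr[OF bounded_by_cochain[OF assms(2)]])
  fix S assume S: "S \<in> \<D>"
  then show "coboundary (restr \<D> e) S = restr \<D> c S"
    using coboundary_restr_down[OF assms(1) bounded_by_cochain[OF assms(2)] S]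
      bounded_by_coboundary[OF assms(2), of S] down_in_subset[OF assms(1)]
    by (auto simp: restr_def)
qed

text \<open>The obstruction to extending \<open>c\<close> is its coboundary, a cocycle on
  \<open>\<S> - \<D>\<close> one degree higher; this is the connecting map.\<close>

lemma cocycle_extension:
  assumes down: "down_in \<D> \<S>" and U: "acyclic_at (\<S> - \<D>) (Suc p)" and conv: "convex_family \<S>"
    and c: "cocycle \<D> (Suc p) c"
  shows "\<exists>c'. cocycle \<S> (Suc p) c' \<and> restr \<D> c' = c"
proof -
  note DS = down_in_subset[OF down]
  have cS: "cochain \<S> (Suc p) c" by (rule cochain_mono[OF cocycle_cochain[OF c] DS])
  have "cocycle (\<S> - \<D>) (Suc (Suc p)) (restr \<S> (coboundary c))"
  proof (rule cocycleI)
    show "cochain (\<S> - \<D>) (Suc (Suc p)) (restr \<S> (coboundary c))"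
      by (rule cochain_vanishing[OF cochain_restr_coboundary[OF cS convex_family_finite[OF conv]]])
         (simp_all add: cocycle_coboundary[OF c] restr_def)
    show "coboundary (restr \<S> (coboundary c)) S = 0" if "S \<in> \<S> - \<D>" for S
      using that coboundary_restr_coboundary[OF conv cS] by simp
  qed
  then obtain e where e: "bounded_by (\<S> - \<D>) (Suc p) (restr \<S> (coboundary c)) e"
    using acyclic_atD[OF U] by blast
  have "cocycle \<S> (Suc p) (\<lambda>S. c S - e S)"
  proof (rule cocycleI)
    show "cochain \<S> (Suc p) (\<lambda>S. c S - e S)"
      by (rule cochain_diff[OF cS cochain_mono[OF bounded_by_cochain[OF e] Diff_subset]])
    show "coboundary (\<lambda>S. c S - e S) S = 0" if "S \<in> \<S>" for S
    proof (cases "S \<in> \<D>")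
      case True
      then show ?thesis
        using cocycle_coboundary[OF c True] coboundary_up_zero[OF down bounded_by_cochain[OF e] True]
        by (simp add: coboundary_diff)
    next
      case False
      then show ?thesis
        using that bounded_by_coboundary[OF e, of S] by (simp add: coboundary_diff restr_def)
    qed
  qed
  moreover have "restr \<D> (\<lambda>S. c S - e S) = c"
  proof
    fix S show "restr \<D> (\<lambda>S. c S - e S) S = c S"
      using cochain_outside[OF bounded_by_cochain[OF e], of S] cochain_outside[OF cocycle_cochain[OF c], of S]
      by (simp add: restr_def)
  qed
  ultimately show ?thesis by blast
qed

text \<open>Exactness at the quotient: a cocycle on \<open>\<D>\<close> extends to
  \<open>\<S>\<close>, is bounded there, and the solution restricts.\<close>

lemma acyclic_at_down:
  assumes down: "down_in \<D> \<S>" and S: "acyclic_at \<S> p" and U: "acyclic_at (\<S> - \<D>) (Suc p)"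
    and conv: "convex_family \<S>"
  shows "acyclic_at \<D> p"
proof (rule acyclic_atI)
  fix c assume c: "cocycle \<D> (Suc p) c"
  note DS = down_in_subset[OF down]
  from cocycle_extension[OF down U conv c]
  obtain c' where c'c: "cocycle \<S> (Suc p) c' \<and> restr \<D> c' = c" ..
  note c' = conjunct1[OF c'c] conjunct2[OF c'c]
  obtain e where e: "bounded_by \<S> p c' e"
    using acyclic_atD[OF S c'(1)] by blast
  have "bounded_by \<D> p c (restr \<D> e)"
  proof (rule bounded_byI)
    show "cochain \<D> p (restr \<D> e)" by (rule cochain_restr[OF bounded_by_cochain[OF e]])
    fix S assume S: "S \<in> \<D>"
    have "coboundary (restr \<D> e) S = c' S"
      using coboundary_restr_down[OF down bounded_by_cochain[OF e] S] bounded_by_coboundary[OF e] DS S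
      by auto
    then show "coboundary (restr \<D> e) S = c S"
      using S c'(2)[symmetric] by (simp add: restr_def)
  qed
  then show "\<exists>e. bounded_by \<D> p c e" by blast
qed

text \<open>Exactness at the kernel: a solution on \<open>\<S>\<close> may be nonzero on
  \<open>\<D>\<close>, but it is a cocycle there and can be removed by a coboundary.\<close>

lemma acyclic_at_up:
  assumes down: "down_in \<D> \<S>" and S: "acyclic_at \<S> (Suc p)" and D: "acyclic_at \<D> p"
    and conv: "convex_family \<S>"
  shows "acyclic_at (\<S> - \<D>) (Suc p)"
proof (rule acyclic_atI)
  fix c assume c: "cocycle (\<S> - \<D>) (Suc (Suc p)) c"
  note DS = down_in_subset[OF down]
  have "cocycle \<S> (Suc (Suc p)) c"
  proof (rule cocycleI)
    show "cochain \<S> (Suc (Suc p)) c" by (rule cochain_mono[OF cocycle_cochain[OF c] Diff_subset])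
    fix S assume "S \<in> \<S>"
    then show "coboundary c S = 0"
      using cocycle_coboundary[OF c, of S] coboundary_up_zero[OF down cocycle_cochain[OF c], of S]
      by (cases "S \<in> \<D>") auto
  qed
  then obtain e where e: "bounded_by \<S> (Suc p) c e"
    using acyclic_atD[OF S] by blast
  have "cocycle \<D> (Suc p) (restr \<D> e)"
  proof (rule cocycleI)
    show "cochain \<D> (Suc p) (restr \<D> e)" by (rule cochain_restr[OF bounded_by_cochain[OF e]])
    fix S assume S: "S \<in> \<D>"
    have "coboundary (restr \<D> e) S = c S"
      using coboundary_restr_down[OF down bounded_by_cochain[OF e] S] bounded_by_coboundary[OF e] DS S
      by auto
    also have "c S = 0"
      using cochain_outside[OF cocycle_cochain[OF c], of S] S by simp
    finally show "coboundary (restr \<D> e) S = 0" .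
  qed
  then obtain z where z: "bounded_by \<D> p (restr \<D> e) z"
    using acyclic_atD[OF D] by blast
  have zS: "cochain \<S> p z" by (rule cochain_mono[OF bounded_by_cochain[OF z] DS])
  have zD: "S \<in> \<S> \<and> coboundary z S = e S" if "S \<in> \<D>" for S
    using bounded_by_coboundary[OF z that] that DS by (auto simp: restr_def)
  have "bounded_by (\<S> - \<D>) (Suc p) c (\<lambda>S. e S - restr \<S> (coboundary z) S)"
  proof (rule bounded_byI)
    show "cochain (\<S> - \<D>) (Suc p) (\<lambda>S. e S - restr \<S> (coboundary z) S)"
      by (rule cochain_minus_coboundary[OF conv bounded_by_cochain[OF e] zS zD])
    fix S assume "S \<in> \<S> - \<D>"
    then show "coboundary (\<lambda>S. e S - restr \<S> (coboundary z) S) S = c S"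
      using bounded_by_coboundary[OF e, of S] coboundary_restr_coboundary[OF conv zS, of S]
      by (simp add: coboundary_diff)
  qed
  then show "\<exists>e. bounded_by (\<S> - \<D>) (Suc p) c e" by blast
qed


text \<open>Geometrically, the charts of \<open>\<Theta>\<close> cover the locus where
  \<open>g\<close> is invertible. Quantifying over \<open>M\<close> builds in that powers of the
  generators have the same radical, which is what clears denominators of any order.\<close>

definition radical_over :: "'i set \<Rightarrow> 'a \<Rightarrow> bool" where
  "radical_over \<Theta> g \<longleftrightarrow> (\<forall>M. \<exists>N r. (\<forall>\<theta>\<in>\<Theta>. r \<theta> \<in> R) \<and> g ^ N = (\<Sum>\<theta>\<in>\<Theta>. r \<theta> * f \<theta> ^ M))"

lemma radical_over_mult:
  assumes "radical_over \<Theta> g" "h \<in> R"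
  shows "radical_over \<Theta> (g * h)"
  unfolding radical_over_def
proof
  fix M
  obtain N r where r: "\<forall>\<theta>\<in>\<Theta>. r \<theta> \<in> R" "g ^ N = (\<Sum>\<theta>\<in>\<Theta>. r \<theta> * f \<theta> ^ M)"
    using assms(1) unfolding radical_over_def by metis
  have "(g * h) ^ N = (\<Sum>\<theta>\<in>\<Theta>. (r \<theta> * h ^ N) * f \<theta> ^ M)"
    unfolding power_mult_distrib r(2) sum_distrib_right by (simp only: mult_ac)
  moreover have "\<forall>\<theta>\<in>\<Theta>. r \<theta> * h ^ N \<in> R"
    using r(1) assms(2) by (simp add: mult_closed power_closed)
  ultimately show "\<exists>N r. (\<forall>\<theta>\<in>\<Theta>. r \<theta> \<in> R) \<and> (g * h) ^ N = (\<Sum>\<theta>\<in>\<Theta>. r \<theta> * f \<theta> ^ M)"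
    by (intro exI[of _ N] exI[of _ "\<lambda>\<theta>. r \<theta> * h ^ N"]) blast
qed

lemma uniform_exponent:
  assumes "finite \<L>" "\<And>S. c S \<in> localization S"
  obtains M where "\<And>S. S \<in> \<L> \<Longrightarrow> prod f S ^ M * c S \<in> R"
proof -
  have "\<forall>S. \<exists>N. prod f S ^ N * c S \<in> R"
    using assms(2) unfolding localization_def by blast
  then obtain n where n: "\<And>S. prod f S ^ n S * c S \<in> R" by metis
  show thesis
  proof (rule that[of "Max (n ` \<L>)"])
    fix S assume "S \<in> \<L>"
    then show "prod f S ^ Max (n ` \<L>) * c S \<in> R"
      using assms(1) by (intro localization_mono_exp[OF n]) auto
  qed
qed

text \<open>
  When the product over \<open>S - \<Theta>\<close> is in the radical of the ideal of \<open>\<Theta>\<close>, say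
  \<open>g ^ N = (\<Sum>\<theta>\<in>\<Theta>. r \<theta> * f \<theta> ^ M)\<close>, the average of the contractions
  \<open>c \<mapsto> (\<lambda>S. \<plusminus> c (insert \<theta> S))\<close> with weights \<open>r \<theta> * f \<theta> ^ M / g ^ N\<close> is a contraction; the
  factor \<open>f \<theta> ^ M\<close> clears the denominator at \<open>\<theta>\<close>.
\<close>

lemma acyclic_at_layer:
  assumes fin: "finite \<L>" "\<And>S. S \<in> \<L> \<Longrightarrow> finite S" "finite \<Theta>"
    and ins: "\<And>S \<theta>. S \<in> \<L> \<Longrightarrow> \<theta> \<in> \<Theta> \<Longrightarrow> insert \<theta> S \<in> \<L>"
    and del: "\<And>S \<theta>. S \<in> \<L> \<Longrightarrow> \<theta> \<in> \<Theta> \<Longrightarrow> S - {\<theta>} \<in> \<L>"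
    and out: "\<And>S i. S \<in> \<L> \<Longrightarrow> i \<in> S - \<Theta> \<Longrightarrow> S - {i} \<notin> \<L>"
    and rad: "\<And>S. S \<in> \<L> \<Longrightarrow> radical_over \<Theta> (prod f (S - \<Theta>))"
  shows "acyclic_at \<L> p"
proof (rule acyclic_atI)
  fix c assume c: "cocycle \<L> (Suc p) c"
  note cc = cocycle_cochain[OF c]
  obtain M where M: "\<And>S. S \<in> \<L> \<Longrightarrow> prod f S ^ M * c S \<in> R"
    by (rule uniform_exponent[OF fin(1) cochain_localization[OF cc]]) blast
  have "\<forall>P. \<exists>N r. radical_over \<Theta> (prod f P) \<longrightarrow>
      (\<forall>\<theta>\<in>\<Theta>. r \<theta> \<in> R) \<and> prod f P ^ N = (\<Sum>\<theta>\<in>\<Theta>. r \<theta> * f \<theta> ^ M)"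
    unfolding radical_over_def by metis
  then obtain N r where Nr: "\<And>P. radical_over \<Theta> (prod f P) \<Longrightarrow>
      (\<forall>\<theta>\<in>\<Theta>. r P \<theta> \<in> R) \<and> prod f P ^ N P = (\<Sum>\<theta>\<in>\<Theta>. r P \<theta> * f \<theta> ^ M)"
    by metis
  define w where "w = (\<lambda>P \<theta>. r P \<theta> * f \<theta> ^ M)"
  define G where "G = (\<lambda>P. inverse (prod f P ^ N P))"
  have wG: "G (S - \<Theta>) * (\<Sum>\<theta>\<in>\<Theta>. w (S - \<Theta>) \<theta>) = 1" if "S \<in> \<L>" for S
  proof -
    have "(\<Sum>\<theta>\<in>\<Theta>. w (S - \<Theta>) \<theta>) = prod f (S - \<Theta>) ^ N (S - \<Theta>)"
      using Nr[OF rad[OF that]] by (simp add: w_def)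
    then show ?thesis using prod_f_nonzero[of "S - \<Theta>"] by (simp add: G_def)
  qed
  \<comment> \<open>The contraction at \<open>\<theta>\<close> is 0 on sets that already contain
    \<open>\<theta>\<close>, hence the sum over \<open>\<Theta> - S\<close>.\<close>
  define e where "e = restr {S \<in> \<L>. card S = p}
    (\<lambda>S. G (S - \<Theta>) * (\<Sum>\<theta>\<in>\<Theta> - S. w (S - \<Theta>) \<theta> * (pos_sign \<theta> (insert \<theta> S) * c (insert \<theta> S))))"
  have "bounded_by \<L> p c e"
  proof (rule bounded_byI)
    have "e S \<in> localization S" for S
    proof (cases "S \<in> \<L> \<and> card S = p")
      case True
      then have S: "S \<in> \<L>" by blast
      have "G (S - \<Theta>) \<in> localization (S - \<Theta>)"
        using prod_f_nonzero one_closed by (intro localizationI[of _ "N (S - \<Theta>)"]) (simp add: G_def)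
      then have G: "G (S - \<Theta>) \<in> localization S"
        by (rule localization_mono[OF _ Diff_subset fin(2)[OF S]])
      have "w (S - \<Theta>) \<theta> * (pos_sign \<theta> (insert \<theta> S) * c (insert \<theta> S)) \<in> localization S"
        if "\<theta> \<in> \<Theta> - S" for \<theta>
      proof (rule localizationI)
        have "prod f (insert \<theta> S) = f \<theta> * prod f S"
          using that fin(2)[OF S] by simp
        then have "prod f S ^ M * (w (S - \<Theta>) \<theta> * (pos_sign \<theta> (insert \<theta> S) * c (insert \<theta> S))) =
            (r (S - \<Theta>) \<theta> * pos_sign \<theta> (insert \<theta> S)) * (prod f (insert \<theta> S) ^ M * c (insert \<theta> S))"
          by (simp add: w_def power_mult_distrib mult_ac)
        also have "\<dots> \<in> R"
          using Nr[OF rad[OF S]] that M[OF ins[OF S, of \<theta>]]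
          by (auto intro: mult_closed pos_sign_closed)
        finally show "prod f S ^ M * (w (S - \<Theta>) \<theta> * (pos_sign \<theta> (insert \<theta> S) * c (insert \<theta> S))) \<in> R" .
      qed
      then have "G (S - \<Theta>) * (\<Sum>\<theta>\<in>\<Theta> - S. w (S - \<Theta>) \<theta> * (pos_sign \<theta> (insert \<theta> S) * c (insert \<theta> S)))
          \<in> localization S"
        by (intro localization_mult[OF G localization_sum])
      then show ?thesis
        using True by (simp add: e_def restr_def)
    next
      case False
      then have "e S = 0" by (auto simp: e_def restr_def)
      then show ?thesis by (simp add: localization_zero)
    qed
    then show "cochain \<L> p e"
      unfolding cochain_def by (auto simp: e_def restr_def)
    fix S assume S: "S \<in> \<L>"
    note finS = fin(2)[OF S]
    show "coboundary e S = c S"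
    proof (cases "card S = Suc p")
      case False
      have "e (S - {i}) = 0" if "i \<in> S" for i
        using False that finS card_Suc_Diff1[OF finS that] by (auto simp: e_def restr_def)
      then show ?thesis
        using cochain_card[OF cc False] by (simp add: coboundary_def)
    next
      case True
      define P where "P = S - \<Theta>"
      \<comment> \<open>The cocycle condition at \<open>insert \<theta> S\<close> expresses
        \<open>c S\<close> by the remaining faces. Those that lose a label outside
        \<open>\<Theta>\<close> leave the layer and contribute 0.\<close>
      have inner: "(\<Sum>i\<in>S \<inter> \<Theta>. pos_sign i S * (pos_sign \<theta> (insert \<theta> (S - {i})) * c (insert \<theta> (S - {i})))) = c S"
        if \<theta>: "\<theta> \<in> \<Theta> - S" for \<theta>
      proof -
        define T where "T = insert \<theta> S"
        have T: "T \<in> \<L>" "T - {\<theta>} = S" "finite T" "\<theta> \<in> T"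
          using ins[OF S] \<theta> finS by (auto simp: T_def)
        have split: "T = insert \<theta> ((S \<inter> \<Theta>) \<union> (S - \<Theta>))" by (auto simp: T_def)
        have "c (T - {i}) = 0" if "i \<in> S - \<Theta>" for i
          using out[OF T(1), of i] that cochain_outside[OF cc] by (auto simp: T_def)
        then have z: "(\<Sum>i\<in>S - \<Theta>. pos_sign i T * c (T - {i})) = 0" by simp
        have "0 = coboundary c T" using cocycle_coboundary[OF c T(1)] by simp
        also have "\<dots> = pos_sign \<theta> T * c S + (\<Sum>i\<in>(S \<inter> \<Theta>) \<union> (S - \<Theta>). pos_sign i T * c (T - {i}))"
          unfolding coboundary_def by (subst (1) split) (use finS \<theta> T(2) in auto)
        also have "(\<Sum>i\<in>(S \<inter> \<Theta>) \<union> (S - \<Theta>). pos_sign i T * c (T - {i})) =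
            (\<Sum>i\<in>S \<inter> \<Theta>. pos_sign i T * c (T - {i}))"
          using finS z by (subst sum.union_disjoint) auto
        finally have dT: "(\<Sum>i\<in>S \<inter> \<Theta>. pos_sign i T * c (T - {i})) = - (pos_sign \<theta> T * c S)"
          by (simp add: eq_neg_iff_add_eq_0 add.commute)
        have sg: "pos_sign i S * pos_sign \<theta> (insert \<theta> (S - {i})) = - (pos_sign \<theta> T * pos_sign i T)"
          and Ti: "insert \<theta> (S - {i}) = T - {i}" if i: "i \<in> S" for i
        proof -
          define Q where "Q = S - {i}"
          have Q: "S = insert i Q" "finite Q" "i \<notin> Q" "\<theta> \<notin> Q" "i \<noteq> \<theta>"
            using i \<theta> finS by (auto simp: Q_def)
          then have Q6: "i < \<theta> \<or> \<theta> < i" by (simp add: neq_iff)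
          have "pos_sign i S = pos_sign i Q" "pos_sign \<theta> (insert \<theta> Q) = pos_sign \<theta> Q"
            "pos_sign \<theta> T = (if i < \<theta> then - pos_sign \<theta> Q else pos_sign \<theta> Q)"
            "pos_sign i T = (if \<theta> < i then - pos_sign i Q else pos_sign i Q)"
            using Q(2-5) by (auto simp: Q(1) T_def pos_sign_insert)
          then show "pos_sign i S * pos_sign \<theta> (insert \<theta> (S - {i})) = - (pos_sign \<theta> T * pos_sign i T)"
            using Q6 unfolding Q_def[symmetric] by (auto simp: mult_ac dest: less_asym)
          show "insert \<theta> (S - {i}) = T - {i}" using Q(5) by (auto simp: T_def)
        qed
        have "(\<Sum>i\<in>S \<inter> \<Theta>. pos_sign i S * (pos_sign \<theta> (insert \<theta> (S - {i})) * c (insert \<theta> (S - {i})))) =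
            (\<Sum>i\<in>S \<inter> \<Theta>. - (pos_sign \<theta> T * (pos_sign i T * c (T - {i}))))"
        proof (rule sum.cong[OF refl])
          fix i assume "i \<in> S \<inter> \<Theta>"
          then have i: "i \<in> S" by blast
          have "pos_sign i S * (pos_sign \<theta> (insert \<theta> (S - {i})) * c (insert \<theta> (S - {i}))) =
              (pos_sign i S * pos_sign \<theta> (insert \<theta> (S - {i}))) * c (T - {i})"
            by (simp add: Ti[OF i])
          then show "pos_sign i S * (pos_sign \<theta> (insert \<theta> (S - {i})) * c (insert \<theta> (S - {i}))) =
              - (pos_sign \<theta> T * (pos_sign i T * c (T - {i})))"
            unfolding sg[OF i] by simp
        qed
        also have "\<dots> = c S"
          by (simp add: sum_negf sum_distrib_left[symmetric] dT pos_sign_square')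
        finally show ?thesis .
      qed
      \<comment> \<open>After the removal of \<open>i\<close>, the label \<open>i\<close> is itself
        available for insertion; it restores \<open>S\<close> and yields the extra summand.\<close>
      have outer: "(\<Sum>\<theta>\<in>\<Theta> - (S - {i}). w P \<theta> * (pos_sign \<theta> (insert \<theta> (S - {i})) * c (insert \<theta> (S - {i})))) =
          w P i * (pos_sign i S * c S) +
          (\<Sum>\<theta>\<in>\<Theta> - S. w P \<theta> * (pos_sign \<theta> (insert \<theta> (S - {i})) * c (insert \<theta> (S - {i}))))"
        if "i \<in> S \<inter> \<Theta>" for i
      proof -
        have "\<Theta> - (S - {i}) = insert i (\<Theta> - S)" "insert i (S - {i}) = S" using that by auto
        then show ?thesis using that fin(3) by simp
      qed
      have "e (S - {i}) = 0" if "i \<in> S - \<Theta>" for i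
        using out[OF S that] by (simp add: e_def restr_def)
      then have "coboundary e S = (\<Sum>i\<in>S \<inter> \<Theta>. pos_sign i S * e (S - {i}))"
        unfolding coboundary_def by (intro sum.mono_neutral_right finS) auto
      also have "\<dots> = (\<Sum>i\<in>S \<inter> \<Theta>. G P * (w P i * c S + (\<Sum>\<theta>\<in>\<Theta> - S. w P \<theta> *
          (pos_sign i S * (pos_sign \<theta> (insert \<theta> (S - {i})) * c (insert \<theta> (S - {i})))))))"
      proof (rule sum.cong[OF refl])
        fix i assume i: "i \<in> S \<inter> \<Theta>"
        have "S - {i} \<in> \<L>" "card (S - {i}) = p" "S - {i} - \<Theta> = P"
          using del[OF S] i True card_Suc_Diff1[OF finS, of i] by (auto simp: P_def)
        then have "e (S - {i}) = G P * (w P i * (pos_sign i S * c S) +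
          (\<Sum>\<theta>\<in>\<Theta> - S. w P \<theta> * (pos_sign \<theta> (insert \<theta> (S - {i})) * c (insert \<theta> (S - {i})))))"
          by (simp add: e_def restr_def outer[OF i])
        then show "pos_sign i S * e (S - {i}) = G P * (w P i * c S + (\<Sum>\<theta>\<in>\<Theta> - S. w P \<theta> *
          (pos_sign i S * (pos_sign \<theta> (insert \<theta> (S - {i})) * c (insert \<theta> (S - {i}))))))"
          by (simp add: distrib_left sum_distrib_left mult.left_commute[of "pos_sign i S"] pos_sign_square')
      qed
      also have "\<dots> = G P * ((\<Sum>i\<in>S \<inter> \<Theta>. w P i * c S) + (\<Sum>i\<in>S \<inter> \<Theta>. \<Sum>\<theta>\<in>\<Theta> - S. w P \<theta> *
          (pos_sign i S * (pos_sign \<theta> (insert \<theta> (S - {i})) * c (insert \<theta> (S - {i}))))))"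
        by (simp only: sum_distrib_left[symmetric] sum.distrib)
      also have "(\<Sum>i\<in>S \<inter> \<Theta>. \<Sum>\<theta>\<in>\<Theta> - S. w P \<theta> *
          (pos_sign i S * (pos_sign \<theta> (insert \<theta> (S - {i})) * c (insert \<theta> (S - {i}))))) =
          (\<Sum>\<theta>\<in>\<Theta> - S. w P \<theta> * c S)"
        by (subst sum.swap) (simp add: sum_distrib_left[symmetric] inner)
      \<comment> \<open>Labels in \<open>S \<inter> \<Theta>\<close> contribute by reinsertion,
        those in \<open>\<Theta> - S\<close> by the cocycle condition, so every weight occurs
        exactly once.\<close>
      also have "(\<Sum>i\<in>S \<inter> \<Theta>. w P i * c S) + (\<Sum>\<theta>\<in>\<Theta> - S. w P \<theta> * c S) = (\<Sum>\<theta>\<in>\<Theta>. w P \<theta>) * c S"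
        using sum.Int_Diff[OF fin(3), of "w P" S]
        by (simp only: sum_distrib_right[symmetric] distrib_right[symmetric] Int_commute)
      also have "G P * ((\<Sum>\<theta>\<in>\<Theta>. w P \<theta>) * c S) = c S"
        using wG[OF S] by (simp add: P_def mult.assoc[symmetric])
      finally show ?thesis .
    qed
  qed
  then show "\<exists>e. bounded_by \<L> p c e" by blast
qed

text \<open>Iterated relative complexes: adding \<open>\<Theta>\<close> to \<open>\<M>\<close>
  passes to the kernel of the restriction from the charts \<open>\<Omega>\<close> to the charts
  \<open>\<Omega> - \<Theta>\<close>, by \<open>meeting_Diff\<close>.\<close>

definition meeting :: "'i set \<Rightarrow> 'i set set \<Rightarrow> 'i set set" where
  "meeting \<Omega> \<M> = {S. S \<subseteq> \<Omega> \<and> (\<forall>M\<in>\<M>. S \<inter> M \<noteq> {})}"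

lemma meeting_Diff: "meeting \<Omega> \<M> - meeting (\<Omega> - \<Theta>) \<M> = meeting \<Omega> (insert \<Theta> \<M>)"
  unfolding meeting_def by blast

lemma down_in_meeting: "down_in (meeting (\<Omega> - \<Theta>) \<M>) (meeting \<Omega> \<M>)"
  unfolding down_in_def meeting_def by blast

lemma convex_meeting:
  assumes "finite \<Omega>"
  shows "convex_family (meeting \<Omega> \<M>)"
proof -
  have "S - {i} \<in> meeting \<Omega> \<M>" if "S \<in> meeting \<Omega> \<M>" "S - {i} - {j} \<in> meeting \<Omega> \<M>" for S i j
    using that unfolding meeting_def by blast
  moreover have "finite S" if "S \<in> meeting \<Omega> \<M>" for S
    using that finite_subset[OF _ assms] unfolding meeting_def by blast
  ultimately show ?thesis unfolding convex_family_def by blast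
qed

text \<open>Filter by the number of labels outside \<open>\<Theta>\<close>. Since
  \<open>\<Theta>\<close> is disjoint from the members of \<open>\<M>\<close>, labels of
  \<open>\<Theta>\<close> can be inserted and removed freely within a layer, while removing any
  other label leaves it. So \<open>acyclic_at_layer\<close> handles each layer, and gluing does the
  rest.\<close>

lemma acyclic_at_meeting:
  assumes fin: "finite \<Omega>" and \<Theta>: "\<Theta> \<subseteq> \<Omega>" "\<And>M. M \<in> \<M> \<Longrightarrow> M \<inter> \<Theta> = {}"
    and rad: "\<And>P. P \<in> meeting (\<Omega> - \<Theta>) \<M> \<Longrightarrow> radical_over \<Theta> (prod f P)"
  shows "acyclic_at (meeting \<Omega> \<M>) p"
proof -
  define \<F> where "\<F> = (\<lambda>k. {S \<in> meeting \<Omega> \<M>. card (S - \<Theta>) < k})"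
  have finS: "finite S" "S \<subseteq> \<Omega>" if "S \<in> meeting \<Omega> \<M>" for S
    using that finite_subset[OF _ fin] unfolding meeting_def by auto
  have finM: "finite (meeting \<Omega> \<M>)"
    by (rule finite_subset[of _ "Pow \<Omega>"]) (use finS(2) fin in auto)
  have P: "S - \<Theta> \<in> meeting (\<Omega> - \<Theta>) \<M>" if "S \<in> meeting \<Omega> \<M>" for S
    using that \<Theta>(2) unfolding meeting_def by blast
  have card_less: "card (S - {i} - \<Theta>) < card (S - \<Theta>)" if "S \<in> meeting \<Omega> \<M>" "i \<in> S - \<Theta>" for S i
    using that finS(1) by (intro psubset_card_mono) auto
  have card_le: "card (S - {i} - \<Theta>) \<le> card (S - \<Theta>)" if "S \<in> meeting \<Omega> \<M>" for S i
    using that finS(1) by (intro card_mono) auto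
  have "acyclic_at (\<F> k) p" for k
  proof (induction k)
    case 0
    have "bounded_by {} p c (\<lambda>_. 0)" for c
      by (simp add: bounded_by_def cochain_def localization_zero)
    then show ?case by (auto simp: \<F>_def acyclic_at_def)
  next
    case (Suc k)
    have sub: "\<F> k \<subseteq> \<F> (Suc k)" by (auto simp: \<F>_def)
    have down: "down_in (\<F> k) (\<F> (Suc k))"
      unfolding down_in_def
    proof (intro conjI ballI impI)
      fix S i assume "S \<in> \<F> k" "S - {i} \<in> \<F> (Suc k)"
      then show "S - {i} \<in> \<F> k"
        using card_le[of S i] by (simp add: \<F>_def)
    qed (rule sub)
    have conv: "convex_family (\<F> (Suc k))"
      unfolding convex_family_def
    proof (intro ballI conjI allI impI)
      fix S assume S: "S \<in> \<F> (Suc k)"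
      then show "finite S" using finS(1) by (simp add: \<F>_def)
      fix i j assume "S - {i} - {j} \<in> \<F> (Suc k)"
      then have "S - {i} \<in> meeting \<Omega> \<M>"
        using S convex_meeting[OF fin, of \<M>] unfolding convex_family_def \<F>_def by blast
      then show "S - {i} \<in> \<F> (Suc k)"
        using S card_le[of S i] by (simp add: \<F>_def)
    qed
    have layer: "\<F> (Suc k) - \<F> k = {S \<in> meeting \<Omega> \<M>. card (S - \<Theta>) = k}"
      by (auto simp: \<F>_def)
    have "acyclic_at (\<F> (Suc k) - \<F> k) p"
      unfolding layer
    proof (rule acyclic_at_layer[where \<Theta> = \<Theta>])
      show "finite {S \<in> meeting \<Omega> \<M>. card (S - \<Theta>) = k}" using finM by simp
      show "finite \<Theta>" by (rule finite_subset[OF \<Theta>(1) fin])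
      fix S assume "S \<in> {S \<in> meeting \<Omega> \<M>. card (S - \<Theta>) = k}"
      then have S: "S \<in> meeting \<Omega> \<M>" "card (S - \<Theta>) = k" by auto
      show "finite S" by (rule finS(1)[OF S(1)])
      show "radical_over \<Theta> (prod f (S - \<Theta>))" by (rule rad[OF P[OF S(1)]])
      show "S - {i} \<notin> {S \<in> meeting \<Omega> \<M>. card (S - \<Theta>) = k}" if "i \<in> S - \<Theta>" for i
        using card_less[OF S(1) that] S(2) by simp
      fix \<theta> assume \<theta>: "\<theta> \<in> \<Theta>"
      have eq: "insert \<theta> S - \<Theta> = S - \<Theta>" "S - {\<theta>} - \<Theta> = S - \<Theta>" using \<theta> by auto
      have "insert \<theta> S \<in> meeting \<Omega> \<M>" "S - {\<theta>} \<in> meeting \<Omega> \<M>"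
        using S(1) \<theta> \<Theta> unfolding meeting_def by blast+
      then show "insert \<theta> S \<in> {S \<in> meeting \<Omega> \<M>. card (S - \<Theta>) = k}"
        "S - {\<theta>} \<in> {S \<in> meeting \<Omega> \<M>. card (S - \<Theta>) = k}"
        using eq S(2) by simp_all
    qed
    then show ?case
      by (rule acyclic_at_glue[OF down Suc.IH _ conv])
  qed
  moreover have "\<F> (Suc (card \<Omega>)) = meeting \<Omega> \<M>"
  proof -
    have "card (S - \<Theta>) < Suc (card \<Omega>)" if "S \<in> meeting \<Omega> \<M>" for S
      using finS(2)[OF that] fin by (intro le_imp_less_Suc card_mono) auto
    then show ?thesis by (auto simp: \<F>_def)
  qed
  ultimately show ?thesis by metis
qed


section \<open>The Mayer-Vietoris argument\<close>

lemma radical_over_prod_mem: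
  assumes "finite P" "i \<in> P" "radical_over \<Theta> (f i)"
  shows "radical_over \<Theta> (prod f P)"
  using radical_over_mult[OF assms(3) prod_f_closed[of "P - {i}"]] prod.remove[OF assms(1,2), of f]
  by simp

lemma radical_over_prod_mem2:
  assumes "finite P" "i \<in> P" "j \<in> P" "i \<noteq> j" "radical_over \<Theta> (f i * f j)"
  shows "radical_over \<Theta> (prod f P)"
proof -
  have "prod f P = f i * f j * prod f (P - {i} - {j})"
    using assms(1-4) prod.remove[of P i f] prod.remove[of "P - {i}" j f] by (simp add: mult_ac)
  then show ?thesis
    using radical_over_mult[OF assms(5) prod_f_closed[of "P - {i} - {j}"]] by simp
qed

text \<open>Every set of the family meets \<open>M\<close>, so each product has a factor in the
  radical.\<close>

lemma acyclic_at_meeting_mem: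
  assumes "finite \<Omega>" "\<Theta> \<subseteq> \<Omega>" "\<And>N. N \<in> \<M> \<Longrightarrow> N \<inter> \<Theta> = {}"
    and M: "M \<in> \<M>" "\<And>i. i \<in> M \<Longrightarrow> i \<in> \<Omega> \<Longrightarrow> radical_over \<Theta> (f i)"
  shows "acyclic_at (meeting \<Omega> \<M>) p"
proof (rule acyclic_at_meeting[OF assms(1-3)])
  fix P assume P: "P \<in> meeting (\<Omega> - \<Theta>) \<M>"
  then have "P \<subseteq> \<Omega>" by (auto simp: meeting_def)
  obtain i where "i \<in> P \<inter> M" using P M(1) unfolding meeting_def by blast
  then show "radical_over \<Theta> (prod f P)"
    using \<open>P \<subseteq> \<Omega>\<close> assms(1) M(2)
    by (intro radical_over_prod_mem[of P i]) (auto intro: finite_subset)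
qed

text \<open>This is the form in which counting charts gives vanishing.\<close>

lemma acyclic_at_card:
  assumes "\<And>S. S \<in> \<S> \<Longrightarrow> card S \<noteq> Suc p"
  shows "acyclic_at \<S> p"
proof (rule acyclic_atI)
  fix c assume c: "cocycle \<S> (Suc p) c"
  have "c S = 0" if "S \<in> \<S>" for S
    by (rule cochain_card[OF cocycle_cochain[OF c] assms[OF that]])
  then have "bounded_by \<S> p c (\<lambda>_. 0)"
    by (intro bounded_byI) (simp_all add: cochain_def localization_zero coboundary_def)
  then show "\<exists>e. bounded_by \<S> p c e" by blast
qed

lemma meeting_Diff_eq:
  "\<Omega> - \<Theta> = \<Omega>' \<Longrightarrow> meeting \<Omega> \<M> - meeting \<Omega>' \<M> = meeting \<Omega> (insert \<Theta> \<M>)"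
  using meeting_Diff by blast

lemma down_in_meeting_subset: "\<Omega>' \<subseteq> \<Omega> \<Longrightarrow> down_in (meeting \<Omega>' \<M>) (meeting \<Omega> \<M>)"
  using down_in_meeting[of \<Omega> "\<Omega> - \<Omega>'" \<M>] by (simp add: double_diff)

text \<open>\<open>A\<close>, \<open>B\<close> and \<open>F\<close> label equations. In terms of
  zero sets, \<open>rX\<close> says that the two pieces meet only where the functions of
  \<open>X\<close> vanish, \<open>rAB\<close> and \<open>rF\<close> that \<open>F\<close> cuts out
  their union, \<open>rA\<close> and \<open>rB\<close> that they contain the axes of
  \<open>i\<close> and \<open>j\<close>. The group that vanishes has degree \<open>card X\<close>,
  the top degree.\<close>

lemma acyclic_at_Pow_if_separated:
  assumes fin: "finite X" "finite A" "finite B" "finite F"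
    and disj: "X \<inter> A = {}" "X \<inter> B = {}" "A \<inter> B = {}" "A \<inter> F = {}" "B \<inter> F = {}"
    and card: "card X = Suc (Suc q)" "card F \<le> q"
    and ij: "i \<in> X" "j \<in> X"
    and rX: "\<And>x. x \<in> X \<Longrightarrow> radical_over (A \<union> B) (f x)"
    and rAB: "\<And>a b. a \<in> A \<Longrightarrow> b \<in> B \<Longrightarrow> radical_over F (f a * f b)"
    and rF: "\<And>k. k \<in> F \<Longrightarrow> radical_over A (f k)" "\<And>k. k \<in> F \<Longrightarrow> radical_over B (f k)"
    and rA: "\<And>a. a \<in> A \<Longrightarrow> radical_over (X - {i}) (f a)"
    and rB: "\<And>b. b \<in> B \<Longrightarrow> radical_over (X - {j}) (f b)"
  shows "acyclic_at (meeting X {}) (Suc q)"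
proof (rule acyclic_atI)
  define \<Omega> where "\<Omega> = X \<union> (A \<union> B)"
  have fin\<Omega>: "finite \<Omega>" using fin by (simp add: \<Omega>_def)
  \<comment> \<open>\<open>F\<close> is too small to contain \<open>Suc q\<close> labels. The
    following steps transport this vanishing to the sets that meet both \<open>A\<close> and
    \<open>B\<close>: each use of \<open>acyclic_at_up\<close> raises the degree by one, and the
    final \<open>acyclic_at_down\<close> lowers it by one.\<close>
  have "acyclic_at (meeting F {F}) q"
  proof (rule acyclic_at_card)
    fix S assume "S \<in> meeting F {F}"
    then have "card S \<le> card F" using fin(4) by (intro card_mono) (auto simp: meeting_def)
    then show "card S \<noteq> Suc q" using card(2) by simp
  qed
  moreover have "acyclic_at (meeting (B \<union> F) {F}) (Suc q)"
    by (rule acyclic_at_meeting_mem[of _ B _ F]) (use fin disj rF in auto)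
  moreover have "meeting (B \<union> F) {F} - meeting F {F} = meeting (B \<union> F) {B, F}"
    using disj by (intro meeting_Diff_eq) auto
  ultimately have BF: "acyclic_at (meeting (B \<union> F) {B, F}) (Suc q)"
    using acyclic_at_up[OF down_in_meeting_subset[of F "B \<union> F" "{F}"]] convex_meeting[of "B \<union> F"] fin
    by simp
  moreover have "acyclic_at (meeting (A \<union> B \<union> F) {B, F}) (Suc (Suc q))"
    by (rule acyclic_at_meeting_mem[of _ A _ F]) (use fin disj rF in auto)
  moreover have "meeting (A \<union> B \<union> F) {B, F} - meeting (B \<union> F) {B, F} = meeting (A \<union> B \<union> F) {A, B, F}"
    using disj by (intro meeting_Diff_eq) auto
  ultimately have "acyclic_at (meeting (A \<union> B \<union> F) {A, B, F}) (Suc (Suc q))"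
    using acyclic_at_up[OF down_in_meeting_subset[of "B \<union> F" "A \<union> B \<union> F" "{B, F}"]]
      convex_meeting[of "A \<union> B \<union> F"] fin by (simp add: Un_assoc)
  moreover have "acyclic_at (meeting (A \<union> B \<union> F) {A, B}) (Suc q)"
  proof (rule acyclic_at_meeting[of _ F])
    fix P assume P: "P \<in> meeting (A \<union> B \<union> F - F) {A, B}"
    then have "P \<inter> A \<noteq> {}" "P \<inter> B \<noteq> {}" by (simp_all add: meeting_def)
    then obtain a b where "a \<in> P" "a \<in> A" "b \<in> P" "b \<in> B" by blast
    moreover have "finite P"
      using P fin by (intro finite_subset[of P "A \<union> B \<union> F"]) (auto simp: meeting_def)
    ultimately show "radical_over F (prod f P)"
      using rAB disj by (intro radical_over_prod_mem2[of P a b]) auto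
  qed (use fin disj in auto)
  moreover have "meeting (A \<union> B \<union> F) {A, B} - meeting (A \<union> B) {A, B} = meeting (A \<union> B \<union> F) {F, A, B}"
    using disj by (intro meeting_Diff_eq) auto
  moreover have "{F, A, B} = {A, B, F}" by auto
  ultimately have AB: "acyclic_at (meeting (A \<union> B) {A, B}) (Suc q)"
    using acyclic_at_down[OF down_in_meeting_subset[of "A \<union> B" "A \<union> B \<union> F" "{A, B}"]]
      convex_meeting[of "A \<union> B \<union> F"] fin by simp
  \<comment> \<open>The complement of an axis: \<open>X - {k}\<close> has one chart too few for this
    degree, and the charts in \<open>C\<close> do not enlarge the union.\<close>
  have part: "acyclic_at (meeting (X - {k} \<union> C) {}) (Suc q)"
    if "k \<in> X" "finite C" "X \<inter> C = {}" "\<And>c. c \<in> C \<Longrightarrow> radical_over (X - {k}) (f c)" for k C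
  proof (rule acyclic_at_glue[OF down_in_meeting_subset])
    show "acyclic_at (meeting (X - {k}) {}) (Suc q)"
    proof (rule acyclic_at_card)
      fix S assume "S \<in> meeting (X - {k}) {}"
      then have "card S \<le> card (X - {k})" using fin(1) by (intro card_mono) (auto simp: meeting_def)
      then show "card S \<noteq> Suc (Suc q)" using card(1) that(1) fin(1) by simp
    qed
    have "meeting (X - {k} \<union> C) {} - meeting (X - {k}) {} = meeting (X - {k} \<union> C) {C}"
      using that by (intro meeting_Diff_eq) auto
    moreover have "acyclic_at (meeting (X - {k} \<union> C) {C}) (Suc q)"
      by (rule acyclic_at_meeting_mem[of _ "X - {k}" _ C]) (use that fin in auto)
    ultimately show "acyclic_at (meeting (X - {k} \<union> C) {} - meeting (X - {k}) {}) (Suc q)" by simp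
  qed (use fin that in \<open>auto intro: convex_meeting\<close>)
  have X\<Omega>: "acyclic_at (meeting \<Omega> {X}) (Suc q)"
    by (rule acyclic_at_meeting_mem[of _ "A \<union> B" _ X]) (use fin\<Omega> disj rX in \<open>auto simp: \<Omega>_def\<close>)
  \<comment> \<open>Vanishing one degree higher, as needed for extending a cocycle from
    \<open>X\<close> to all charts.\<close>
  have AB\<Omega>: "acyclic_at (meeting \<Omega> {A \<union> B}) (Suc (Suc q))"
  proof (rule acyclic_at_glue[OF down_in_meeting_subset])
    show "acyclic_at (meeting (X \<union> B) {A \<union> B}) (Suc (Suc q))"
      by (rule acyclic_at_meeting_mem[of _ "X - {j}" _ "A \<union> B"]) (use fin disj rB in auto)
    have "meeting \<Omega> {A \<union> B} - meeting (X \<union> B) {A \<union> B} = meeting \<Omega> {A, A \<union> B}"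
      using disj by (intro meeting_Diff_eq) (auto simp: \<Omega>_def)
    moreover have "acyclic_at (meeting \<Omega> {A, A \<union> B}) (Suc (Suc q))"
      by (rule acyclic_at_meeting_mem[of _ "X - {i}" _ A]) (use fin\<Omega> disj rA in \<open>auto simp: \<Omega>_def\<close>)
    ultimately show "acyclic_at (meeting \<Omega> {A \<union> B} - meeting (X \<union> B) {A \<union> B}) (Suc (Suc q))" by simp
  qed (use fin\<Omega> in \<open>auto intro: convex_meeting simp: \<Omega>_def\<close>)
  fix c assume c: "cocycle (meeting X {}) (Suc (Suc q)) c"
  have downX: "down_in (meeting X {}) (meeting \<Omega> {})"
    and downAB: "down_in (meeting (A \<union> B) {}) (meeting \<Omega> {})"
    by (rule down_in_meeting_subset; simp add: \<Omega>_def)+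
  have diff: "meeting \<Omega> {} - meeting X {} = meeting \<Omega> {A \<union> B}"
    "meeting \<Omega> {} - meeting (A \<union> B) {} = meeting \<Omega> {X}"
    using disj by (intro meeting_Diff_eq; auto simp: \<Omega>_def)+
  have "acyclic_at (meeting \<Omega> {} - meeting X {}) (Suc (Suc q))" unfolding diff by (rule AB\<Omega>)
  from cocycle_extension[OF downX this convex_meeting[OF fin\<Omega>] c]
  obtain c' where c'c: "cocycle (meeting \<Omega> {}) (Suc (Suc q)) c' \<and> restr (meeting X {}) c' = c" ..
  note c' = conjunct1[OF c'c]
  \<comment> \<open>Restriction to the charts \<open>C\<close> factors through
    \<open>X - {k} \<union> C\<close>, where every cocycle of this degree is bounded.\<close>
  have bounded_part: "\<exists>e. bounded_by (meeting C {}) (Suc q) (restr (meeting C {}) c') e"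
    if "k \<in> X" "C \<subseteq> A \<union> B" "\<And>c. c \<in> C \<Longrightarrow> radical_over (X - {k}) (f c)" for k C
  proof -
    have "finite C" "X \<inter> C = {}" using that fin disj by (auto intro: finite_subset)
    note acyc = part[OF that(1) this that(3)]
    have down: "down_in (meeting (X - {k} \<union> C) {}) (meeting \<Omega> {})"
      using that by (intro down_in_meeting_subset) (auto simp: \<Omega>_def)
    obtain e where e: "bounded_by (meeting (X - {k} \<union> C) {}) (Suc q) (restr (meeting (X - {k} \<union> C) {}) c') e"
      using acyclic_atD[OF acyc cocycle_restr_down[OF down c']] by blast
    have "restr (meeting C {}) (restr (meeting (X - {k} \<union> C) {}) c') = restr (meeting C {}) c'"
      by (auto simp: restr_def meeting_def fun_eq_iff)
    then show ?thesis
      using bounded_by_restr_down[OF down_in_meeting_subset e, of C] by auto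
  qed
  obtain eA where eA: "bounded_by (meeting A {}) (Suc q) (restr (meeting A {}) c') eA"
    using bounded_part[of i A] ij(1) rA by blast
  obtain eB where eB: "bounded_by (meeting B {}) (Suc q) (restr (meeting B {}) c') eB"
    using bounded_part[of j B] ij(2) rB by blast
  define \<D> where "\<D> = meeting A {} \<union> meeting B {}"
  have "bounded_by \<D> (Suc q) (restr \<D> (restr (meeting (A \<union> B) {}) c')) (\<lambda>S. eA S + eB S)"
  proof (rule bounded_byI)
    show "cochain \<D> (Suc q) (\<lambda>S. eA S + eB S)"
      unfolding \<D>_def
      by (intro cochain_add cochain_mono[OF bounded_by_cochain[OF eA] Un_upper1]
          cochain_mono[OF bounded_by_cochain[OF eB] Un_upper2])
    \<comment> \<open>A face of a subset of \<open>C\<close> that also lies in \<open>D\<close> is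
      empty, and the positive degree \<open>Suc q\<close> excludes the empty set. So the solutions
      on \<open>A\<close> and \<open>B\<close> do not disturb each other.\<close>
    have zero: "coboundary e S = 0"
      if e: "cochain (meeting D {}) (Suc q) e" and "S \<in> meeting C {}" "C \<inter> D = {}" for e S C D
      unfolding coboundary_def
    proof (intro sum.neutral ballI)
      fix k assume "k \<in> S"
      have "S - {k} \<notin> meeting D {} \<or> S - {k} = {}" using that(2,3) unfolding meeting_def by blast
      then have "e (S - {k}) = 0"
      proof
        assume "S - {k} = {}"
        then show ?thesis using cochain_card[OF e, of "{}"] unfolding \<open>S - {k} = {}\<close> by simp
      qed (rule cochain_outside[OF e])
      then show "pos_sign k S * e (S - {k}) = 0" by simp
    qed
    fix S assume S: "S \<in> \<D>"
    then have r: "restr \<D> (restr (meeting (A \<union> B) {}) c') S = c' S"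
      by (auto simp: restr_def \<D>_def meeting_def)
    show "coboundary (\<lambda>S. eA S + eB S) S = restr \<D> (restr (meeting (A \<union> B) {}) c') S"
    proof (cases "S \<in> meeting A {}")
      case True
      then show ?thesis
        using bounded_by_coboundary[OF eA True] zero[OF bounded_by_cochain[OF eB] True disj(3)] r
        by (simp add: coboundary_add restr_def)
    next
      case False
      then have SB: "S \<in> meeting B {}" using S by (simp add: \<D>_def)
      have "B \<inter> A = {}" using disj(3) by blast
      then show ?thesis
        using bounded_by_coboundary[OF eB SB] zero[OF bounded_by_cochain[OF eA] SB] SB r
        by (simp add: coboundary_add restr_def)
    qed
  qed
  moreover have "down_in \<D> (meeting (A \<union> B) {})"
    unfolding \<D>_def by (intro down_in_Un down_in_meeting_subset) auto
  moreover have "meeting (A \<union> B) {} - \<D> = meeting (A \<union> B) {A, B}"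
  proof -
    have "S \<subseteq> A \<union> B \<Longrightarrow> S \<subseteq> A \<longleftrightarrow> S \<inter> B = {}" "S \<subseteq> A \<union> B \<Longrightarrow> S \<subseteq> B \<longleftrightarrow> S \<inter> A = {}" for S
      using disj(3) by auto
    then show ?thesis unfolding \<D>_def meeting_def by auto
  qed
  ultimately have "\<exists>e. bounded_by (meeting (A \<union> B) {}) (Suc q) (restr (meeting (A \<union> B) {}) c') e"
    using bounded_by_extension[of \<D> "meeting (A \<union> B) {}" "Suc q"] AB
      cocycle_restr_down[OF downAB c'] convex_meeting[of "A \<union> B"] fin by simp
  then obtain e where e: "bounded_by (meeting (A \<union> B) {}) (Suc q) (restr (meeting (A \<union> B) {}) c') e"
    by blast
  \<comment> \<open>By \<open>rX\<close> the charts of \<open>X\<close> add nothing to the union of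
    those of \<open>A\<close> and \<open>B\<close>; the solution therefore extends to
    \<open>\<Omega>\<close>, from where it is restricted to \<open>X\<close>.\<close>
  have "acyclic_at (meeting \<Omega> {} - meeting (A \<union> B) {}) (Suc q)" unfolding diff by (rule X\<Omega>)
  then obtain e' where e': "bounded_by (meeting \<Omega> {}) (Suc q) c' e'"
    using bounded_by_extension[OF downAB _ convex_meeting[OF fin\<Omega>] c' e] by blast
  show "\<exists>e. bounded_by (meeting X {}) (Suc q) c e"
    using bounded_by_restr_down[OF downX e'] conjunct2[OF c'c] by auto
qed

end

section \<open>The Nullstellensatz\<close>

type_synonym 'k mpoly = "(nat \<Rightarrow>\<^sub>0 nat) \<Rightarrow>\<^sub>0 'k"

abbreviation mconst :: "'k::zero \<Rightarrow> 'k mpoly" where "mconst \<equiv> Poly_Mapping.single 0"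

abbreviation mvar :: "nat \<Rightarrow> 'k::zero_neq_one mpoly" where
  "mvar i \<equiv> Poly_Mapping.single (Poly_Mapping.single i (Suc 0)) 1"

definition monom_eval :: "(nat \<Rightarrow> 'k::comm_ring_1) \<Rightarrow> (nat \<Rightarrow>\<^sub>0 nat) \<Rightarrow> 'k" where
  "monom_eval v m = (\<Prod>i\<in>Poly_Mapping.keys m. v i ^ Poly_Mapping.lookup m i)"

definition meval :: "(nat \<Rightarrow> 'k::comm_ring_1) \<Rightarrow> 'k mpoly \<Rightarrow> 'k" where
  "meval v p = (\<Sum>m\<in>Poly_Mapping.keys p. Poly_Mapping.lookup p m * monom_eval v m)"

lemma monom_eval_superset:
  "finite A \<Longrightarrow> Poly_Mapping.keys m \<subseteq> A \<Longrightarrow> monom_eval v m = (\<Prod>i\<in>A. v i ^ Poly_Mapping.lookup m i)"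
  unfolding monom_eval_def by (intro prod.mono_neutral_left) (auto simp: in_keys_iff)

lemma monom_eval_add: "monom_eval v (m + n) = monom_eval v m * monom_eval v n"
proof -
  let ?A = "Poly_Mapping.keys m \<union> Poly_Mapping.keys n"
  have "monom_eval v (m + n) = (\<Prod>i\<in>?A. v i ^ Poly_Mapping.lookup (m + n) i)"
    by (intro monom_eval_superset) (auto dest: subsetD[OF keys_add])
  also have "\<dots> = monom_eval v m * monom_eval v n"
    by (simp add: lookup_add power_add prod.distrib monom_eval_superset[of ?A])
  finally show ?thesis .
qed

lemma meval_superset:
  "finite A \<Longrightarrow> Poly_Mapping.keys p \<subseteq> A \<Longrightarrow> meval v p = (\<Sum>m\<in>A. Poly_Mapping.lookup p m * monom_eval v m)"
  unfolding meval_def by (intro sum.mono_neutral_left) (auto simp: in_keys_iff)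

lemma meval_0 [simp]: "meval v 0 = 0"
  by (simp add: meval_def)

lemma meval_add [simp]: "meval v (p + q) = meval v p + meval v q"
proof -
  let ?A = "Poly_Mapping.keys p \<union> Poly_Mapping.keys q"
  have "meval v (p + q) = (\<Sum>m\<in>?A. Poly_Mapping.lookup (p + q) m * monom_eval v m)"
    by (intro meval_superset) (auto dest: subsetD[OF keys_add])
  also have "\<dots> = meval v p + meval v q"
    by (simp add: lookup_add distrib_right sum.distrib meval_superset[of ?A])
  finally show ?thesis .
qed

lemma meval_sum [simp]: "meval v (sum g A) = (\<Sum>x\<in>A. meval v (g x))"
  by (induction A rule: infinite_finite_induct) auto

lemma meval_single: "meval v (Poly_Mapping.single m a) = a * monom_eval v m"
  by (subst meval_superset[of "{m}"]) auto

lemma sum_single_lookup: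
  fixes p :: "'a \<Rightarrow>\<^sub>0 'b::comm_monoid_add"
  shows "(\<Sum>m\<in>Poly_Mapping.keys p. Poly_Mapping.single m (Poly_Mapping.lookup p m)) = p"
proof (rule poly_mapping_eqI)
  fix k
  show "Poly_Mapping.lookup (\<Sum>m\<in>Poly_Mapping.keys p. Poly_Mapping.single m (Poly_Mapping.lookup p m)) k =
      Poly_Mapping.lookup p k"
    by (simp add: lookup_sum lookup_single when_def in_keys_iff)
qed

lemma meval_mult [simp]: "meval v (p * q) = meval v p * meval v q"
proof -
  have "p * q = (\<Sum>m\<in>Poly_Mapping.keys p. \<Sum>n\<in>Poly_Mapping.keys q.
      Poly_Mapping.single (m + n) (Poly_Mapping.lookup p m * Poly_Mapping.lookup q n))"
    using arg_cong2[OF sum_single_lookup[of p] sum_single_lookup[of q], of "(*)"]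
    by (simp add: sum_product mult_single)
  then have "meval v (p * q) = (\<Sum>m\<in>Poly_Mapping.keys p. \<Sum>n\<in>Poly_Mapping.keys q.
      (Poly_Mapping.lookup p m * monom_eval v m) * (Poly_Mapping.lookup q n * monom_eval v n))"
    by (simp add: meval_single monom_eval_add mult_ac)
  then show ?thesis
    by (simp add: meval_def sum_product)
qed

lemma meval_mconst [simp]: "meval v (mconst c) = c"
  by (simp add: meval_single monom_eval_def)

lemma meval_1 [simp]: "meval v 1 = 1"
  using meval_mconst[of v 1] by simp

lemma meval_mvar [simp]: "meval v (mvar i) = v i"
  by (simp add: meval_single monom_eval_def)

lemma meval_minus [simp]: "meval v (- p) = - meval v p"
  using meval_add[of v p "- p"] by (simp add: eq_neg_iff_add_eq_0 add.commute del: meval_add)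

lemma meval_diff [simp]: "meval v (p - q) = meval v p - meval v q"
  using meval_add[of v p "- q"] by simp

lemma meval_power [simp]: "meval v (p ^ n) = meval v p ^ n"
  by (induction n) auto

lemma meval_prod [simp]: "meval v (prod g A) = (\<Prod>x\<in>A. meval v (g x))"
  by (induction A rule: infinite_finite_induct) auto

text \<open>The polynomial type has all variables at once; this set bounds their number, so that
  induction on \<open>n\<close> is possible without changing the type.\<close>

inductive_set mpolys_below :: "nat \<Rightarrow> 'k::comm_ring_1 mpoly set" for n where
  const: "mconst c \<in> mpolys_below n"
| var: "i < n \<Longrightarrow> mvar i \<in> mpolys_below n"
| add: "p \<in> mpolys_below n \<Longrightarrow> q \<in> mpolys_below n \<Longrightarrow> p + q \<in> mpolys_below n"
| mult: "p \<in> mpolys_below n \<Longrightarrow> q \<in> mpolys_below n \<Longrightarrow> p * q \<in> mpolys_below n"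

lemma mpolys_below_0: "0 \<in> mpolys_below n"
  using const[of 0] by simp

lemma mpolys_below_1: "1 \<in> mpolys_below n"
  using const[of 1] by simp

lemma mpolys_below_uminus: "p \<in> mpolys_below n \<Longrightarrow> - p \<in> mpolys_below n"
  using mult[OF const[of "- 1"]] by (simp add: single_uminus)

lemma mpolys_below_diff: "p \<in> mpolys_below n \<Longrightarrow> q \<in> mpolys_below n \<Longrightarrow> p - q \<in> mpolys_below n"
  using add[OF _ mpolys_below_uminus, of p n q] by simp

lemma meval_cong_below:
  "p \<in> mpolys_below n \<Longrightarrow> (\<And>i. i < n \<Longrightarrow> v i = w i) \<Longrightarrow> meval v p = meval w p"
  by (induction p rule: mpolys_below.induct) auto

lemma mpolys_below_0_eq: "p \<in> mpolys_below 0 \<Longrightarrow> \<exists>c. p = mconst c"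
proof (induction p rule: mpolys_below.induct)
  case (add p q)
  then show ?case by (metis single_add)
next
  case (mult p q)
  then show ?case by (metis mult_single add_0)
qed auto

section \<open>Ideals and primes\<close>

definition ideal_set :: "'a::comm_ring_1 set \<Rightarrow> bool" where
  "ideal_set I \<longleftrightarrow> 0 \<in> I \<and> (\<forall>x\<in>I. \<forall>y\<in>I. x + y \<in> I) \<and> (\<forall>x\<in>I. \<forall>r. r * x \<in> I)"

lemma ideal_setD:
  assumes "ideal_set I"
  shows "0 \<in> I" "x \<in> I \<Longrightarrow> y \<in> I \<Longrightarrow> x + y \<in> I" "x \<in> I \<Longrightarrow> r * x \<in> I" "x \<in> I \<Longrightarrow> x * r \<in> I"
    "x \<in> I \<Longrightarrow> y \<in> I \<Longrightarrow> x - y \<in> I"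
proof -
  show 1: "0 \<in> I" "x \<in> I \<Longrightarrow> y \<in> I \<Longrightarrow> x + y \<in> I" "x \<in> I \<Longrightarrow> r * x \<in> I" for x y r
    using assms unfolding ideal_set_def by blast+
  show "x \<in> I \<Longrightarrow> x * r \<in> I" using 1(3)[of x r] by (simp add: mult.commute)
  show "x \<in> I \<Longrightarrow> y \<in> I \<Longrightarrow> x - y \<in> I" using 1(2)[of x "- 1 * y"] 1(3)[of y "- 1"] by simp
qed

lemma ideal_set_sum: "ideal_set I \<Longrightarrow> (\<And>x. x \<in> A \<Longrightarrow> g x \<in> I) \<Longrightarrow> sum g A \<in> I"
  by (induction A rule: infinite_finite_induct) (auto intro: ideal_setD)

definition prime_ideal_set :: "'a::comm_ring_1 set \<Rightarrow> bool" where
  "prime_ideal_set P \<longleftrightarrow> ideal_set P \<and> 1 \<notin> P \<and> (\<forall>x y. x * y \<in> P \<longrightarrow> x \<in> P \<or> y \<in> P)"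

lemma prime_ideal_set_power: "prime_ideal_set P \<Longrightarrow> x \<notin> P \<Longrightarrow> x ^ n \<notin> P"
  by (induction n) (auto simp: prime_ideal_set_def)

text \<open>An ideal maximal among those without a power of \<open>p\<close> is prime: if
  \<open>a\<close> and \<open>b\<close> lie outside, then powers of \<open>p\<close> lie in
  \<open>P + (a)\<close> and in \<open>P + (b)\<close>, and their product lies in
  \<open>P + (a * b)\<close>.\<close>

lemma exists_prime_ideal_avoiding:
  assumes I: "ideal_set I" "\<And>N. p ^ N \<notin> I"
  obtains P where "prime_ideal_set P" "I \<subseteq> P" "p \<notin> P"
proof -
  define \<A> where "\<A> = {J. ideal_set J \<and> I \<subseteq> J \<and> (\<forall>N. p ^ N \<notin> J)}"
  have "\<exists>M\<in>\<A>. \<forall>X\<in>\<A>. M \<subseteq> X \<longrightarrow> X = M"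
  proof (rule subset_Zorn_nonempty)
    show "\<A> \<noteq> {}" using I unfolding \<A>_def by blast
    fix \<C> assume C: "\<C> \<noteq> {}" "subset.chain \<A> \<C>"
    then have CA: "J \<in> \<A>" if "J \<in> \<C>" for J using that unfolding subset.chain_def by blast
    have "x + y \<in> \<Union>\<C>" if xy: "x \<in> \<Union>\<C>" "y \<in> \<Union>\<C>" for x y
    proof -
      obtain J K where JK: "J \<in> \<C>" "K \<in> \<C>" "x \<in> J" "y \<in> K" using xy by blast
      then have "J \<subseteq> K \<or> K \<subseteq> J" using C(2) unfolding subset.chain_def by blast
      then obtain L where L: "L \<in> \<C>" "x \<in> L" "y \<in> L" using JK by blast
      then have "x + y \<in> L" using CA[OF L(1)] unfolding \<A>_def ideal_set_def by blast
      then show ?thesis using L(1) by blast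
    qed
    moreover have "r * x \<in> \<Union>\<C>" if "x \<in> \<Union>\<C>" for x r
      using that CA unfolding \<A>_def ideal_set_def by blast
    moreover obtain J where "J \<in> \<C>" using C(1) by blast
    ultimately show "\<Union>\<C> \<in> \<A>"
      using CA unfolding \<A>_def ideal_set_def by blast
  qed
  then obtain P where P: "P \<in> \<A>" "\<And>X. X \<in> \<A> \<Longrightarrow> P \<subseteq> X \<Longrightarrow> X = P" by blast
  have idP: "ideal_set P" and IP: "I \<subseteq> P" and pP: "\<And>N. p ^ N \<notin> P"
    using P(1) unfolding \<A>_def by auto
  have ext: "\<exists>N x r. x \<in> P \<and> p ^ N = x + r * a" if "a \<notin> P" for a
  proof (rule ccontr)
    assume no: "\<not> ?thesis"
    define Q where "Q = {x + r * a | x r. x \<in> P}"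
    have "ideal_set Q"
      unfolding ideal_set_def
    proof (intro conjI ballI allI)
      show "0 \<in> Q" unfolding Q_def using ideal_setD(1)[OF idP] by (force intro: exI[of _ 0])
      fix x assume x: "x \<in> Q"
      then obtain x' r where x': "x = x' + r * a" "x' \<in> P" unfolding Q_def by blast
      show "s * x \<in> Q" for s
        unfolding Q_def using ideal_setD(3)[OF idP x'(2), of s]
        by (intro CollectI exI[of _ "s * x'"] exI[of _ "s * r"]) (simp add: x'(1) algebra_simps)
      fix y assume "y \<in> Q"
      then obtain y' t where y': "y = y' + t * a" "y' \<in> P" unfolding Q_def by blast
      show "x + y \<in> Q"
        unfolding Q_def using ideal_setD(2)[OF idP x'(2) y'(2)]
        by (intro CollectI exI[of _ "x' + y'"] exI[of _ "r + t"]) (simp add: x'(1) y'(1) algebra_simps)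
    qed
    moreover have PQ: "P \<subseteq> Q"
    proof
      fix x assume "x \<in> P"
      then show "x \<in> Q" unfolding Q_def by (intro CollectI exI[of _ x] exI[of _ 0]) simp
    qed
    moreover have "p ^ N \<notin> Q" for N using no unfolding Q_def by blast
    ultimately have "Q \<in> \<A>" using IP unfolding \<A>_def by blast
    then have "Q = P" using P(2) PQ by blast
    moreover have "a \<in> Q"
      unfolding Q_def using ideal_setD(1)[OF idP] by (intro CollectI exI[of _ 0] exI[of _ 1]) simp
    ultimately show False using that by blast
  qed
  have "a \<in> P \<or> b \<in> P" if ab: "a * b \<in> P" for a b
  proof (rule ccontr)
    assume "\<not> ?thesis"
    then obtain N x r M y s where eq: "x \<in> P" "p ^ N = x + r * a" "y \<in> P" "p ^ M = y + s * b"
      using ext[of a] ext[of b] by blast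
    have "p ^ (N + M) = x * (y + s * b) + ((r * a) * y + (r * s) * (a * b))"
      by (simp add: power_add eq algebra_simps)
    also have "\<dots> \<in> P"
      using eq ab by (intro ideal_setD(2)[OF idP]) (auto intro: ideal_setD[OF idP])
    finally show False using pP by blast
  qed
  then have "prime_ideal_set P"
    using idP pP[of 0] unfolding prime_ideal_set_def by auto
  then show thesis using that IP pP[of 1] by auto
qed

lemma infinite_alg_closed_field: "infinite (UNIV :: 'k::alg_closed_field set)"
proof
  assume fin: "finite (UNIV :: 'k set)"
  \<comment> \<open>Over a finite field this polynomial is 1 everywhere although its degree is
    positive.\<close>
  define p where "p = (\<Prod>a\<in>(UNIV :: 'k set). [:- a, 1:]) + 1"
  have ev: "poly p x = 1" for x
  proof -
    have "(\<Prod>a\<in>(UNIV :: 'k set). x - a) = 0" using fin by (intro prod_zero) auto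
    then show ?thesis by (simp add: p_def poly_prod)
  qed
  have "degree (\<Prod>a\<in>(UNIV :: 'k set). [:- a, 1:]) = card (UNIV :: 'k set)"
    by (subst degree_prod_eq_sum_degree) auto
  moreover have "card (UNIV :: 'k set) > 0" using fin by (simp add: card_gt_0_iff)
  ultimately have "degree p > 0"
    unfolding p_def by (subst degree_add_eq_left) auto
  then obtain x where "poly p x = 0" using alg_closed_imp_poly_has_root by blast
  then show False using ev by simp
qed


section \<open>Polynomials over a subring, modulo a prime\<close>

definition coeffs_in :: "'a::comm_ring_1 set \<Rightarrow> 'a poly set" where
  "coeffs_in B = {q. \<forall>i. coeff q i \<in> B}"

definition subring_set :: "'a::comm_ring_1 set \<Rightarrow> bool" where
  "subring_set B \<longleftrightarrow> 1 \<in> B \<and> (\<forall>x\<in>B. \<forall>y\<in>B. x - y \<in> B \<and> x * y \<in> B)"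

lemma subring_setD:
  assumes "subring_set B"
  shows "1 \<in> B" "0 \<in> B" "x \<in> B \<Longrightarrow> y \<in> B \<Longrightarrow> x - y \<in> B" "x \<in> B \<Longrightarrow> y \<in> B \<Longrightarrow> x * y \<in> B"
    "x \<in> B \<Longrightarrow> y \<in> B \<Longrightarrow> x + y \<in> B"
proof -
  show 1: "1 \<in> B" "x \<in> B \<Longrightarrow> y \<in> B \<Longrightarrow> x - y \<in> B" "x \<in> B \<Longrightarrow> y \<in> B \<Longrightarrow> x * y \<in> B" for x y
    using assms unfolding subring_set_def by blast+
  show 0: "0 \<in> B" using 1(2)[OF 1(1) 1(1)] by simp
  show "x \<in> B \<Longrightarrow> y \<in> B \<Longrightarrow> x + y \<in> B" using 1(2)[of x "0 - y"] 1(2)[OF 0, of y] by simp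
qed

lemma subring_set_sum: "subring_set B \<Longrightarrow> (\<And>x. x \<in> A \<Longrightarrow> g x \<in> B) \<Longrightarrow> sum g A \<in> B"
  by (induction A rule: infinite_finite_induct) (auto intro: subring_setD)

lemma subring_set_power: "subring_set B \<Longrightarrow> x \<in> B \<Longrightarrow> x ^ n \<in> B"
  by (induction n) (auto intro: subring_setD)

lemma coeffs_in_closed:
  assumes "subring_set B"
  shows "q \<in> coeffs_in B \<Longrightarrow> s \<in> coeffs_in B \<Longrightarrow> q - s \<in> coeffs_in B"
    and "q \<in> coeffs_in B \<Longrightarrow> s \<in> coeffs_in B \<Longrightarrow> q + s \<in> coeffs_in B"
    and "q \<in> coeffs_in B \<Longrightarrow> s \<in> coeffs_in B \<Longrightarrow> q * s \<in> coeffs_in B"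
    and "a \<in> B \<Longrightarrow> q \<in> coeffs_in B \<Longrightarrow> smult a q \<in> coeffs_in B"
    and "a \<in> B \<Longrightarrow> monom a n \<in> coeffs_in B"
    and "a \<in> B \<Longrightarrow> [:a:] \<in> coeffs_in B"
    and "0 \<in> coeffs_in B" and "1 \<in> coeffs_in B"
  using subring_setD[OF assms]
  by (auto simp: coeffs_in_def coeff_mult coeff_pCons one_pCons split: nat.splits
      intro: subring_set_sum[OF assms])

lemma lead_coeff_in: "q \<in> coeffs_in B \<Longrightarrow> lead_coeff q \<in> B"
  by (simp add: coeffs_in_def)

text \<open>A power of the leading coefficient takes the place of its inverse, which need not lie in
  \<open>B\<close>.\<close>

lemma pseudo_division_coeffs_in:
  fixes g :: "'a::idom poly"
  assumes B: "subring_set B" and g: "g \<in> coeffs_in B" "g \<noteq> 0"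
  shows "q \<in> coeffs_in B \<Longrightarrow> \<exists>k s r. s \<in> coeffs_in B \<and> r \<in> coeffs_in B \<and>
    smult (lead_coeff g ^ k) q = s * g + r \<and> (r = 0 \<or> degree r < degree g)"
proof (induction "degree q" arbitrary: q rule: less_induct)
  case less
  note cl = coeffs_in_closed[OF B]
  show ?case
  proof (cases "q = 0 \<or> degree q < degree g")
    case True
    then show ?thesis
      using less.prems cl(7) by (intro exI[of _ 0] exI[of _ 0] exI[of _ q]) auto
  next
    case False
    define h where "h = monom (lead_coeff q) (degree q - degree g)"
    define q' where "q' = smult (lead_coeff g) q - h * g"
    have h: "h \<in> coeffs_in B" unfolding h_def by (rule cl(5)[OF lead_coeff_in[OF less.prems]])
    have q': "q' \<in> coeffs_in B"
      unfolding q'_def by (intro cl(1,3,4) h g(1) less.prems lead_coeff_in)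
    have "coeff (h * g) (degree q) = lead_coeff q * lead_coeff g"
      using False by (simp add: h_def coeff_monom_mult)
    then have c0: "coeff q' (degree q) = 0"
      by (simp add: q'_def)
    have "degree (h * g) \<le> degree q"
      using False degree_mult_le[of h g] degree_monom_le[of "lead_coeff q" "degree q - degree g"]
      unfolding h_def by linarith
    then have "degree q' \<le> degree q"
      unfolding q'_def using degree_smult_le[of "lead_coeff g" q] by (intro degree_diff_le) auto
    then have deg: "q' = 0 \<or> degree q' < degree q"
      using c0 by (metis le_neq_implies_less leading_coeff_0_iff)
    show ?thesis
    proof (cases "q' = 0")
      case True
      then show ?thesis
        using h cl(7) by (intro exI[of _ 1] exI[of _ h] exI[of _ 0]) (auto simp: q'_def)
    next
      case False
      then obtain k s r where ksr: "s \<in> coeffs_in B" "r \<in> coeffs_in B"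
          "smult (lead_coeff g ^ k) q' = s * g + r" "r = 0 \<or> degree r < degree g"
        using less.hyps[OF _ q'] deg by blast
      have "smult (lead_coeff g ^ Suc k) q = smult (lead_coeff g ^ k) (q' + h * g)"
        by (simp add: q'_def mult.commute)
      also have "\<dots> = (s + smult (lead_coeff g ^ k) h) * g + r"
        by (simp add: smult_add_right ksr(3) algebra_simps)
      finally have "smult (lead_coeff g ^ Suc k) q = (s + smult (lead_coeff g ^ k) h) * g + r" .
      moreover have "s + smult (lead_coeff g ^ k) h \<in> coeffs_in B"
        by (intro cl(2,4) ksr h subring_set_power[OF B] lead_coeff_in g)
      ultimately show ?thesis using ksr by blast
    qed
  qed
qed

lemma poly_coeffs_in_ideal: "ideal_set P \<Longrightarrow> q \<in> coeffs_in P \<Longrightarrow> poly q x \<in> P"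
  unfolding poly_altdef by (rule ideal_set_sum) (auto simp: coeffs_in_def intro: ideal_setD)

text \<open>This stands in for reduction modulo \<open>P\<close> without a quotient type: dropping
  the top coefficients that lie in \<open>P\<close> makes the leading one nonzero modulo
  \<open>P\<close> and changes values only by elements of \<open>P\<close>.\<close>

lemma truncate_modulo_ideal:
  assumes P: "ideal_set P" and B: "subring_set B" and q: "q \<in> coeffs_in B" "q \<notin> coeffs_in P"
  obtains q' where "q' \<in> coeffs_in B" "lead_coeff q' \<notin> P" "degree q' \<le> degree q"
    "poly q x - poly q' x \<in> P"
proof -
  define I where "I = {i. coeff q i \<notin> P}"
  have I: "I \<noteq> {}" "\<And>i. i \<in> I \<Longrightarrow> i \<le> degree q"
    using q(2) ideal_setD(1)[OF P] by (auto simp: I_def coeffs_in_def intro: le_degree)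
  then have finI: "finite I" by (auto intro: finite_subset[of _ "{..degree q}"])
  define n where "n = Max I"
  have n: "coeff q n \<notin> P" "n \<le> degree q" "\<And>i. i > n \<Longrightarrow> coeff q i \<in> P"
  proof -
    have "n \<in> I" unfolding n_def by (rule Max_in[OF finI I(1)])
    then show "coeff q n \<notin> P" "n \<le> degree q" using I(2) by (auto simp: I_def)
    show "coeff q i \<in> P" if "i > n" for i
      using Max_ge[OF finI, of i] that unfolding n_def[symmetric] by (fastforce simp: I_def)
  qed
  define q' where "q' = poly_cutoff (Suc n) q"
  have cn: "coeff q' n \<noteq> 0" using n(1) ideal_setD(1)[OF P] by (auto simp: q'_def coeff_poly_cutoff)
  have deg: "degree q' = n"
    by (rule antisym[OF degree_le le_degree[OF cn]]) (simp add: q'_def coeff_poly_cutoff)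
  show thesis
  proof
    show "q' \<in> coeffs_in B"
      using q(1) subring_setD(2)[OF B] by (simp add: coeffs_in_def q'_def coeff_poly_cutoff)
    show "lead_coeff q' \<notin> P" unfolding deg using n(1) by (simp add: q'_def coeff_poly_cutoff)
    show "degree q' \<le> degree q" using deg n(2) by simp
    have "q - q' \<in> coeffs_in P"
      using n(3) ideal_setD(1)[OF P] by (auto simp: coeffs_in_def q'_def coeff_poly_cutoff)
    then show "poly q x - poly q' x \<in> P"
      using poly_coeffs_in_ideal[OF P, of "q - q'" x] by simp
  qed
qed

definition ring_map :: "('a::comm_ring_1 \<Rightarrow> 'b::comm_ring_1) \<Rightarrow> bool" where
  "ring_map \<phi> \<longleftrightarrow> \<phi> 1 = 1 \<and> (\<forall>x y. \<phi> (x + y) = \<phi> x + \<phi> y \<and> \<phi> (x * y) = \<phi> x * \<phi> y)"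

lemma ring_mapD:
  assumes "ring_map \<phi>"
  shows "\<phi> 1 = 1" "\<phi> 0 = 0" "\<phi> (x + y) = \<phi> x + \<phi> y" "\<phi> (x * y) = \<phi> x * \<phi> y" "\<phi> (x ^ n) = \<phi> x ^ n"
proof -
  show 1: "\<phi> 1 = 1" "\<phi> (x + y) = \<phi> x + \<phi> y" "\<phi> (x * y) = \<phi> x * \<phi> y" for x y
    using assms unfolding ring_map_def by blast+
  show "\<phi> 0 = 0" using 1(2)[of 0 0] by simp
  show "\<phi> (x ^ n) = \<phi> x ^ n" by (induction n) (simp_all add: 1)
qed

lemma ring_map_sum: "ring_map \<phi> \<Longrightarrow> \<phi> (sum g A) = (\<Sum>x\<in>A. \<phi> (g x))"
  by (induction A rule: infinite_finite_induct) (auto simp: ring_mapD)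

lemma map_poly_ring_map:
  assumes "ring_map \<phi>"
  shows "map_poly \<phi> (p + q) = map_poly \<phi> p + map_poly \<phi> q"
    "map_poly \<phi> (p * q) = map_poly \<phi> p * map_poly \<phi> q"
    "map_poly \<phi> (smult a p) = smult (\<phi> a) (map_poly \<phi> p)"
  by (auto intro!: poly_eqI simp: coeff_map_poly coeff_mult ring_mapD[OF assms] ring_map_sum[OF assms])

text \<open>
  Here \<open>\<phi>\<close> is a point of the base \<open>B / P\<close> and \<open>t\<close> a lift of it to the algebra generated by \<open>x\<close>. If \<open>x\<close> is transcendental modulo \<open>P\<close>, then \<open>a\<close> is a coefficient of \<open>qb\<close>;
  otherwise a lift is a root of a minimal equation \<open>q0\<close> of \<open>x\<close>, and \<open>a\<close> combines the leading
  coefficient of \<open>q0\<close> with a nonzero constant in the ideal generated by \<open>qb\<close> modulo \<open>P\<close>.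
\<close>

lemma point_extension_step:
  fixes x :: "'a::idom" and P B :: "'a set"
  assumes P: "prime_ideal_set P" and B: "subring_set B"
    and qb: "qb \<in> coeffs_in B" "poly qb x \<notin> P"
  obtains a where "a \<in> B" "a \<notin> P"
    "\<And>\<phi> :: 'a \<Rightarrow> 'k::alg_closed_field. ring_map \<phi> \<Longrightarrow> (\<And>y. y \<in> B \<inter> P \<Longrightarrow> \<phi> y = 0) \<Longrightarrow> \<phi> a \<noteq> 0 \<Longrightarrow>
      \<exists>t. (\<forall>q\<in>coeffs_in B. poly q x \<in> P \<longrightarrow> poly (map_poly \<phi> q) t = 0) \<and> poly (map_poly \<phi> qb) t \<noteq> 0"
proof -
  have idP: "ideal_set P" and prime: "\<And>y z. y * z \<in> P \<Longrightarrow> y \<in> P \<or> z \<in> P"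
    using P unfolding prime_ideal_set_def by auto
  note iP = ideal_setD[OF idP] and cl = coeffs_in_closed[OF B]
  have map0: "map_poly \<phi> q = 0"
    if "ring_map \<phi>" "\<And>y. y \<in> B \<inter> P \<Longrightarrow> \<phi> y = 0" "q \<in> coeffs_in B" "q \<in> coeffs_in P"
    for \<phi> :: "'a \<Rightarrow> 'k" and q
    using that ring_mapD(2)[OF that(1)] by (intro poly_eqI) (auto simp: coeff_map_poly coeffs_in_def)
  have nb: "qb \<notin> coeffs_in P" using qb(2) poly_coeffs_in_ideal[OF idP] by blast
  show thesis
  proof (cases "\<forall>q\<in>coeffs_in B. poly q x \<in> P \<longrightarrow> q \<in> coeffs_in P")
    case True
    \<comment> \<open>The transcendental case: every \<open>t\<close> satisfies the equations, so it
      only has to avoid the finitely many roots of \<open>map_poly \<phi> qb\<close>.\<close>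
    obtain j where j: "coeff qb j \<notin> P" using nb unfolding coeffs_in_def by blast
    show thesis
    proof (rule that[of "coeff qb j"])
      show "coeff qb j \<in> B" using qb(1) by (simp add: coeffs_in_def)
      show "coeff qb j \<notin> P" by (rule j)
      fix \<phi> :: "'a \<Rightarrow> 'k"
      assume \<phi>: "ring_map \<phi>" "\<And>y. y \<in> B \<inter> P \<Longrightarrow> \<phi> y = 0" "\<phi> (coeff qb j) \<noteq> 0"
      have "coeff (map_poly \<phi> qb) j \<noteq> 0"
        using \<phi>(3) ring_mapD(2)[OF \<phi>(1)] by (simp add: coeff_map_poly)
      then have "map_poly \<phi> qb \<noteq> 0" by auto
      then have "finite {t. poly (map_poly \<phi> qb) t = 0}" by (rule poly_roots_finite)
      then obtain t where "poly (map_poly \<phi> qb) t \<noteq> 0"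
        using infinite_alg_closed_field[where 'k = 'k] by (metis (mono_tags, lifting) ex_new_if_finite mem_Collect_eq)
      moreover have "poly (map_poly \<phi> q) t = 0" if "q \<in> coeffs_in B" "poly q x \<in> P" for q
        using map0[OF \<phi>(1,2)] that True by auto
      ultimately show "\<exists>t. (\<forall>q\<in>coeffs_in B. poly q x \<in> P \<longrightarrow> poly (map_poly \<phi> q) t = 0) \<and>
          poly (map_poly \<phi> qb) t \<noteq> 0" by blast
    qed
  next
    case False
    \<comment> \<open>Modulo \<open>P\<close>, \<open>Z\<close> describes the nonzero polynomials
      that vanish at \<open>x\<close>, and \<open>Y\<close> those whose value at \<open>x\<close> is
      a multiple of that of \<open>qb\<close>. Members of minimal degree play the roles of the
      minimal polynomial of \<open>x\<close> and of its gcd with \<open>qb\<close>.\<close>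
    define Z where "Z = (\<lambda>q. q \<in> coeffs_in B \<and> lead_coeff q \<notin> P \<and> poly q x \<in> P)"
    define Y where "Y = (\<lambda>q. q \<in> coeffs_in B \<and> lead_coeff q \<notin> P \<and>
      (\<exists>s\<in>coeffs_in B. poly q x - poly s x * poly qb x \<in> P))"
    have truncZ: "\<exists>q'. Z q' \<and> degree q' \<le> degree q"
      if q: "q \<in> coeffs_in B" "q \<notin> coeffs_in P" "poly q x \<in> P" for q
    proof -
      obtain q' where q': "q' \<in> coeffs_in B" "lead_coeff q' \<notin> P" "degree q' \<le> degree q"
          "poly q x - poly q' x \<in> P"
        using truncate_modulo_ideal[OF idP B q(1,2)] .
      then have "poly q' x \<in> P" using iP(5)[OF q(3) q'(4)] by simp
      then show ?thesis using q' unfolding Z_def by blast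
    qed
    have truncY: "\<exists>q'. Y q' \<and> degree q' \<le> degree q"
      if q: "q \<in> coeffs_in B" "q \<notin> coeffs_in P" "s \<in> coeffs_in B" "poly q x - poly s x * poly qb x \<in> P" for q s
    proof -
      obtain q' where q': "q' \<in> coeffs_in B" "lead_coeff q' \<notin> P" "degree q' \<le> degree q"
          "poly q x - poly q' x \<in> P"
        using truncate_modulo_ideal[OF idP B q(1,2)] .
      then have "poly q' x - poly s x * poly qb x \<in> P" using iP(5)[OF q(4) q'(4)] by simp
      then show ?thesis using q' q(3) unfolding Y_def by blast
    qed
    have "\<exists>q. Z q" using False truncZ by blast
    then obtain q0 where q0: "Z q0" "\<And>q. Z q \<Longrightarrow> degree q0 \<le> degree q"
      using ex_has_least_nat[of Z _ degree] by metis
    have "\<exists>q. Y q" using truncY[OF qb(1) nb cl(8)] iP(1) by auto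
    then obtain q1 where q1: "Y q1" "\<And>q. Y q \<Longrightarrow> degree q1 \<le> degree q"
      using ex_has_least_nat[of Y _ degree] by metis
    define c0 c1 where "c0 = lead_coeff q0" and "c1 = lead_coeff q1"
    have q0': "q0 \<in> coeffs_in B" "c0 \<notin> P" "poly q0 x \<in> P" "q0 \<noteq> 0" "c0 \<in> B"
      using q0(1) iP(1) lead_coeff_in unfolding Z_def c0_def by auto
    obtain s1 where q1': "q1 \<in> coeffs_in B" "c1 \<notin> P" "q1 \<noteq> 0" "c1 \<in> B"
      and s1: "s1 \<in> coeffs_in B" "poly q1 x - poly s1 x * poly qb x \<in> P"
    proof -
      have "q1 \<in> coeffs_in B" "lead_coeff q1 \<notin> P" using q1(1) unfolding Y_def by auto
      moreover obtain s where "s \<in> coeffs_in B" "poly q1 x - poly s x * poly qb x \<in> P"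
        using q1(1) unfolding Y_def by blast
      moreover have "q1 \<noteq> 0" using \<open>lead_coeff q1 \<notin> P\<close> iP(1) by auto
      ultimately show thesis using that lead_coeff_in unfolding c1_def by blast
    qed
    have deg0: "degree q0 > 0"
    proof (rule ccontr)
      assume "\<not> ?thesis"
      then obtain c where "q0 = [:c:]" by (auto elim: degree_eq_zeroE)
      then show False using q0'(2,3) by (simp add: c0_def)
    qed
    have rem0: "r \<in> coeffs_in P"
      if h: "q \<in> coeffs_in B" "poly q x \<in> P" "smult (c0 ^ k) q = s * q0 + r" "r \<in> coeffs_in B"
        "r = 0 \<or> degree r < degree q0" for q k s r
    proof (rule ccontr)
      assume nr: "r \<notin> coeffs_in P"
      have "poly r x = c0 ^ k * poly q x - poly s x * poly q0 x"
        using arg_cong[OF h(3), of "\<lambda>p. poly p x"] by simp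
      then have "poly r x \<in> P" using h(2) q0'(3) by (simp add: iP)
      then obtain q' where "Z q'" "degree q' \<le> degree r" using truncZ[OF h(4) nr] by blast
      moreover have "r \<noteq> 0" using nr iP(1) by (auto simp: coeffs_in_def)
      ultimately show False using q0(2)[of q'] h(5) by simp
    qed
    have rem1: "r \<in> coeffs_in P"
      if h: "r \<in> coeffs_in B" "s \<in> coeffs_in B" "poly r x - poly s x * poly qb x \<in> P"
        "r = 0 \<or> degree r < degree q1" for r s
    proof (rule ccontr)
      assume nr: "r \<notin> coeffs_in P"
      then obtain q' where "Y q'" "degree q' \<le> degree r" using truncY[OF h(1) nr h(2,3)] by blast
      moreover have "r \<noteq> 0" using nr iP(1) by (auto simp: coeffs_in_def)
      ultimately show False using q1(2)[of q'] h(4) by simp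
    qed
    \<comment> \<open>The minimal polynomial is irreducible, so the gcd is constant: modulo
      \<open>P\<close> and up to a power of \<open>c1\<close>, \<open>q0 = s * q1\<close>. As
      \<open>P\<close> is prime, \<open>x\<close> is a root of \<open>s\<close>, whose degree is too
      small, or of \<open>q1\<close>; then \<open>q1\<close> divides \<open>qb\<close> as well and
      forces \<open>poly qb x \<in> P\<close>.\<close>
    have deg1: "degree q1 = 0"
    proof (rule ccontr)
      assume pos: "degree q1 \<noteq> 0"
      obtain k s r where ksr: "s \<in> coeffs_in B" "r \<in> coeffs_in B" "smult (c1 ^ k) q0 = s * q1 + r"
          "r = 0 \<or> degree r < degree q1"
        using pseudo_division_coeffs_in[OF B q1'(1,3) q0'(1)] unfolding c1_def by blast
      have r_eq: "poly r x = c1 ^ k * poly q0 x - poly s x * poly q1 x"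
        using arg_cong[OF ksr(3), of "\<lambda>p. poly p x"] by simp
      have "poly r x - poly (0 - s * s1) x * poly qb x =
          c1 ^ k * poly q0 x - poly s x * (poly q1 x - poly s1 x * poly qb x)"
        by (simp add: r_eq algebra_simps)
      also have "\<dots> \<in> P" using q0'(3) s1(2) by (simp add: iP)
      finally have rP: "r \<in> coeffs_in P"
        using ksr s1 by (intro rem1[of r "0 - s * s1"] cl(1,3,7))
      then have "poly s x * poly q1 x \<in> P"
        using iP(5)[OF iP(3)[OF q0'(3), of "c1 ^ k"] poly_coeffs_in_ideal[OF idP rP, of x]]
        by (simp add: r_eq)
      then consider "poly s x \<in> P" | "poly q1 x \<in> P" using prime by blast
      then show False
      proof cases
        case 1
        have "s \<notin> coeffs_in P"
        proof
          assume "s \<in> coeffs_in P"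
          then have "coeff (s * q1 + r) (degree q0) \<in> P"
            using rP by (auto simp: coeffs_in_def coeff_mult intro!: iP ideal_set_sum[OF idP])
          then have "c1 ^ k * c0 \<in> P" unfolding ksr(3)[symmetric] by (simp add: c0_def)
          then show False using prime prime_ideal_set_power[OF P q1'(2)] q0'(2) by blast
        qed
        then obtain s' where "Z s'" "degree s' \<le> degree s" using truncZ[OF ksr(1) _ 1] by blast
        then have le: "degree q0 \<le> degree s" using q0(2) by fastforce
        have "s \<noteq> 0" using \<open>s \<notin> coeffs_in P\<close> iP(1) by (auto simp: coeffs_in_def)
        then have "degree s + degree q1 = degree (smult (c1 ^ k) q0 - r)"
          using q1'(3) by (simp add: ksr(3) degree_mult_eq)
        also have "\<dots> \<le> max (degree q0) (degree r)"
          using degree_diff_le_max[of "smult (c1 ^ k) q0" r] degree_smult_le[of "c1 ^ k" q0] by linarith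
        finally show False using pos le ksr(4) by auto
      next
        case 2
        obtain k s r where ksr: "s \<in> coeffs_in B" "r \<in> coeffs_in B" "smult (c1 ^ k) qb = s * q1 + r"
            "r = 0 \<or> degree r < degree q1"
          using pseudo_division_coeffs_in[OF B q1'(1,3) qb(1)] unfolding c1_def by blast
        have r_eq: "poly r x = c1 ^ k * poly qb x - poly s x * poly q1 x"
          using arg_cong[OF ksr(3), of "\<lambda>p. poly p x"] by simp
        have "poly r x - poly [:c1 ^ k:] x * poly qb x = poly (0 - s) x * poly q1 x"
          by (simp add: r_eq)
        also have "\<dots> \<in> P" using 2 by (rule iP(3))
        finally have rP: "r \<in> coeffs_in P"
          using ksr by (intro rem1[of r "[:c1 ^ k:]"] cl(6) subring_set_power[OF B] q1'(4))
        have "c1 ^ k * poly qb x = poly r x + poly s x * poly q1 x" by (simp add: r_eq)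
        also have "\<dots> \<in> P" using poly_coeffs_in_ideal[OF idP rP] 2 by (simp add: iP)
        finally show False using prime prime_ideal_set_power[OF P q1'(2)] qb(2) by blast
      qed
    qed
    then have q1c: "q1 = [:c1:]" unfolding c1_def by (metis degree_0_id coeff_pCons_0 degree_eq_zeroE)
    show thesis
    proof (rule that[of "c0 * c1"])
      show "c0 * c1 \<in> B" using q0'(5) q1'(4) by (rule subring_setD(4)[OF B])
      show "c0 * c1 \<notin> P" using prime q0'(2) q1'(2) by blast
      fix \<phi> :: "'a \<Rightarrow> 'k"
      assume \<phi>: "ring_map \<phi>" "\<And>y. y \<in> B \<inter> P \<Longrightarrow> \<phi> y = 0" "\<phi> (c0 * c1) \<noteq> 0"
      note rm = ring_mapD[OF \<phi>(1)] and mp = map_poly_ring_map[OF \<phi>(1)]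
      have n0: "\<phi> c0 \<noteq> 0" "\<phi> c1 \<noteq> 0" using \<phi>(3) by (auto simp: rm)
      have "coeff (map_poly \<phi> q0) (degree q0) \<noteq> 0" using n0(1) by (simp add: coeff_map_poly rm c0_def)
      then have "degree (map_poly \<phi> q0) > 0" using deg0 le_degree by fastforce
      then obtain t where t: "poly (map_poly \<phi> q0) t = 0" using alg_closed_imp_poly_has_root by blast
      have vanish: "poly (map_poly \<phi> q) t = 0" if q: "q \<in> coeffs_in B" "poly q x \<in> P" for q
      proof -
        obtain k s r where ksr: "s \<in> coeffs_in B" "r \<in> coeffs_in B" "smult (c0 ^ k) q = s * q0 + r"
            "r = 0 \<or> degree r < degree q0"
          using pseudo_division_coeffs_in[OF B q0'(1,4) q(1)] unfolding c0_def by blast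
        have "map_poly \<phi> r = 0"
          by (rule map0[OF \<phi>(1,2) ksr(2) rem0[OF q ksr(3,2,4)]])
        then have "smult (\<phi> c0 ^ k) (map_poly \<phi> q) = map_poly \<phi> s * map_poly \<phi> q0"
          using arg_cong[OF ksr(3), of "map_poly \<phi>"] by (simp add: mp rm)
        then have "\<phi> c0 ^ k * poly (map_poly \<phi> q) t = 0"
          using t arg_cong[of _ _ "\<lambda>p. poly p t"] by (metis poly_smult poly_mult mult_zero_right)
        then show ?thesis using n0(1) by simp
      qed
      \<comment> \<open>This polynomial vanishes at \<open>x\<close> modulo \<open>P\<close>, hence
        at \<open>t\<close>; so the nonzero \<open>\<phi> c1\<close> is a multiple of the value of
        \<open>qb\<close> at \<open>t\<close>.\<close>
      have "[:c1:] - s1 * qb \<in> coeffs_in B" by (intro cl q1'(4) s1(1) qb(1))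
      moreover have "poly ([:c1:] - s1 * qb) x \<in> P" using s1(2) by (simp add: q1c)
      ultimately have "poly (map_poly \<phi> ([:c1:] - s1 * qb)) t = 0" by (rule vanish)
      moreover have "map_poly \<phi> [:c1:] = map_poly \<phi> ([:c1:] - s1 * qb) + map_poly \<phi> s1 * map_poly \<phi> qb"
        by (simp flip: mp)
      moreover have "map_poly \<phi> [:c1:] = [:\<phi> c1:]" using n0(2) by (simp add: map_poly_pCons rm)
      ultimately have "\<phi> c1 = poly (map_poly \<phi> s1) t * poly (map_poly \<phi> qb) t"
      proof -
        have "poly (map_poly \<phi> [:c1:]) t = poly (map_poly \<phi> s1) t * poly (map_poly \<phi> qb) t"
          unfolding \<open>map_poly \<phi> [:c1:] = map_poly \<phi> ([:c1:] - s1 * qb) + map_poly \<phi> s1 * map_poly \<phi> qb\<close>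
          by (simp add: \<open>poly (map_poly \<phi> ([:c1:] - s1 * qb)) t = 0\<close>)
        then show ?thesis by (simp add: \<open>map_poly \<phi> [:c1:] = [:\<phi> c1:]\<close>)
      qed
      then have "poly (map_poly \<phi> qb) t \<noteq> 0" using n0(2) by auto
      then show "\<exists>t. (\<forall>q\<in>coeffs_in B. poly q x \<in> P \<longrightarrow> poly (map_poly \<phi> q) t = 0) \<and>
          poly (map_poly \<phi> qb) t \<noteq> 0" using vanish by blast
    qed
  qed
qed

lemma mpolys_below_Suc_poly:
  "p \<in> mpolys_below (Suc n) \<Longrightarrow> \<exists>q\<in>coeffs_in (mpolys_below n). p = poly q (mvar n)"
proof (induction p rule: mpolys_below.induct)
  have B: "subring_set (mpolys_below n :: 'a mpoly set)"
    unfolding subring_set_def by (auto intro: mpolys_below_1 mpolys_below_diff mpolys_below.mult)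
  note cl = coeffs_in_closed[OF B]
  {
    case (const c)
    show ?case by (rule bexI[OF _ cl(6)[OF mpolys_below.const[of c]]]) simp
  next
    case (var i)
    show ?case
    proof (cases "i = n")
      case True
      show ?thesis
        by (rule bexI[OF _ cl(5)[OF mpolys_below_1, of 1]]) (simp add: True poly_monom)
    next
      case False
      then have "i < n" using var by simp
      show ?thesis by (rule bexI[OF _ cl(6)[OF mpolys_below.var[OF \<open>i < n\<close>]]]) simp
    qed
  next
    case (add p q)
    then show ?case using cl(2) by (metis poly_add)
  next
    case (mult p q)
    then show ?case using cl(3) by (metis poly_mult)
  }
qed

lemma ring_map_meval: "ring_map (meval v)"
  by (simp add: ring_map_def)

lemma meval_poly_mvar:
  assumes "q \<in> coeffs_in (mpolys_below n)"
  shows "meval (v(n := t)) (poly q (mvar n)) = poly (map_poly (meval v) q) t"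
proof -
  have "meval (v(n := t)) (poly q (mvar n)) =
      (\<Sum>i\<le>degree q. meval (v(n := t)) (coeff q i) * t ^ i)"
    by (simp add: poly_altdef)
  also have "\<dots> = (\<Sum>i\<le>degree q. coeff (map_poly (meval v) q) i * t ^ i)"
    using assms by (intro sum.cong refl)
      (simp add: coeff_map_poly coeffs_in_def meval_cong_below[of _ n "v(n := t)" v])
  also have "\<dots> = poly (map_poly (meval v) q) t"
  proof -
    have "degree (map_poly (meval v) q) \<le> degree q"
      by (rule degree_le) (simp add: coeff_map_poly coeff_eq_0)
    then show ?thesis
      unfolding poly_altdef by (intro sum.mono_neutral_right) (auto simp: coeff_eq_0)
  qed
  finally show ?thesis .
qed

lemma exists_point_of_prime:
  fixes P :: "'k::alg_closed_field mpoly set"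
  assumes P: "prime_ideal_set P" and b: "b \<in> mpolys_below n" "b \<notin> P"
  shows "\<exists>v. (\<forall>f\<in>mpolys_below n \<inter> P. meval v f = 0) \<and> meval v b \<noteq> 0"
  using b
proof (induction n arbitrary: b)
  case 0
  have "f = 0" if f: "f \<in> mpolys_below 0 \<inter> P" for f
  proof -
    obtain c where c: "f = mconst c" using f mpolys_below_0_eq by blast
    have "c = 0"
    proof (rule ccontr)
      assume "c \<noteq> 0"
      then have "mconst (inverse c) * f = 1" by (simp add: c mult_single)
      then have "1 \<in> P" using f P ideal_setD(3)[of P f "mconst (inverse c)"] by (auto simp: prime_ideal_set_def)
      then show False using P by (simp add: prime_ideal_set_def)
    qed
    then show ?thesis by (simp add: c)
  qed
  moreover obtain c where c: "b = mconst c" using 0(1) mpolys_below_0_eq by blast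
  moreover have "c \<noteq> 0"
    using c 0(2) P ideal_setD(1)[of P] by (auto simp: prime_ideal_set_def)
  ultimately show ?case by (intro exI[of _ "\<lambda>_. 0"]) (metis meval_0 meval_mconst)
next
  case (Suc n)
  have B: "subring_set (mpolys_below n :: 'k mpoly set)"
    unfolding subring_set_def by (auto intro: mpolys_below_1 mpolys_below_diff mpolys_below.mult)
  obtain qb where qb: "qb \<in> coeffs_in (mpolys_below n)" "b = poly qb (mvar n)"
    using mpolys_below_Suc_poly[OF Suc.prems(1)] by blast
  have "poly qb (mvar n) \<notin> P" using Suc.prems(2) qb(2) by simp
  then obtain a where a: "a \<in> mpolys_below n" "a \<notin> P"
    "\<And>\<phi> :: 'k mpoly \<Rightarrow> 'k. ring_map \<phi> \<Longrightarrow> (\<And>y. y \<in> mpolys_below n \<inter> P \<Longrightarrow> \<phi> y = 0) \<Longrightarrow> \<phi> a \<noteq> 0 \<Longrightarrow>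
      \<exists>t. (\<forall>q\<in>coeffs_in (mpolys_below n). poly q (mvar n) \<in> P \<longrightarrow> poly (map_poly \<phi> q) t = 0) \<and>
        poly (map_poly \<phi> qb) t \<noteq> 0"
    using point_extension_step[OF P B qb(1), of "mvar n", where 'k = 'k] by metis
  obtain v where v: "\<forall>f\<in>mpolys_below n \<inter> P. meval v f = 0" "meval v a \<noteq> 0"
    using Suc.IH[OF a(1,2)] by blast
  obtain t where t: "\<forall>q\<in>coeffs_in (mpolys_below n). poly q (mvar n) \<in> P \<longrightarrow> poly (map_poly (meval v) q) t = 0"
      "poly (map_poly (meval v) qb) t \<noteq> 0"
    using a(3)[OF ring_map_meval[of v]] v by blast
  have "meval (v(n := t)) f = 0" if f: "f \<in> mpolys_below (Suc n) \<inter> P" for f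
  proof -
    obtain q where q: "q \<in> coeffs_in (mpolys_below n)" "f = poly q (mvar n)"
      using mpolys_below_Suc_poly f by blast
    then show ?thesis using t(1) f meval_poly_mvar[OF q(1), of v t] by auto
  qed
  moreover have "meval (v(n := t)) b \<noteq> 0"
    using t(2) meval_poly_mvar[OF qb(1), of v t] qb(2) by simp
  ultimately show ?case by blast
qed

text \<open>If no power of \<open>p\<close> were in the ideal, some prime would contain the ideal
  but not \<open>p\<close>, and a point of that prime would be a common zero of the
  \<open>g i\<close> at which \<open>p\<close> is nonzero.\<close>

theorem nullstellensatz:
  fixes g :: "'i \<Rightarrow> 'k::alg_closed_field mpoly"
  assumes I: "finite I" "\<And>i. i \<in> I \<Longrightarrow> g i \<in> mpolys_below n" and p: "p \<in> mpolys_below n"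
    and vanish: "\<And>v. (\<And>i. i \<in> I \<Longrightarrow> meval v (g i) = 0) \<Longrightarrow> meval v p = 0"
  shows "\<exists>N r. p ^ N = (\<Sum>i\<in>I. r i * g i)"
proof (rule ccontr)
  assume no: "\<not> ?thesis"
  define J where "J = {\<Sum>i\<in>I. r i * g i | r. True}"
  have "ideal_set J"
    unfolding ideal_set_def
  proof (intro conjI ballI allI)
    show "0 \<in> J" unfolding J_def by (intro CollectI exI[of _ "\<lambda>_. 0"]) simp
    fix x assume "x \<in> J"
    then obtain r where r: "x = (\<Sum>i\<in>I. r i * g i)" unfolding J_def by blast
    show "c * x \<in> J" for c
      unfolding J_def by (intro CollectI exI[of _ "\<lambda>i. c * r i"]) (simp add: r sum_distrib_left mult.assoc)
    fix y assume "y \<in> J"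
    then obtain s where s: "y = (\<Sum>i\<in>I. s i * g i)" unfolding J_def by blast
    show "x + y \<in> J"
      unfolding J_def by (intro CollectI exI[of _ "\<lambda>i. r i + s i"]) (simp add: r s distrib_right sum.distrib)
  qed
  moreover have "p ^ N \<notin> J" for N using no unfolding J_def by blast
  ultimately obtain P where P: "prime_ideal_set P" "J \<subseteq> P" "p \<notin> P"
    by (rule exists_prime_ideal_avoiding)
  obtain v where v: "\<forall>f\<in>mpolys_below n \<inter> P. meval v f = 0" "meval v p \<noteq> 0"
    using exists_point_of_prime[OF P(1) p P(3)] by blast
  have "g i \<in> P" if "i \<in> I" for i
  proof -
    have "(\<Sum>k\<in>I. (if k = i then 1 else 0) * g k) = (\<Sum>k\<in>I. if k = i then g k else 0)"
      by (intro sum.cong refl) simp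
    also have "\<dots> = g i" using that I(1) by simp
    finally have "(\<Sum>k\<in>I. (if k = i then 1 else 0) * g k) = g i" .
    then have "g i \<in> J"
      unfolding J_def by (intro CollectI exI[of _ "\<lambda>k. if k = i then 1 else 0"] conjI TrueI) (rule sym)
    then show ?thesis using P(2) by blast
  qed
  then have "meval v p = 0" using v(1) I(2) by (intro vanish) blast
  then show False using v(2) by simp
qed

section \<open>Connectedness of punctured neighbourhoods\<close>

lemma meval_at_0:
  fixes p :: "'k::comm_ring_1 mpoly"
  shows "meval (\<lambda>_. 0) p = Poly_Mapping.lookup p 0"
proof -
  have "monom_eval (\<lambda>_. 0 :: 'k) m = (if m = 0 then 1 else 0)" for m :: "nat \<Rightarrow>\<^sub>0 nat"
    by (auto simp: monom_eval_def in_keys_iff poly_mapping_eq_iff fun_eq_iff power_0_left intro!: prod_zero bexI)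
  then have "meval (\<lambda>_. 0) p = (\<Sum>m\<in>Poly_Mapping.keys p. if m = 0 then Poly_Mapping.lookup p m else 0)"
    unfolding meval_def by (intro sum.cong) auto
  then show ?thesis by (simp add: in_keys_iff)
qed

lemma single_mult_eq_sum:
  fixes p :: "'k::comm_ring_1 mpoly"
  shows "Poly_Mapping.single m 1 * p =
    (\<Sum>k\<in>Poly_Mapping.keys p. Poly_Mapping.single (m + k) (Poly_Mapping.lookup p k))"
  using arg_cong[OF sum_single_lookup[of p], of "\<lambda>x. Poly_Mapping.single m 1 * x"]
  by (simp add: sum_distrib_left mult_single)

lemma lookup_single_mult_add:
  fixes p :: "'k::comm_ring_1 mpoly"
  shows "Poly_Mapping.lookup (Poly_Mapping.single m 1 * p) m = Poly_Mapping.lookup p 0"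
  unfolding single_mult_eq_sum
  by (simp add: lookup_sum lookup_single when_def in_keys_iff)

lemma lookup_single_mult_eq_0:
  fixes p :: "'k::comm_ring_1 mpoly"
  assumes "Poly_Mapping.lookup l i < Poly_Mapping.lookup m i"
  shows "Poly_Mapping.lookup (Poly_Mapping.single m 1 * p) l = 0"
proof -
  have "m + k \<noteq> l" for k
    using assms by (metis lookup_add not_add_less1)
  then show ?thesis
    unfolding single_mult_eq_sum by (simp add: lookup_sum lookup_single when_def)
qed

lemma mvar_nonzero: "mvar i \<noteq> (0 :: 'k::zero_neq_one mpoly)"
  by (metis lookup_single_eq lookup_zero zero_neq_one)

lemma mvar_power: "(mvar i :: 'k::comm_ring_1 mpoly) ^ M = Poly_Mapping.single (Poly_Mapping.single i M) 1"
  by (induction M) (simp_all add: mult_single single_add[symmetric])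

lemma prod_mvar_power:
  "finite A \<Longrightarrow> (\<Prod>i\<in>A. (mvar i :: 'k::comm_ring_1 mpoly) ^ M) =
    Poly_Mapping.single (\<Sum>i\<in>A. Poly_Mapping.single i M) 1"
  by (induction A rule: finite_induct) (simp_all add: mvar_power mult_single)

lemma lookup_sum_single:
  "finite A \<Longrightarrow> i \<in> A \<Longrightarrow> Poly_Mapping.lookup (\<Sum>j\<in>A. Poly_Mapping.single j (M :: nat)) i = M"
  by (simp add: lookup_sum lookup_single when_def)

text \<open>
  This says that the inverse of \<open>\<Prod>i\<in>A. mvar i\<close> is a nonzero class in top local cohomology at the
  origin; \<open>D\<close> is a common denominator in the local ring.
\<close>

lemma monomial_not_in_higher_powers:
  fixes D :: "'k::comm_ring_1 mpoly"
  assumes A: "finite A" and eq: "(\<Prod>i\<in>A. mvar i ^ M) * D = (\<Sum>i\<in>A. mvar i ^ Suc M * p i)"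
  shows "meval (\<lambda>_. 0) D = 0"
proof -
  let ?m = "\<Sum>i\<in>A. Poly_Mapping.single i M"
  have "meval (\<lambda>_. 0) D = Poly_Mapping.lookup ((\<Prod>i\<in>A. mvar i ^ M) * D) ?m"
    by (simp only: meval_at_0 prod_mvar_power[OF A] lookup_single_mult_add)
  also have "\<dots> = (\<Sum>i\<in>A. Poly_Mapping.lookup (mvar i ^ Suc M * p i) ?m)"
    by (simp only: eq lookup_sum)
  also have "\<dots> = 0"
  proof (intro sum.neutral ballI)
    fix i assume "i \<in> A"
    then have "Poly_Mapping.lookup ?m i < Poly_Mapping.lookup (Poly_Mapping.single i (Suc M)) i"
      by (simp only: lookup_sum_single[OF A] lookup_single_eq lessI)
    then show "Poly_Mapping.lookup (mvar i ^ Suc M * p i) ?m = 0"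
      unfolding mvar_power by (rule lookup_single_mult_eq_0)
  qed
  finally show ?thesis .
qed

section \<open>The local ring at the origin\<close>

definition embed :: "'a::idom \<Rightarrow> 'a fract" where "embed p = Fract p 1"

lemma embed_simps [simp]:
  "embed 0 = 0" "embed 1 = 1" "embed (p + q) = embed p + embed q" "embed (p * q) = embed p * embed q"
  "embed (- p) = - embed p"
  by (simp_all add: embed_def Zero_fract_def One_fract_def)

lemma embed_eq_iff [simp]: "embed p = embed q \<longleftrightarrow> p = q"
  by (simp add: embed_def eq_fract)

lemma embed_eq_0_iff [simp]: "embed p = 0 \<longleftrightarrow> p = 0"
  using embed_eq_iff[of p 0] by (simp del: embed_eq_iff)

lemma embed_power [simp]: "embed (p ^ n) = embed p ^ n"
  by (induction n) auto

lemma embed_sum [simp]: "embed (sum g A) = (\<Sum>x\<in>A. embed (g x))"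
  by (induction A rule: infinite_finite_induct) auto

lemma embed_prod [simp]: "embed (prod g A) = (\<Prod>x\<in>A. embed (g x))"
  by (induction A rule: infinite_finite_induct) auto

text \<open>It is realised inside the fraction field, the common field of values that
  \<open>cech\<close> requires.\<close>

definition local_ring :: "'k::field mpoly fract set" where
  "local_ring = {y. \<exists>b p. meval (\<lambda>_. 0) b \<noteq> 0 \<and> embed b * y = embed p}"

lemma local_ringI: "meval (\<lambda>_. 0) b \<noteq> 0 \<Longrightarrow> embed b * y = embed p \<Longrightarrow> y \<in> local_ring"
  unfolding local_ring_def by blast

lemma local_ringE:
  assumes "y \<in> local_ring"
  obtains b p where "meval (\<lambda>_. 0) b \<noteq> 0" "embed b * y = embed p"
  using assms unfolding local_ring_def by blast

lemma embed_in_local_ring: "embed p \<in> local_ring"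
  by (rule local_ringI[of 1 _ p]) simp_all

lemma cech_local_ring:
  fixes h :: "'i::linorder \<Rightarrow> 'k::field mpoly"
  assumes "\<And>i. f i = embed (h i) \<and> h i \<noteq> 0"
  shows "cech local_ring f"
proof
  show "(1 :: 'k mpoly fract) \<in> local_ring" using embed_in_local_ring[of 1] by simp
  show "f i \<in> local_ring" "f i \<noteq> 0" for i using assms[of i] by (simp_all add: embed_in_local_ring)
  fix x :: "'k mpoly fract" assume "x \<in> local_ring"
  then obtain b p where x: "meval (\<lambda>_. 0) b \<noteq> 0" "embed b * x = embed p" by (rule local_ringE)
  show "- x \<in> local_ring" by (rule local_ringI[of b _ "- p"]) (simp_all add: x)
  fix y :: "'k mpoly fract" assume "y \<in> local_ring"
  then obtain c q where y: "meval (\<lambda>_. 0) c \<noteq> 0" "embed c * y = embed q" by (rule local_ringE)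
  show "x + y \<in> local_ring"
  proof (rule local_ringI[of "b * c" _ "c * p + b * q"])
    have "embed (b * c) * (x + y) = embed c * (embed b * x) + embed b * (embed c * y)"
      by (simp add: algebra_simps)
    then show "embed (b * c) * (x + y) = embed (c * p + b * q)" by (simp add: x y)
  qed (simp add: x y)
  show "x * y \<in> local_ring"
  proof (rule local_ringI[of "b * c" _ "p * q"])
    have "embed (b * c) * (x * y) = (embed b * x) * (embed c * y)"
      by (simp add: algebra_simps)
    then show "embed (b * c) * (x * y) = embed (p * q)" by (simp add: x y)
  qed (simp add: x y)
qed

definition zeros :: "'k::comm_ring_1 mpoly set \<Rightarrow> (nat \<Rightarrow> 'k) set" where
  "zeros S = {v. \<forall>f\<in>S. meval v f = 0}"

text \<open>
  The polynomial \<open>q\<close> cuts out a neighbourhood of the origin. Residues modulo 4 keep apart the labels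
  of the variables, of \<open>A\<close>, of \<open>B\<close> and of \<open>F\<close>.
\<close>

theorem separated_zeros_contradiction:
  fixes A B F :: "'k::alg_closed_field mpoly set"
  assumes fin: "finite A" "finite B" "finite F"
    and sub: "A \<subseteq> mpolys_below n" "B \<subseteq> mpolys_below n" "F \<subseteq> mpolys_below n" "q \<in> mpolys_below n"
    and nz: "0 \<notin> A" "0 \<notin> B" "0 \<notin> F"
    and card: "card F + 2 \<le> n"
    and q: "meval (\<lambda>_. 0) q \<noteq> 0"
    and ZF: "\<And>v. v \<in> zeros F \<Longrightarrow> v \<in> zeros A \<or> v \<in> zeros B \<or> meval v q = 0"
    and FAB: "zeros A \<subseteq> zeros F" "zeros B \<subseteq> zeros F"
    and AB: "\<And>v i. v \<in> zeros A \<Longrightarrow> v \<in> zeros B \<Longrightarrow> i < n \<Longrightarrow> v i = 0"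
    and axis0: "\<And>v. (\<And>i. i < n \<Longrightarrow> i \<noteq> 0 \<Longrightarrow> v i = 0) \<Longrightarrow> v \<in> zeros A"
    and axis1: "\<And>v. (\<And>i. i < n \<Longrightarrow> i \<noteq> 1 \<Longrightarrow> v i = 0) \<Longrightarrow> v \<in> zeros B"
  shows False
proof -
  have enum: "\<exists>e. bij_betw e {..<card S} S" if "finite S" for S :: "'k mpoly set"
    using ex_bij_betw_nat_finite[OF that] by (auto simp: atLeast0LessThan)
  obtain eA eB eF where e: "bij_betw eA {..<card A} A" "bij_betw eB {..<card B} B" "bij_betw eF {..<card F} F"
    using enum[OF fin(1)] enum[OF fin(2)] enum[OF fin(3)] by blast
  define g where "g = (\<lambda>j :: nat. if j = 0 then mvar else if j = 1 then eA else if j = 2 then eB else eF)"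
  define N where "N = (\<lambda>j :: nat. if j = 0 then n else if j = 1 then card A else if j = 2 then card B else card F)"
  define S where "S = (\<lambda>j :: nat. if j = 0 then mvar ` {..<n} else if j = 1 then A else if j = 2 then B else F)"
  define h where "h = (\<lambda>i :: nat. if i div 4 < N (i mod 4) then g (i mod 4) (i div 4) else 1)"
  define f where "f = (\<lambda>i. embed (h i))"
  have f_eq: "f i = embed (h i)" for i by (simp add: f_def)
  define L where "L = (\<lambda>j. (\<lambda>k. 4 * k + j) ` {..<N j})"
  have hL: "h (4 * k + j) = g j k" if "k < N j" "j < 4" for j k
    using that by (simp add: h_def)
  have gS: "g j ` {..<N j} = S j" for j
    using e by (auto simp: g_def N_def S_def bij_betw_def)
  have hS: "h ` L j = S j" if "j < 4" for j
  proof -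
    have "h ` L j = g j ` {..<N j}"
      unfolding L_def image_image using hL that by (intro image_cong) auto
    then show ?thesis by (simp add: gS)
  qed
  have nzS: "0 \<notin> S j" for j
    using nz by (auto simp: S_def mvar_nonzero[symmetric])
  have nzh: "h i \<noteq> 0" for i
  proof (cases "i div 4 < N (i mod 4)")
    case True
    then have "h i \<in> S (i mod 4)" using gS[of "i mod 4"] by (auto simp: h_def)
    then show ?thesis using nzS by metis
  qed (simp add: h_def)
  interpret cech local_ring f
    by (rule cech_local_ring[of f h]) (simp add: f_def nzh)
  have Ssub: "S j \<subseteq> mpolys_below n" for j
    using sub by (auto simp: S_def intro: mpolys_below.var)
  have finL: "finite (L j)" for j by (simp add: L_def)
  have cardL: "card (L j) = N j" for j
    unfolding L_def by (subst card_image) (auto intro: inj_onI)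
  have disj: "L i \<inter> L j = {}" if "i < 4" "j < 4" "i \<noteq> j" for i j
  proof -
    have "4 * k + i \<noteq> 4 * l + j" for k l using that by presburger
    then show ?thesis unfolding L_def by blast
  qed
  \<comment> \<open>Inclusions of zero sets are known only where \<open>q\<close> is nonzero, so the
    Nullstellensatz is applied to \<open>q * p\<close>; afterwards \<open>q\<close> is cancelled as
    a unit of the local ring.\<close>
  have rad: "radical_over I (embed p)"
    if I: "finite I" "h ` I \<subseteq> mpolys_below n" and p: "p \<in> mpolys_below n"
      and vanish: "\<And>v. v \<in> zeros (h ` I) \<Longrightarrow> meval v q = 0 \<or> meval v p = 0" for I p
    unfolding radical_over_def
  proof
    fix M
    have "\<exists>N r. (q * p) ^ N = (\<Sum>i\<in>I. r i * h i ^ M)"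
    proof (rule nullstellensatz[OF I(1)])
      show "h i ^ M \<in> mpolys_below n" if "i \<in> I" for i
        using I(2) that by (induction M) (auto intro: mpolys_below_1 mpolys_below.mult)
      show "q * p \<in> mpolys_below n" by (intro mpolys_below.mult sub p)
      fix v assume "\<And>i. i \<in> I \<Longrightarrow> meval v (h i ^ M) = 0"
      then have "v \<in> zeros (h ` I)" by (simp add: zeros_def)
      then show "meval v (q * p) = 0" using vanish by auto
    qed
    then obtain N r where Nr: "(q * p) ^ N = (\<Sum>i\<in>I. r i * h i ^ M)" by blast
    have q0: "q \<noteq> 0" using q by auto
    have "embed q ^ N * embed p ^ N = (\<Sum>i\<in>I. embed (r i) * f i ^ M)"
      using arg_cong[OF Nr, of embed] by (simp add: f_def power_mult_distrib)
    then have "embed p ^ N = inverse (embed q ^ N) * (\<Sum>i\<in>I. embed (r i) * f i ^ M)"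
      using q0 by (simp add: field_simps)
    also have "\<dots> = (\<Sum>i\<in>I. (inverse (embed q ^ N) * embed (r i)) * f i ^ M)"
      by (simp add: sum_distrib_left mult.assoc)
    finally have "embed p ^ N = (\<Sum>i\<in>I. (inverse (embed q ^ N) * embed (r i)) * f i ^ M)" .
    moreover have "inverse (embed q ^ N) * embed (r i) \<in> local_ring" for i
      by (rule local_ringI[of "q ^ N" _ "r i"]) (use q q0 in simp_all)
    ultimately show "\<exists>N r. (\<forall>i\<in>I. r i \<in> local_ring) \<and> embed p ^ N = (\<Sum>i\<in>I. r i * f i ^ M)"
      by (intro exI[of _ N] exI[of _ "\<lambda>i. inverse (embed q ^ N) * embed (r i)"] conjI ballI)
  qed
  have memL: "h i \<in> S j" if "i \<in> L j" "j < 4" for i j using hS that by blast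
  have hL1: "h ` L 1 = A" "h ` L (Suc 0) = A" "h ` L 2 = B" "h ` L 3 = F"
    using hS[of 1] hS[of 2] hS[of 3] by (simp_all add: S_def)
  define m where "m = n - 2"
  then have m: "n = Suc (Suc m)" "card F \<le> m" using card by auto
  have axis: "radical_over (L 0 - {i}) (f a)"
    if a: "a \<in> L j" "j < 4" and ax: "\<And>v. (\<And>k. k < n \<Longrightarrow> 4 * k \<noteq> i \<Longrightarrow> v k = 0) \<Longrightarrow> v \<in> zeros (S j)"
    for i a j
    unfolding f_eq[of a]
  proof (rule rad)
    show "finite (L 0 - {i})" using finL by simp
    show "h ` (L 0 - {i}) \<subseteq> mpolys_below n" using Ssub[of 0] hS[of 0] by auto
    show "h a \<in> mpolys_below n" using memL[OF a] Ssub by blast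
    fix v assume v: "v \<in> zeros (h ` (L 0 - {i}))"
    have "v k = 0" if "k < n" "4 * k \<noteq> i" for k
    proof -
      have "4 * k \<in> L 0 - {i}" using that by (auto simp: L_def N_def)
      then have "meval v (h (4 * k)) = 0" using v by (simp add: zeros_def)
      moreover have "h (4 * k) = mvar k" using hL[of k 0] that by (simp add: N_def g_def)
      ultimately show ?thesis by simp
    qed
    then have "v \<in> zeros (S j)" by (rule ax)
    then show "meval v q = 0 \<or> meval v (h a) = 0" using memL[OF a] by (simp add: zeros_def)
  qed
  have "acyclic_at (meeting (L 0) {}) (Suc m)"
  \<comment> \<open>Labels 0 and 4 belong to the variables 0 and 1, whose axes lie in the zero sets
    of \<open>A\<close> and \<open>B\<close>.\<close>
  proof (rule acyclic_at_Pow_if_separated[where A = "L 1" and B = "L 2" and F = "L 3" and i = 0 and j = 4])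
    show "card (L 0) = Suc (Suc m)" "card (L 3) \<le> m" using m by (simp_all add: cardL N_def)
    show "0 \<in> L 0" "4 \<in> L 0" using m by (auto simp: L_def N_def image_iff intro: bexI[of _ 0] bexI[of _ 1])
    show "radical_over (L 1 \<union> L 2) (f x)" if x: "x \<in> L 0" for x
      unfolding f_eq[of x]
    proof (rule rad)
      show "finite (L 1 \<union> L 2)" using finL by simp
      show "h ` (L 1 \<union> L 2) \<subseteq> mpolys_below n" using sub by (simp add: image_Un hL1)
      show "h x \<in> mpolys_below n" using memL[OF x] Ssub[of 0] by auto
      fix v assume "v \<in> zeros (h ` (L 1 \<union> L 2))"
      then have "v \<in> zeros A" "v \<in> zeros B" by (auto simp: zeros_def image_Un hL1)
      then show "meval v q = 0 \<or> meval v (h x) = 0"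
        using memL[OF x] AB by (auto simp: S_def)
    qed
    show "radical_over (L 3) (f a * f b)" if ab: "a \<in> L 1" "b \<in> L 2" for a b
    proof -
      have mem: "h a \<in> A" "h b \<in> B" using ab hL1 by auto
      have "radical_over (L 3) (embed (h a * h b))"
      proof (rule rad)
        show "finite (L 3)" by (rule finL)
        show "h ` L 3 \<subseteq> mpolys_below n" using sub by (simp add: hL1)
        show "h a * h b \<in> mpolys_below n" using mem sub by (intro mpolys_below.mult) auto
        fix v assume "v \<in> zeros (h ` L 3)"
        then show "meval v q = 0 \<or> meval v (h a * h b) = 0"
          using ZF[of v] mem by (auto simp: hL1 zeros_def)
      qed
      then show ?thesis by (simp add: f_def)
    qed
    show "radical_over (L 1) (f k)" "radical_over (L 2) (f k)" if k: "k \<in> L 3" for k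
    proof -
      have mem: "h k \<in> F" using k hL1 by auto
      have "meval v (h k) = 0" if "v \<in> zeros A \<or> v \<in> zeros B" for v
        using that FAB mem unfolding zeros_def by blast
      then show "radical_over (L 1) (f k)" "radical_over (L 2) (f k)"
        unfolding f_eq[of k] using finL mem sub by (intro rad; auto simp: hL1)+
    qed
    show "radical_over (L 0 - {0}) (f a)" if "a \<in> L 1" for a
      by (rule axis[OF that]) (auto simp: S_def intro: axis0)
    show "radical_over (L 0 - {4}) (f a)" if "a \<in> L 2" for a
      by (rule axis[OF that]) (auto simp: S_def intro: axis1)
  qed (use finL disj in auto)
  define X where "X = L 0"
  have finX: "finite X" unfolding X_def by (rule finL)
  \<comment> \<open>The class of the inverse of the product of all coordinates; it is a cocycle
    because no subset of \<open>X\<close> has \<open>X\<close> as a proper face.\<close>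
  define c where "c = (\<lambda>S. if S = X then inverse (prod f X) else 0)"
  have "cocycle (meeting X {}) (Suc (Suc m)) c"
  proof (rule cocycleI)
    have "inverse (prod f X) \<in> localization X"
      by (rule localizationI[of _ 1]) (simp add: prod_f_nonzero one_closed)
    then show "cochain (meeting X {}) (Suc (Suc m)) c"
      using m by (auto simp: cochain_def c_def localization_zero meeting_def cardL X_def N_def)
    fix S assume "S \<in> meeting X {}"
    then have "S - {i} \<noteq> X" if "i \<in> S" for i using that by (auto simp: meeting_def)
    then show "coboundary c S = 0" by (simp add: coboundary_def c_def)
  qed
  then obtain e where e: "bounded_by (meeting X {}) (Suc m) c e"
    using acyclic_atD[OF \<open>acyclic_at (meeting (L 0) {}) (Suc m)\<close>] unfolding X_def by blast
  obtain M where M: "\<And>S. S \<in> Pow X \<Longrightarrow> prod f S ^ M * e S \<in> local_ring"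
    using uniform_exponent[OF _ cochain_localization[OF bounded_by_cochain[OF e]], of "Pow X"] finX by auto
  \<comment> \<open>The power \<open>M\<close> clears the chart functions from the denominators of
    \<open>e\<close>, and the \<open>b i\<close> are the denominators left in the local ring.
    Multiplying the equation for the inverse by \<open>prod f X ^ Suc M\<close> and
    \<open>prod b X\<close> gives a polynomial identity.\<close>
  define y where "y = (\<lambda>i. prod f (X - {i}) ^ M * e (X - {i}))"
  have "\<forall>i. \<exists>b p. meval (\<lambda>_. 0) b \<noteq> 0 \<and> embed b * y i = embed p"
    using M[of "X - {i}" for i] unfolding y_def local_ring_def by blast
  then obtain b p where bp: "\<And>i. meval (\<lambda>_. 0) (b i) \<noteq> 0" "\<And>i. embed (b i) * y i = embed (p i)"
    by metis
  \<comment> \<open>\<open>h i ^ Suc M\<close> is kept apart; \<open>y i\<close> absorbs the power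
    \<open>M\<close> of the other chart functions, and one factor of each remains.\<close>
  define p' where "p' = (\<lambda>i. (- 1) ^ card {j \<in> X. j < i} * (prod h (X - {i}) * (prod b (X - {i}) * p i)))"
  have "embed (prod h X ^ M * prod b X) = embed (\<Sum>i\<in>X. h i ^ Suc M * p' i)"
  proof -
    have "X \<in> meeting X {}" by (simp add: meeting_def)
    then have "inverse (prod f X) = (\<Sum>i\<in>X. pos_sign i X * e (X - {i}))"
      using bounded_by_coboundary[OF e] by (simp add: c_def coboundary_def)
    then have "prod f X ^ Suc M * inverse (prod f X) * embed (prod b X) =
        (\<Sum>i\<in>X. prod f X ^ Suc M * (pos_sign i X * e (X - {i})) * embed (prod b X))"
      by (simp only: sum_distrib_left sum_distrib_right)
    also have "prod f X ^ Suc M * inverse (prod f X) * embed (prod b X) = embed (prod h X ^ M * prod b X)"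
      using prod_f_nonzero[of X] by (simp add: f_def)
    also have "(\<Sum>i\<in>X. prod f X ^ Suc M * (pos_sign i X * e (X - {i})) * embed (prod b X)) =
        (\<Sum>i\<in>X. embed (h i ^ Suc M * p' i))"
    proof (rule sum.cong[OF refl])
      fix i assume i: "i \<in> X"
      have P: "prod f X = f i * prod f (X - {i})" "embed (prod b X) = embed (prod b (X - {i})) * embed (b i)"
        using prod.remove[OF finX i, of f] prod.remove[OF finX i, of b] by simp_all
      have "prod f X ^ Suc M * (pos_sign i X * e (X - {i})) * embed (prod b X) =
          f i ^ Suc M * (pos_sign i X * (prod f (X - {i}) * (embed (prod b (X - {i})) * (embed (b i) * y i))))"
        unfolding P y_def by (simp add: power_mult_distrib mult_ac)
      also have "\<dots> = embed (h i ^ Suc M * p' i)"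
        by (simp add: bp(2) f_def p'_def pos_sign_def)
      finally show "prod f X ^ Suc M * (pos_sign i X * e (X - {i})) * embed (prod b X) =
          embed (h i ^ Suc M * p' i)" .
    qed
    finally show ?thesis by simp
  qed
  then have eq: "prod h X ^ M * prod b X = (\<Sum>i\<in>X. h i ^ Suc M * p' i)"
    by (simp only: embed_eq_iff)
  have X4: "X = (\<lambda>k. 4 * k) ` {..<n}" "inj_on (\<lambda>k :: nat. 4 * k) {..<n}"
    by (auto simp: X_def L_def N_def intro: inj_onI)
  have h4: "h (4 * k) = mvar k" if "k < n" for k
    using hL[of k 0] that by (simp add: N_def g_def)
  have "prod h X ^ M = (\<Prod>k<n. mvar k ^ M)"
    unfolding X4(1) prod.reindex[OF X4(2)] by (simp add: h4 prod_power_distrib)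
  moreover have "(\<Sum>i\<in>X. h i ^ Suc M * p' i) = (\<Sum>k<n. mvar k ^ Suc M * p' (4 * k))"
    unfolding X4(1) sum.reindex[OF X4(2)] by (rule sum.cong) (simp_all add: h4)
  ultimately have "meval (\<lambda>_. 0) (prod b X) = 0"
    using eq by (intro monomial_not_in_higher_powers[of "{..<n}" M _ "\<lambda>k. p' (4 * k)"]) simp_all
  then show False using bp(1) finX by simp
qed

section \<open>Generic linear forms and regular maps\<close>

text \<open>Finitely many bad conditions are avoided one at a time: \<open>x\<close> is good for the
  previous ones, \<open>y\<close> for the new one, and each condition excludes only finitely many
  points of the line \<open>comb s x y\<close>. An abstract \<open>comb\<close> covers vectors and
  linear forms alike.\<close>

lemma exists_avoiding:
  fixes comb :: "'k \<Rightarrow> 'w \<Rightarrow> 'w \<Rightarrow> 'w"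
  assumes inf: "infinite (UNIV :: 'k set)" and "finite I" and W: "W \<noteq> {}"
    and comb: "\<And>s x y. x \<in> W \<Longrightarrow> y \<in> W \<Longrightarrow> comb s x y \<in> W"
    and good: "\<And>i. i \<in> I \<Longrightarrow> \<exists>x\<in>W. \<not> bad i x"
    and fin: "\<And>i x y. i \<in> I \<Longrightarrow> \<not> bad i x \<or> \<not> bad i y \<Longrightarrow> finite {s. bad i (comb s x y)}"
  shows "\<exists>x\<in>W. \<forall>i\<in>I. \<not> bad i x"
  using assms(2) good fin
proof (induction I rule: finite_induct)
  case empty
  then show ?case using W by blast
next
  case (insert i I)
  obtain x where x: "x \<in> W" "\<forall>j\<in>I. \<not> bad j x" using insert by auto
  obtain y where y: "y \<in> W" "\<not> bad i y" using insert.prems(1)[of i] by auto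
  have "finite (\<Union>j\<in>insert i I. {s. bad j (comb s x y)})"
    using insert.hyps(1) insert.prems(2) x(2) y(2) by (intro finite_UN_I) auto
  then obtain s where "s \<notin> (\<Union>j\<in>insert i I. {s. bad j (comb s x y)})"
    using ex_new_if_finite[OF inf] by blast
  then show ?case using comb[OF x(1) y(1), of s] by blast
qed

context vector_space
begin

lemma finite_solutions:
  assumes "a \<noteq> 0 \<or> b \<noteq> 0"
  shows "finite {s. a + scale s b = 0}"
proof (cases "b = 0")
  case False
  have "s = t" if "a + scale s b = 0" "a + scale t b = 0" for s t
  proof -
    have "scale (s - t) b = (a + scale s b) - (a + scale t b)"
      by (simp add: scale_left_diff_distrib)
    then show ?thesis using that False by simp
  qed
  then show ?thesis by (metis (mono_tags, lifting) finite.emptyI finite_insert finite_subset insertI1 mem_Collect_eq subsetI)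
qed (use assms in simp)

end

section \<open>Linear forms, bases and regular maps\<close>

context finite_dimensional_vector_space
begin

abbreviation linear_form :: "('b \<Rightarrow> 'a) \<Rightarrow> bool" where
  "linear_form l \<equiv> Vector_Spaces.linear scale (*) l"

lemma field_vector_space_pair: "vector_space_pair scale ((*) :: 'a \<Rightarrow> 'a \<Rightarrow> 'a)"
  by unfold_locales (simp_all add: algebra_simps)

lemma linear_form_iff:
  "linear_form l \<longleftrightarrow> (\<forall>x y. l (x + y) = l x + l y) \<and> (\<forall>c x. l (scale c x) = c * l x)"
  using field_vector_space_pair vector_space_axioms
  by (simp add: Vector_Spaces.linear_iff vector_space_pair_def)

lemma linear_formD:
  assumes "linear_form l"
  shows "l (x + y) = l x + l y" "l (scale c x) = c * l x" "l 0 = 0" "l (x - y) = l x - l y"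
    "l (sum g A) = (\<Sum>i\<in>A. l (g i))"
proof -
  show 1: "l (x + y) = l x + l y" "l (scale c x) = c * l x" for x y c
    using assms by (auto simp: linear_form_iff)
  show 0: "l 0 = 0" using 1(2)[of 0 0] by simp
  show "l (x - y) = l x - l y" using 1(1)[of "x - y" y] by (simp add: algebra_simps)
  show "l (sum g A) = (\<Sum>i\<in>A. l (g i))"
    by (induction A rule: infinite_finite_induct) (simp_all add: 0 1)
qed

lemma exists_linear_form_nonzero:
  assumes "v \<noteq> 0"
  shows "\<exists>l. linear_form l \<and> l v \<noteq> 0"
proof -
  interpret P: vector_space_pair scale "(*) :: 'a \<Rightarrow> 'a \<Rightarrow> 'a" by (rule field_vector_space_pair)
  have "independent {v}" using assms by simp
  then obtain l where "linear_form l" "l v = 1"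
    using P.linear_independent_extend[of "{v}" "\<lambda>_. 1"] by auto
  then show ?thesis by (intro exI[of _ l]) simp
qed

lemma exists_linear_form_nonzero_finite:
  assumes inf: "infinite (UNIV :: 'a set)" and V: "finite V" "0 \<notin> V"
  shows "\<exists>l. linear_form l \<and> (\<forall>v\<in>V. l v \<noteq> 0)"
proof -
  have field: "vector_space ((*) :: 'a \<Rightarrow> 'a \<Rightarrow> 'a)" by unfold_locales (simp_all add: algebra_simps)
  have "\<exists>l\<in>{l. linear_form l}. \<forall>v\<in>V. \<not> l v = 0"
  proof (rule exists_avoiding[OF inf V(1), where comb = "\<lambda>s l l' v. l v + s * l' v"])
    have "linear_form (\<lambda>_. 0)" by (simp add: linear_form_iff)
    then show "{l. linear_form l} \<noteq> {}" by blast
    show "(\<lambda>v. l v + s * l' v) \<in> {l. linear_form l}"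
      if "l \<in> {l. linear_form l}" "l' \<in> {l. linear_form l}" for s l l'
      using that by (simp add: linear_form_iff algebra_simps)
    show "\<exists>l\<in>{l. linear_form l}. \<not> l v = 0" if "v \<in> V" for v
    proof -
      have "v \<noteq> 0" using that V(2) by blast
      then show ?thesis using exists_linear_form_nonzero[of v] by (simp add: Bex_def)
    qed
    show "finite {s. l v + s * l' v = 0}" if "\<not> l v = 0 \<or> \<not> l' v = 0" for v and l l' :: "'b \<Rightarrow> 'a"
      using that by (intro vector_space.finite_solutions[OF field]) auto
  qed
  then show ?thesis by simp
qed

text \<open>A form that is nonzero at a chosen vector of each nonzero subspace lowers the dimension
  of all of them simultaneously.\<close>

lemma exists_forms_separating_subspaces:
  assumes inf: "infinite (UNIV :: 'a set)"
  shows "finite \<W> \<Longrightarrow> (\<And>W. W \<in> \<W> \<Longrightarrow> subspace W \<and> dim W \<le> k) \<Longrightarrow>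
    \<exists>l. (\<forall>j<k. linear_form (l j)) \<and> (\<forall>W\<in>\<W>. \<forall>w\<in>W. (\<forall>j<k. l j w = 0) \<longrightarrow> w = 0)"
proof (induction k arbitrary: \<W>)
  case 0
  then have "W \<subseteq> {0}" if "W \<in> \<W>" for W using that by (metis dim_eq_0 le_zero_eq)
  then show ?case by auto
next
  case (Suc k)
  have "\<exists>w. W \<in> \<W> \<longrightarrow> W \<noteq> {0} \<longrightarrow> w \<in> W \<and> w \<noteq> 0" for W
  proof (cases "W \<in> \<W> \<and> W \<noteq> {0}")
    case True
    then have "0 \<in> W" using Suc.prems(2)[of W] subspace_0 by blast
    then show ?thesis using True by blast
  qed blast
  then obtain w where w: "\<And>W. W \<in> \<W> \<Longrightarrow> W \<noteq> {0} \<Longrightarrow> w W \<in> W \<and> w W \<noteq> 0" by metis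
  have finw: "finite (w ` (\<W> - {{0}}))" using Suc.prems(1) by simp
  have w0: "0 \<notin> w ` (\<W> - {{0}})"
  proof
    assume "0 \<in> w ` (\<W> - {{0}})"
    then obtain W where W: "W \<in> \<W> - {{0}}" "0 = w W" by (rule imageE)
    then show False using w[of W] by simp
  qed
  from exists_linear_form_nonzero_finite[OF inf finw w0]
  obtain l0 where "linear_form l0 \<and> (\<forall>v\<in>w ` (\<W> - {{0}}). l0 v \<noteq> 0)" ..
  then have l0: "linear_form l0" "\<forall>v\<in>w ` (\<W> - {{0}}). l0 v \<noteq> 0" by blast+
  define \<W>' where "\<W>' = (\<lambda>W. W \<inter> {v. l0 v = 0}) ` \<W>"
  have "subspace W \<and> dim W \<le> k" if "W \<in> \<W>'" for W
  proof -
    obtain W0 where W0: "W0 \<in> \<W>" "W = W0 \<inter> {v. l0 v = 0}" using \<open>W \<in> \<W>'\<close> by (auto simp: \<W>'_def)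
    have sub0: "subspace W0" "dim W0 \<le> Suc k" using Suc.prems(2)[OF W0(1)] by auto
    have "subspace {v. l0 v = 0}"
      using linear_formD[OF l0(1)] by (auto simp: subspace_def)
    then have sub: "subspace W" unfolding W0(2) by (rule subspace_inter[OF sub0(1)])
    have "dim W \<le> k"
    proof (cases "W0 = {0}")
      case True
      then have "W \<subseteq> {0}" using W0(2) by blast
      then have "dim W = 0" by (rule dim_eq_0[THEN iffD2])
      then show ?thesis by linarith
    next
      case False
      then have "w W0 \<in> W0 - W" using w[OF W0(1) False] l0(2) W0 by auto
      then have "W \<subset> W0" using W0(2) by blast
      then have "dim W < dim W0" by (intro dim_psubset) (simp add: span_eq_iff[THEN iffD2] sub sub0)
      then show ?thesis using sub0(2) by simp
    qed
    then show ?thesis using sub by blast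
  qed
  moreover have "finite \<W>'" using Suc.prems(1) by (simp add: \<W>'_def)
  ultimately have "\<exists>l. (\<forall>j<k. linear_form (l j)) \<and> (\<forall>W\<in>\<W>'. \<forall>w\<in>W. (\<forall>j<k. l j w = 0) \<longrightarrow> w = 0)"
    by (intro Suc.IH)
  then obtain l where "(\<forall>j<k. linear_form (l j)) \<and> (\<forall>W\<in>\<W>'. \<forall>w\<in>W. (\<forall>j<k. l j w = 0) \<longrightarrow> w = 0)" ..
  then have l: "\<forall>j<k. linear_form (l j)" "\<forall>W\<in>\<W>'. \<forall>w\<in>W. (\<forall>j<k. l j w = 0) \<longrightarrow> w = 0"
    by simp_all
  show ?case
  proof (intro exI[of _ "\<lambda>j. if j = k then l0 else l j"] conjI allI impI ballI)
    show "linear_form (if j = k then l0 else l j)" if "j < Suc k" for j using that l(1) l0(1) by auto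
    fix W v assume W: "W \<in> \<W>" "v \<in> W" "\<forall>j<Suc k. (if j = k then l0 else l j) v = 0"
    have "l0 v = 0" using W(3)[rule_format, of k] by simp
    moreover have "\<forall>j<k. l j v = 0"
    proof (intro allI impI)
      fix j assume "j < k" then show "l j v = 0" using W(3)[rule_format, of j] by simp
    qed
    moreover have "W \<inter> {v. l0 v = 0} \<in> \<W>'" using W(1) by (simp add: \<W>'_def)
    moreover have "v \<in> W \<inter> {v. l0 v = 0}" using W(2) \<open>l0 v = 0\<close> by simp
    ultimately show "v = 0" using bspec[OF bspec[OF l(2)], of "W \<inter> {v. l0 v = 0}" v] by simp
  qed
qed

text \<open>Conversely, one form lowers the dimension by at most one.\<close>

lemma exists_common_zero:
  "(\<And>j. j < k \<Longrightarrow> linear_form (l j)) \<Longrightarrow> subspace W \<Longrightarrow> k < dim W \<Longrightarrow>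
    \<exists>v\<in>W. v \<noteq> 0 \<and> (\<forall>j<k. l j v = 0)"
proof (induction k arbitrary: W)
  case 0
  then have "dim W \<noteq> 0" by linarith
  then have "\<not> W \<subseteq> {0}" unfolding dim_eq_0 .
  then show ?case by auto
next
  case (Suc k)
  note lk = linear_formD[OF Suc.prems(1)[OF lessI]]
  define W' where "W' = W \<inter> {v. l k v = 0}"
  have "subspace {v. l k v = 0}" using lk by (auto simp: subspace_def)
  then have sub: "subspace W'" unfolding W'_def by (rule subspace_inter[OF Suc.prems(2)])
  have "dim W \<le> Suc (dim W')"
  proof (cases "W \<subseteq> W'")
    case True
    then show ?thesis using dim_subset[of W W'] by simp
  next
    case False
    then obtain w where w: "w \<in> W" "l k w \<noteq> 0" unfolding W'_def by blast
    have "W \<subseteq> span (insert w W')"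
    proof
      fix x assume x: "x \<in> W"
      define c where "c = l k x / l k w"
      have "x - scale c w \<in> W'"
        using x w Suc.prems(2) by (auto simp: W'_def c_def lk intro: subspace_diff subspace_scale)
      then have "(x - scale c w) + scale c w \<in> span (insert w W')"
        by (intro span_add span_scale span_base) auto
      then show "x \<in> span (insert w W')" by simp
    qed
    then have "dim W \<le> dim (span (insert w W'))" by (rule dim_subset)
    then have "dim W \<le> dim (insert w W')" by (simp only: dim_span)
    then show ?thesis by (simp add: dim_insert split: if_splits)
  qed
  then have "k < dim W'" using Suc.prems(3) by simp
  then have "\<exists>v\<in>W'. v \<noteq> 0 \<and> (\<forall>j<k. l j v = 0)"
    by (intro Suc.IH sub Suc.prems(1)) simp_all
  then obtain v where v: "v \<in> W'" "v \<noteq> 0 \<and> (\<forall>j<k. l j v = 0)" by (rule bexE)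
  have "\<forall>j<Suc k. l j v = 0"
  proof (intro allI impI)
    fix j assume "j < Suc k"
    then show "l j v = 0" using v by (cases "j = k") (simp_all add: W'_def)
  qed
  then show ?case using v by (intro bexI[of _ v]) (simp_all add: W'_def)
qed

text \<open>Independence is phrased for coefficient functions on indices, so that coordinates can be
  read off from a vanishing sum.\<close>

lemma exists_indexed_basis:
  assumes "v \<noteq> 0"
  shows "\<exists>b. b 0 = v \<and> (\<forall>s. (\<Sum>k<dim UNIV. scale (s k) (b k)) = 0 \<longrightarrow> (\<forall>k<dim UNIV. s k = 0))"
proof -
  have "independent {v}" using assms by simp
  then obtain B where B: "{v} \<subseteq> B" "independent B" "UNIV \<subseteq> span B"
    using maximal_independent_subset_extend[of "{v}" UNIV] by auto
  have card: "card B = dim UNIV" using basis_card_eq_dim[of B UNIV] B by auto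
  have finB: "finite B" by (rule finiteI_independent[OF B(2)])
  obtain d where d: "dim UNIV = Suc d" using card B(1) finB by (metis card_0_eq empty_iff insert_subset not0_implies_Suc)
  have cardB: "card B = Suc d" using card d by (rule trans)
  then have "card (B - {v}) = d" using B(1) by simp
  then obtain e where e: "bij_betw e {..<d} (B - {v})"
    using ex_bij_betw_nat_finite[of "B - {v}"] finB by (auto simp: atLeast0LessThan)
  define b where "b = case_nat v e"
  have "bij_betw b {..<Suc d} B"
    unfolding bij_betw_def
  proof
    have "b ` {..<Suc d} = insert (b 0) ((b \<circ> Suc) ` {..<d})"
      unfolding lessThan_Suc_eq_insert_0 by (simp add: image_comp)
    also have "\<dots> = B" using e B(1) by (auto simp: b_def bij_betw_def comp_def)
    finally show im: "b ` {..<Suc d} = B" .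
    show "inj_on b {..<Suc d}" by (rule eq_card_imp_inj_on) (simp_all add: im cardB)
  qed
  then obtain D where D: "dim UNIV = D" and b: "bij_betw b {..<D} B" using d by metis
  have "s k = 0" if s: "(\<Sum>k<D. scale (s k) (b k)) = 0" and k: "k < D" for s k
  proof -
    define u where "u = (\<lambda>x. s (inv_into {..<D} b x))"
    have inv: "inv_into {..<D} b (b k) = k" if "k < D" for k
      using bij_betw_imp_inj_on[OF b] that by (simp add: inv_into_f_f)
    have "(\<Sum>x\<in>B. scale (u x) x) = (\<Sum>k<D. scale (u (b k)) (b k))"
      by (rule sum.reindex_bij_betw[OF b, symmetric])
    also have "\<dots> = 0" using s by (simp add: u_def inv)
    finally have "u x = 0" if "x \<in> B" for x
      using B(2) that dependent_finite[OF finB] by blast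
    then have "u (b k) = 0" using b k by (auto simp: bij_betw_def)
    then show ?thesis using inv[OF k] by (simp add: u_def)
  qed
  moreover have "b 0 = v" by (simp add: b_def)
  ultimately show ?thesis unfolding D by blast
qed

text \<open>A morphism from affine \<open>n\<close>-space to \<open>V\<close>, described without
  coordinates on \<open>V\<close>: linear forms pull back to polynomials.\<close>

definition regular_map :: "nat \<Rightarrow> ((nat \<Rightarrow> 'a) \<Rightarrow> 'b) \<Rightarrow> bool" where
  "regular_map n \<Phi> \<longleftrightarrow> (\<forall>l. linear_form l \<longrightarrow> (\<exists>p\<in>mpolys_below n. \<forall>t. meval t p = l (\<Phi> t)))"

lemma regular_map_const: "regular_map n (\<lambda>_. u)"
  unfolding regular_map_def by (meson meval_mconst mpolys_below.const)

lemma regular_map_add: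
  "regular_map n \<Phi> \<Longrightarrow> regular_map n \<Psi> \<Longrightarrow> regular_map n (\<lambda>t. \<Phi> t + \<Psi> t)"
  unfolding regular_map_def by (metis linear_formD(1) meval_add mpolys_below.add)

lemma regular_map_diff:
  "regular_map n \<Phi> \<Longrightarrow> regular_map n \<Psi> \<Longrightarrow> regular_map n (\<lambda>t. \<Phi> t - \<Psi> t)"
  unfolding regular_map_def by (metis linear_formD(4) meval_diff mpolys_below_diff)

lemma regular_map_scale:
  assumes "p \<in> mpolys_below n"
  shows "regular_map n (\<lambda>t. scale (meval t p) u)"
  unfolding regular_map_def
proof (intro allI impI)
  fix l assume "linear_form l"
  then have "meval t (p * mconst (l u)) = l (scale (meval t p) u)" for t
    by (simp add: linear_formD)
  then show "\<exists>p'\<in>mpolys_below n. \<forall>t. meval t p' = l (scale (meval t p) u)"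
    using mpolys_below.mult[OF assms mpolys_below.const] by blast
qed

lemma regular_map_sum:
  "finite I \<Longrightarrow> (\<And>i. i \<in> I \<Longrightarrow> regular_map n (\<Phi> i)) \<Longrightarrow> regular_map n (\<lambda>t. \<Sum>i\<in>I. \<Phi> i t)"
  by (induction I rule: finite_induct) (auto intro: regular_map_const regular_map_add)

lemma regular_map_linear:
  assumes "Vector_Spaces.linear scale scale T" "regular_map n \<Phi>"
  shows "regular_map n (\<lambda>t. T (\<Phi> t))"
  unfolding regular_map_def
proof (intro allI impI)
  fix l assume "linear_form l"
  then have "linear_form (\<lambda>x. l (T x))"
    using assms(1) by (auto simp: linear_form_iff Vector_Spaces.linear_iff)
  then show "\<exists>p\<in>mpolys_below n. \<forall>t. meval t p = l (T (\<Phi> t))"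
    using assms(2) unfolding regular_map_def by blast
qed

lemma regular_map_polynomial:
  assumes \<Phi>: "regular_map n \<Phi>"
  shows "f \<in> polynomial_functions scale \<Longrightarrow> \<exists>p\<in>mpolys_below n. \<forall>t. meval t p = f (\<Phi> t)"
proof (induction f rule: polynomial_functions.induct)
  case (const c)
  show ?case by (rule bexI[OF _ mpolys_below.const[of c]]) simp
next
  case (linear_form l)
  then show ?case using \<Phi> unfolding regular_map_def by blast
next
  case (add p q)
  then show ?case by (metis meval_add mpolys_below.add)
next
  case (mult p q)
  then show ?case by (metis meval_mult mpolys_below.mult)
qed

end

text \<open>The zero polynomial is excluded because every equation becomes a chart function, and
  these must be nonzero.\<close>

definition closed_below :: "nat \<Rightarrow> (nat \<Rightarrow> 'k::field) set \<Rightarrow> bool" where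
  "closed_below n Z \<longleftrightarrow> (\<exists>S. finite S \<and> S \<subseteq> mpolys_below n \<and> 0 \<notin> S \<and> Z = zeros S)"

lemma closed_below_meval:
  assumes "p \<in> mpolys_below n"
  shows "closed_below n {t. meval t p = 0}"
proof (cases "p = 0")
  case True
  then show ?thesis unfolding closed_below_def by (intro exI[of _ "{}"]) (simp add: zeros_def)
next
  case False
  then show ?thesis
    unfolding closed_below_def using assms by (intro exI[of _ "{p}"]) (simp add: zeros_def)
qed

lemma closed_below_UNIV: "closed_below n UNIV"
  using closed_below_meval[OF mpolys_below_0] by simp

lemma closed_below_empty: "closed_below n {}"
  using closed_below_meval[OF mpolys_below_1] by simp

lemma closed_below_Int:
  assumes "closed_below n Y" "closed_below n Z"
  shows "closed_below n (Y \<inter> Z)"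
proof -
  obtain S T where "finite S" "S \<subseteq> mpolys_below n" "0 \<notin> S" "Y = zeros S"
    and "finite T" "T \<subseteq> mpolys_below n" "0 \<notin> T" "Z = zeros T"
    using assms unfolding closed_below_def by blast
  then show ?thesis
    unfolding closed_below_def by (intro exI[of _ "S \<union> T"]) (auto simp: zeros_def)
qed

lemma closed_below_Un:
  assumes "closed_below n Y" "closed_below n Z"
  shows "closed_below n (Y \<union> Z)"
proof -
  obtain S T where S: "finite S" "S \<subseteq> mpolys_below n" "0 \<notin> S" "Y = zeros S"
    and T: "finite T" "T \<subseteq> mpolys_below n" "0 \<notin> T" "Z = zeros T"
    using assms unfolding closed_below_def by blast
  define U where "U = (\<lambda>(f, g). f * g) ` (S \<times> T)"
  have "finite U" using S(1) T(1) by (simp add: U_def)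
  moreover have "U \<subseteq> mpolys_below n" using S(2) T(2) by (auto simp: U_def intro: mpolys_below.mult)
  moreover have "0 \<notin> U" using S(3) T(3) by (auto simp: U_def)
  moreover have "Y \<union> Z = zeros U"
    unfolding S(4) T(4) U_def zeros_def by fastforce
  ultimately show ?thesis unfolding closed_below_def by blast
qed

lemma closed_below_INT:
  "finite I \<Longrightarrow> (\<And>i. i \<in> I \<Longrightarrow> closed_below n (Z i)) \<Longrightarrow> closed_below n (\<Inter>i\<in>I. Z i)"
  by (induction I rule: finite_induct) (auto intro: closed_below_UNIV closed_below_Int)

lemma closed_below_UN:
  "finite I \<Longrightarrow> (\<And>i. i \<in> I \<Longrightarrow> closed_below n (Z i)) \<Longrightarrow> closed_below n (\<Union>i\<in>I. Z i)"
  by (induction I rule: finite_induct) (auto intro: closed_below_empty closed_below_Un)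

lemma (in finite_dimensional_vector_space) closed_below_regular_map:
  assumes inf: "infinite (UNIV :: 'a set)" and \<Phi>: "regular_map n \<Phi>"
  shows "closed_below n {t. \<Phi> t = 0}"
proof -
  \<comment> \<open>As many generic forms as the dimension have common kernel 0, which turns the
    vector equation into scalar ones.\<close>
  obtain l where l: "\<And>j. j < dim UNIV \<Longrightarrow> linear_form (l j)"
      "\<And>w. (\<forall>j<dim UNIV. l j w = 0) \<Longrightarrow> w = 0"
    using exists_forms_separating_subspaces[OF inf, of "{UNIV}" "dim UNIV"] by auto
  have "{t. \<Phi> t = 0} = (\<Inter>j\<in>{..<dim UNIV}. {t. l j (\<Phi> t) = 0})"
    using l linear_formD(3) by auto
  moreover have "closed_below n {t. l j (\<Phi> t) = 0}" if j: "j < dim UNIV" for j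
  proof -
    obtain p where "p \<in> mpolys_below n" "\<And>t. meval t p = l j (\<Phi> t)"
      using \<Phi> l(1)[OF j] unfolding regular_map_def by blast
    then show ?thesis using closed_below_meval[of p n] by simp
  qed
  ultimately show ?thesis by (auto intro: closed_below_INT)
qed

text \<open>Some equation of \<open>C\<close> is nonzero at the origin; it serves as the
  \<open>q\<close> whose nonvanishing locus misses \<open>C\<close>.\<close>

theorem closed_separated_zeros_contradiction:
  fixes F :: "'k::alg_closed_field mpoly set"
  assumes closed: "closed_below n A" "closed_below n B" "closed_below n C"
    and F: "finite F" "F \<subseteq> mpolys_below n" "card F + 2 \<le> n" "zeros F = A \<union> B \<union> C"
    and C: "(\<lambda>_. 0) \<notin> C"
    and AB: "\<And>v i. v \<in> A \<Longrightarrow> v \<in> B \<Longrightarrow> i < n \<Longrightarrow> v i = 0"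
    and axis0: "\<And>v. (\<And>i. i < n \<Longrightarrow> i \<noteq> 0 \<Longrightarrow> v i = 0) \<Longrightarrow> v \<in> A"
    and axis1: "\<And>v. (\<And>i. i < n \<Longrightarrow> i \<noteq> 1 \<Longrightarrow> v i = 0) \<Longrightarrow> v \<in> B"
  shows False
proof -
  obtain SA where SA: "finite SA" "SA \<subseteq> mpolys_below n" "0 \<notin> SA" "A = zeros SA"
    using closed(1) unfolding closed_below_def by blast
  obtain SB where SB: "finite SB" "SB \<subseteq> mpolys_below n" "0 \<notin> SB" "B = zeros SB"
    using closed(2) unfolding closed_below_def by blast
  obtain SC where SC: "SC \<subseteq> mpolys_below n" "C = zeros SC"
    using closed(3) unfolding closed_below_def by blast
  obtain q where q: "q \<in> SC" "meval (\<lambda>_. 0) q \<noteq> 0" using C SC(2) by (auto simp: zeros_def)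
  have Z0: "zeros (F - {0}) = zeros F" by (auto simp: zeros_def)
  have "card (F - {0}) \<le> card F" by (intro card_mono F(1)) auto
  show False
  proof (rule separated_zeros_contradiction[of SA SB "F - {0}" n q])
    show "v \<in> zeros SA \<or> v \<in> zeros SB \<or> meval v q = 0" if "v \<in> zeros (F - {0})" for v
      using that q(1) unfolding Z0 F(4) SA(4) SB(4) SC(2) by (auto simp: zeros_def)
    show "zeros SA \<subseteq> zeros (F - {0})" "zeros SB \<subseteq> zeros (F - {0})"
      unfolding Z0 F(4) SA(4) SB(4) by auto
    show "card (F - {0}) + 2 \<le> n" using \<open>card (F - {0}) \<le> card F\<close> F(3) by simp
  qed (use F SA SB SC q AB axis0 axis1 in auto)
qed

section \<open>Generation of isotropy groups\<close>

text \<open>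
  Linear coordinates on \<open>V \<times> V\<close>, written as the pair \<open>(\<Phi>, \<Phi> + \<Psi>)\<close>, whose first two axes are spanned
  by \<open>(v, v)\<close> and \<open>(v, v + \<delta>)\<close>.
\<close>

lemma (in finite_dimensional_vector_space) adapted_coordinates:
  assumes v: "v \<noteq> 0" and \<delta>: "\<delta> \<noteq> 0"
  obtains \<Phi> \<Psi> where "regular_map (2 * dim UNIV) \<Phi>" "regular_map (2 * dim UNIV) \<Psi>"
    "\<forall>t. \<Phi> t = 0 \<longrightarrow> \<Psi> t = 0 \<longrightarrow> (\<forall>i<2 * dim UNIV. t i = 0)"
    "\<forall>t. (\<forall>i<2 * dim UNIV. i \<noteq> 0 \<longrightarrow> t i = 0) \<longrightarrow> \<Phi> t = scale (t 0) v \<and> \<Psi> t = 0"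
    "\<forall>t. (\<forall>i<2 * dim UNIV. i \<noteq> 1 \<longrightarrow> t i = 0) \<longrightarrow> \<Phi> t = scale (t 1) v \<and> \<Psi> t = scale (t 1) \<delta>"
proof -
  obtain d where d: "dim UNIV = d" by blast
  have "d \<noteq> 0"
  proof
    assume "d = 0"
    then have "dim UNIV = 0" using d by (rule trans[rotated])
    then have "(UNIV :: 'b set) \<subseteq> {0}" by (rule dim_eq_0[THEN iffD1])
    then show False using v by blast
  qed
  then have d0: "0 < d" by simp
  obtain b where b: "b 0 = v" "\<And>s. (\<Sum>k<d. scale (s k) (b k)) = 0 \<Longrightarrow> \<forall>k<d. s k = 0"
    using exists_indexed_basis[OF v] unfolding d by blast
  obtain c where c: "c 0 = \<delta>" "\<And>s. (\<Sum>k<d. scale (s k) (c k)) = 0 \<Longrightarrow> \<forall>k<d. s k = 0"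
    using exists_indexed_basis[OF \<delta>] unfolding d by blast
  \<comment> \<open>Motion along \<open>(v, v + \<delta>)\<close> changes \<open>\<Phi>\<close> by
    \<open>v\<close> and \<open>\<Psi>\<close> by \<open>\<delta>\<close>, so variable 1 enters both
    leading coordinates and variable 0 only that of \<open>\<Phi>\<close>. Variables 2 to
    \<open>d\<close> and \<open>d + 1\<close> to \<open>2 * d - 1\<close> serve the remaining basis
    vectors.\<close>
  define P where "P = (\<lambda>k. if k = 0 then mvar 0 + mvar 1 else mvar (Suc k) :: 'a mpoly)"
  define Q where "Q = (\<lambda>k. if k = 0 then mvar 1 else mvar (d + k) :: 'a mpoly)"
  define \<Phi> where "\<Phi> = (\<lambda>t. \<Sum>k<d. scale (meval t (P k)) (b k))"
  define \<Psi> where "\<Psi> = (\<lambda>t. \<Sum>k<d. scale (meval t (Q k)) (c k))"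
  have evP: "meval t (P k) = (if k = 0 then t 0 + t 1 else t (Suc k))"
    and evQ: "meval t (Q k) = (if k = 0 then t 1 else t (d + k))" for t k
    by (simp_all add: P_def Q_def)
  have P: "P k \<in> mpolys_below (2 * d)" and Q: "Q k \<in> mpolys_below (2 * d)" if "k < d" for k
    using that unfolding P_def Q_def by (auto intro!: mpolys_below.intros)
  have first: "(\<Sum>k<d. scale (s k) (e k)) = scale (s 0) (e 0)"
    if "\<And>k. 0 < k \<Longrightarrow> k < d \<Longrightarrow> s k = 0" for s :: "nat \<Rightarrow> 'a" and e :: "nat \<Rightarrow> 'b"
  proof -
    have "(\<Sum>k<d. scale (s k) (e k)) = (\<Sum>k\<in>{0}. scale (s k) (e k))"
      using d0 that by (intro sum.mono_neutral_right) auto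
    then show ?thesis by simp
  qed
  have reg: "regular_map (2 * d) \<Phi>" "regular_map (2 * d) \<Psi>"
    unfolding \<Phi>_def \<Psi>_def by (intro regular_map_sum regular_map_scale P Q; simp)+
  have inj: "\<forall>i<2 * d. t i = 0" if t: "\<Phi> t = 0" "\<Psi> t = 0" for t
  proof -
    have Pz: "meval t (P k) = 0" and Qz: "meval t (Q k) = 0" if "k < d" for k
      using b(2)[of "\<lambda>k. meval t (P k)"] c(2)[of "\<lambda>k. meval t (Q k)"] t that
      unfolding \<Phi>_def \<Psi>_def by blast+
    have t1: "t 1 = 0" using Qz[OF d0] unfolding evQ by simp
    then have t0: "t 0 = 0" using Pz[OF d0] unfolding evP by simp
    have "t i = 0" if i: "i < 2 * d" for i
    proof -
      consider "i = 0" | "i = 1" | "1 < i" "i \<le> d" | "d < i" by linarith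
      then show ?thesis
      proof cases
        case 3
        then show ?thesis using Pz[of "i - 1"] unfolding evP by simp
      next
        case 4
        then show ?thesis using Qz[of "i - d"] i unfolding evQ by simp
      qed (use t0 t1 in simp_all)
    qed
    then show ?thesis by blast
  qed
  have axis0: "\<Phi> t = scale (t 0) v \<and> \<Psi> t = 0" if t: "\<forall>i<2 * d. i \<noteq> 0 \<longrightarrow> t i = 0" for t
  proof -
    have t1: "t 1 = 0" using t d0 by simp
    have "\<Phi> t = scale (meval t (P 0)) (b 0)" "\<Psi> t = scale (meval t (Q 0)) (c 0)"
      unfolding \<Phi>_def \<Psi>_def by (rule first; use t in \<open>simp add: evP evQ\<close>)+
    then show ?thesis using t1 by (simp add: evP evQ b(1))
  qed
  have axis1: "\<Phi> t = scale (t 1) v \<and> \<Psi> t = scale (t 1) \<delta>" if t: "\<forall>i<2 * d. i \<noteq> 1 \<longrightarrow> t i = 0" for t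
  proof -
    have t0: "t 0 = 0" using t d0 by simp
    have "\<Phi> t = scale (meval t (P 0)) (b 0)" "\<Psi> t = scale (meval t (Q 0)) (c 0)"
      unfolding \<Phi>_def \<Psi>_def by (rule first; use t in \<open>simp add: evP evQ\<close>)+
    then show ?thesis using t0 by (simp add: evP evQ b(1) c(1))
  qed
  have "\<forall>t. \<Phi> t = 0 \<longrightarrow> \<Psi> t = 0 \<longrightarrow> (\<forall>i<2 * d. t i = 0)"
    by (rule allI, intro impI, rule inj)
  moreover have "\<forall>t. (\<forall>i<2 * d. i \<noteq> 0 \<longrightarrow> t i = 0) \<longrightarrow> \<Phi> t = scale (t 0) v \<and> \<Psi> t = 0"
    by (rule allI, rule impI, rule axis0)
  moreover have "\<forall>t. (\<forall>i<2 * d. i \<noteq> 1 \<longrightarrow> t i = 0) \<longrightarrow> \<Phi> t = scale (t 1) v \<and> \<Psi> t = scale (t 1) \<delta>"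
    by (rule allI, rule impI, rule axis1)
  ultimately show thesis
    by (rule that[of \<Phi> \<Psi>, unfolded d, OF reg])
qed

section \<open>Linear group actions and separation of orbits\<close>

lemma linear_group_actionD:
  assumes "linear_group_action G scale \<phi>"
  shows "group G" "\<phi> \<one>\<^bsub>G\<^esub> v = v"
    "g \<in> carrier G \<Longrightarrow> h \<in> carrier G \<Longrightarrow> \<phi> (g \<otimes>\<^bsub>G\<^esub> h) v = \<phi> g (\<phi> h v)"
    "g \<in> carrier G \<Longrightarrow> \<phi> (inv\<^bsub>G\<^esub> g) (\<phi> g v) = v"
    "g \<in> carrier G \<Longrightarrow> Vector_Spaces.linear scale scale (\<phi> g)"
    "orbit G \<phi> v = {\<phi> g v | g. g \<in> carrier G}"
proof -
  interpret group_action G UNIV \<phi> using assms by (simp add: linear_group_action_def)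
  show G: "group G" using group_hom group_hom.axioms(1) by blast
  show 1: "\<phi> \<one>\<^bsub>G\<^esub> v = v" for v using fun_cong[OF id_eq_one, of v] by simp
  show 2: "\<phi> (g \<otimes>\<^bsub>G\<^esub> h) v = \<phi> g (\<phi> h v)" if "g \<in> carrier G" "h \<in> carrier G" for g h v
    using composition_rule[of v g h] that by simp
  show "\<phi> (inv\<^bsub>G\<^esub> g) (\<phi> g v) = v" if "g \<in> carrier G"
    using 2[of "inv\<^bsub>G\<^esub> g" g v] that 1 G by (simp add: group.l_inv)
  show "g \<in> carrier G \<Longrightarrow> Vector_Spaces.linear scale scale (\<phi> g)"
    using assms by (simp add: linear_group_action_def)
  show "orbit G \<phi> v = {\<phi> g v | g. g \<in> carrier G}" by (simp add: orbit_def)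
qed

lemma subgroup_isotropy:
  assumes "linear_group_action G scale \<phi>"
  shows "subgroup (isotropy_subgroup G \<phi> U) G"
proof -
  note act = linear_group_actionD[OF assms]
  interpret group G by (rule act(1))
  have "\<phi> (inv\<^bsub>G\<^esub> g) u = u" if "g \<in> isotropy_subgroup G \<phi> U" "u \<in> U" for g u
    using that act(4)[of g u] by (auto simp: isotropy_subgroup_def)
  then show ?thesis
    by (intro subgroupI) (auto simp: isotropy_subgroup_def act intro: exI[of _ "\<one>\<^bsub>G\<^esub>"])
qed

text \<open>Through this equivalence the equations \<open>f v = f w\<close> describe the union of
  the graphs of the group elements.\<close>

lemma separating_set_iff:
  assumes act: "linear_group_action G scale \<phi>" and sep: "separating_set G scale \<phi> E"
  shows "(\<forall>f\<in>E. f v = f w) \<longleftrightarrow> (\<exists>g\<in>carrier G. w = \<phi> g v)"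
proof
  note actD = linear_group_actionD[OF act]
  interpret group G by (rule actD(1))
  {
    assume "\<forall>f\<in>E. f v = f w"
    then have "orbit G \<phi> v = orbit G \<phi> w" using sep unfolding separating_set_def by blast
    moreover have "w \<in> orbit G \<phi> w" unfolding actD(6) using actD(2)[of w] one_closed by force
    ultimately show "\<exists>g\<in>carrier G. w = \<phi> g v" unfolding actD(6) by blast
  }
  assume "\<exists>g\<in>carrier G. w = \<phi> g v"
  then obtain g where g: "g \<in> carrier G" "w = \<phi> g v" by blast
  have "f v = f w" if "f \<in> E" for f
  proof -
    have "function_action G \<phi> g f = f"
      using sep that g(1) unfolding separating_set_def invariant_ring_def by blast
    then have "f w = f (\<phi> (inv\<^bsub>G\<^esub> g) w)" by (metis function_action_def)
    then show ?thesis using actD(4)[OF g(1), of v] g(2) by simp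
  qed
  then show "\<forall>f\<in>E. f v = f w" by blast
qed


lemma linear_mapD:
  assumes "Vector_Spaces.linear s1 s2 T"
  shows "T (x + y) = T x + T y" "T (s1 c x) = s2 c (T x)" "T 0 = 0" "T (x - y) = T x - T y"
proof -
  interpret Vector_Spaces.linear s1 s2 T by (rule assms)
  show "T (x + y) = T x + T y" "T (s1 c x) = s2 c (T x)" "T 0 = 0" "T (x - y) = T x - T y"
    by (rule add scale zero diff)+
qed

lemma isotropy_subgroup_generated:
  fixes G :: "('g, 'b) monoid_scheme"
    and scale :: "'k :: alg_closed_field \<Rightarrow> 'v :: ab_group_add \<Rightarrow> 'v"
  assumes V: "finite_dimensional_vector_space scale Basis"
    and dim: "vector_space.dim scale UNIV = d"
    and finG: "finite (carrier G)"
    and act: "linear_group_action G scale \<phi>"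
    and r: "r \<ge> 1"
    and E: "separating_set G scale \<phi> E" "finite E" "card E = d + r - 1"
  shows "isotropy_subgroup G \<phi> U =
    generate G {\<sigma> \<in> isotropy_subgroup G \<phi> U. codimension scale (fixed_subspace \<phi> \<sigma>) \<le> r}"
    (is "?K = generate G ?S")
proof -
  interpret V: finite_dimensional_vector_space scale Basis by (rule V)
  note actD = linear_group_actionD[OF act]
  interpret group G by (rule actD(1))
  note lin = linear_mapD[OF actD(5)]
  note inf = infinite_alg_closed_field[where 'k = 'k]
  have K: "subgroup ?K G" by (rule subgroup_isotropy[OF act])
  have KG: "?K \<subseteq> carrier G" by (auto simp: isotropy_subgroup_def)
  define H where "H = generate G ?S"
  have H: "subgroup H G" unfolding H_def using KG by (intro generate_is_subgroup) auto
  have HK: "H \<subseteq> ?K" unfolding H_def by (rule generate_subgroup_incl[OF _ K]) auto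
  have "?K \<subseteq> H"
  proof
    fix g0 assume g0K: "g0 \<in> ?K"
    show "g0 \<in> H"
    proof (rule ccontr)
      assume g0H: "g0 \<notin> H"
      define fix_of where "fix_of = (\<lambda>g. {v. \<phi> g v = v})"
      have sub_fix: "V.subspace (fix_of g)" if "g \<in> carrier G" for g
        using lin[OF that] unfolding fix_of_def V.subspace_def by simp
      \<comment> \<open>An element with larger fixed space would be one of the generators of
        \<open>H\<close>.\<close>
      have large: "V.dim (fix_of g) + r < d" if "g \<in> ?K - H" for g
      proof -
        have "g \<notin> ?S" using that generate.incl[of g ?S G] unfolding H_def by blast
        then have "\<not> codimension scale (fixed_subspace \<phi> g) \<le> r" using that by blast
        moreover have "fixed_subspace \<phi> g = fix_of g" by (simp add: fixed_subspace_def fix_of_def)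
        ultimately have "r < d - V.dim (fix_of g)" unfolding codimension_def dim by (metis not_le)
        then show ?thesis by linarith
      qed
      \<comment> \<open>By \<open>large\<close> the subtraction does not truncate;
        \<open>d + r - 1\<close> and \<open>k\<close> add up to \<open>2 * d - 2\<close>.\<close>
      define k where "k = d - r - 1"
      have kd: "k < d" "card E + k + 2 \<le> 2 * d" using large[of g0] g0K g0H r E(3) by (auto simp: k_def)
      have "finite (fix_of ` (?K - H))" using finite_subset[OF KG finG] by simp
      moreover have "V.subspace W \<and> V.dim W \<le> k" if W: "W \<in> fix_of ` (?K - H)" for W
      proof -
        obtain g where g: "g \<in> ?K - H" "W = fix_of g" using W by blast
        then show ?thesis using sub_fix[of g] large[OF g(1)] KG by (auto simp: k_def)
      qed
      ultimately have "\<exists>l. (\<forall>j<k. V.linear_form (l j)) \<and>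
          (\<forall>W\<in>fix_of ` (?K - H). \<forall>w\<in>W. (\<forall>j<k. l j w = 0) \<longrightarrow> w = 0)"
        by (rule V.exists_forms_separating_subspaces[OF inf])
      then obtain l where l': "(\<forall>j<k. V.linear_form (l j)) \<and>
          (\<forall>W\<in>fix_of ` (?K - H). \<forall>w\<in>W. (\<forall>j<k. l j w = 0) \<longrightarrow> w = 0)" ..
      then have l: "V.linear_form (l j)" if "j < k" for j using that by blast
      have free: "w = 0" if "g \<in> ?K - H" "\<phi> g w = w" "\<forall>j<k. l j w = 0" for g w
      proof -
        have "fix_of g \<in> fix_of ` (?K - H)" "w \<in> fix_of g" using that by (auto simp: fix_of_def)
        then show ?thesis using l' that(3) by blast
      qed
      have "k < V.dim UNIV" using kd(1) unfolding dim .
      then obtain v0 where v0: "v0 \<noteq> 0" "\<forall>j<k. l j v0 = 0"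
        using V.exists_common_zero[of k l UNIV] l V.subspace_UNIV by blast
      \<comment> \<open>\<open>(v0, v0 + \<delta>)\<close> lies on the graph of \<open>g0\<close>,
        and \<open>\<delta>\<close> is nonzero because \<open>g0\<close> fixes no nonzero common
        zero of the forms \<open>l j\<close>.\<close>
      define \<delta> where "\<delta> = \<phi> g0 v0 - v0"
      have "\<delta> \<noteq> 0" using free[of g0 v0] g0K g0H v0 by (auto simp: \<delta>_def)
      \<comment> \<open>A generic common fixed vector of \<open>?K\<close>. An element outside
        \<open>?K\<close> moves some vector of \<open>U\<close>, and \<open>U\<close> lies in the
        space of these fixed vectors.\<close>
      have "\<exists>u\<in>{v. \<forall>h\<in>?K. \<phi> h v = v}. \<forall>g\<in>carrier G - ?K. \<not> \<phi> g u = u"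
      proof (rule exists_avoiding[OF inf, where comb = "\<lambda>s x y. x + scale s y"])
        show "finite (carrier G - ?K)" using finG by simp
        have "0 \<in> {v. \<forall>h\<in>?K. \<phi> h v = v}" using lin(3) KG by blast
        then show "{v. \<forall>h\<in>?K. \<phi> h v = v} \<noteq> {}" by blast
        show "x + scale s y \<in> {v. \<forall>h\<in>?K. \<phi> h v = v}"
          if "x \<in> {v. \<forall>h\<in>?K. \<phi> h v = v}" "y \<in> {v. \<forall>h\<in>?K. \<phi> h v = v}" for s x y
          using that lin(1,2) KG by auto
        show "\<exists>x\<in>{v. \<forall>h\<in>?K. \<phi> h v = v}. \<not> \<phi> g x = x" if "g \<in> carrier G - ?K" for g
          using that by (auto simp: isotropy_subgroup_def)
        show "finite {s. \<phi> g (x + scale s y) = x + scale s y}"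
          if g: "g \<in> carrier G - ?K" and "\<not> \<phi> g x = x \<or> \<not> \<phi> g y = y" for g x y
        proof -
          have "finite {s. (\<phi> g x - x) + scale s (\<phi> g y - y) = 0}"
            using that(2) by (intro V.finite_solutions) auto
          moreover have "\<phi> g (x + scale s y) = x + scale s y \<longleftrightarrow> (\<phi> g x - x) + scale s (\<phi> g y - y) = 0" for s
            using g lin(1,2)[of g] by (auto simp: V.scale_right_diff_distrib algebra_simps)
          ultimately show ?thesis by simp
        qed
      qed
      then obtain u where u: "\<And>h. h \<in> ?K \<Longrightarrow> \<phi> h u = u" "\<And>g. g \<in> carrier G - ?K \<Longrightarrow> \<phi> g u \<noteq> u" by blast
      obtain \<Phi> \<Psi> where reg: "V.regular_map (2 * d) \<Phi>" "V.regular_map (2 * d) \<Psi>"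
        and inj': "\<forall>t. \<Phi> t = 0 \<longrightarrow> \<Psi> t = 0 \<longrightarrow> (\<forall>i<2 * d. t i = 0)"
        and ax0': "\<forall>t. (\<forall>i<2 * d. i \<noteq> 0 \<longrightarrow> t i = 0) \<longrightarrow> \<Phi> t = scale (t 0) v0 \<and> \<Psi> t = 0"
        and ax1': "\<forall>t. (\<forall>i<2 * d. i \<noteq> 1 \<longrightarrow> t i = 0) \<longrightarrow> \<Phi> t = scale (t 1) v0 \<and> \<Psi> t = scale (t 1) \<delta>"
        using that by (rule V.adapted_coordinates[OF v0(1) \<open>\<delta> \<noteq> 0\<close>, unfolded dim])
      note inj = inj'[rule_format] and ax0 = ax0'[rule_format] and ax1 = ax1'[rule_format]
      have regu: "V.regular_map (2 * d) (\<lambda>t. u + \<Phi> t)" "V.regular_map (2 * d) (\<lambda>t. u + (\<Phi> t + \<Psi> t))"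
        by (intro V.regular_map_add V.regular_map_const reg)+
      \<comment> \<open>\<open>t\<close> stands for the point
        \<open>(u + \<Phi> t, u + \<Phi> t + \<Psi> t)\<close>, and \<open>T g\<close> collects the
        points on the graph of \<open>g\<close>. For \<open>g\<close> in \<open>?K\<close> the
        translation by \<open>u\<close> cancels, as \<open>TK\<close> shows.\<close>
      define T where "T = (\<lambda>g. {t. \<phi> g (u + \<Phi> t) - (u + (\<Phi> t + \<Psi> t)) = 0})"
      have TT: "t \<in> T g \<longleftrightarrow> u + (\<Phi> t + \<Psi> t) = \<phi> g (u + \<Phi> t)" for g t
        unfolding T_def mem_Collect_eq right_minus_eq by (rule eq_commute)
      define L where "L = (\<Inter>j\<in>{..<k}. {t. l j (\<Phi> t) = 0})"
      have TK: "t \<in> T g \<longleftrightarrow> \<Phi> t + \<Psi> t = \<phi> g (\<Phi> t)" if g: "g \<in> ?K" for g t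
      proof -
        have "g \<in> carrier G" using g KG by blast
        then have "\<phi> g (u + \<Phi> t) = u + \<phi> g (\<Phi> t)" using u(1)[OF g] lin(1)[of g] by simp
        then show ?thesis by (auto simp: T_def)
      qed
      have closedT: "closed_below (2 * d) (T g)" if "g \<in> carrier G" for g
        unfolding T_def
        by (intro V.closed_below_regular_map[OF inf] V.regular_map_diff V.regular_map_linear[OF actD(5)] regu that)
      have closedL: "closed_below (2 * d) L"
        unfolding L_def
      proof (rule closed_below_INT)
        fix j assume "j \<in> {..<k}"
        then obtain p where "p \<in> mpolys_below (2 * d)" "\<And>t. meval t p = l j (\<Phi> t)"
          using reg(1) l[of j] unfolding V.regular_map_def by blast
        then show "closed_below (2 * d) {t. l j (\<Phi> t) = 0}" using closed_below_meval[of p] by simp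
      qed simp
      define A where "A = L \<inter> (\<Union>h\<in>H. T h)"
      define B where "B = L \<inter> (\<Union>g\<in>?K - H. T g)"
      define C where "C = L \<inter> (\<Union>g\<in>carrier G - ?K. T g)"
      have closed: "closed_below (2 * d) A" "closed_below (2 * d) B" "closed_below (2 * d) C"
        unfolding A_def B_def C_def using HK KG finite_subset[OF _ finG]
        by (intro closed_below_Int closedL closed_below_UN closedT; blast)+
      have "\<forall>f\<in>E. \<exists>p\<in>mpolys_below (2 * d). \<forall>t. meval t p = f (u + \<Phi> t) - f (u + (\<Phi> t + \<Psi> t))"
      proof
        fix f assume "f \<in> E"
        then have "f \<in> polynomial_functions scale"
          using E(1) unfolding separating_set_def invariant_ring_def by blast
        then obtain p q where "p \<in> mpolys_below (2 * d)" "\<forall>t. meval t p = f (u + \<Phi> t)"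
          "q \<in> mpolys_below (2 * d)" "\<forall>t. meval t q = f (u + (\<Phi> t + \<Psi> t))"
          using V.regular_map_polynomial[OF regu(1)] V.regular_map_polynomial[OF regu(2)] by metis
        then show "\<exists>p\<in>mpolys_below (2 * d). \<forall>t. meval t p = f (u + \<Phi> t) - f (u + (\<Phi> t + \<Psi> t))"
          by (intro bexI[of _ "p - q"] mpolys_below_diff) simp_all
      qed
      then obtain pf where pf: "\<And>f. f \<in> E \<Longrightarrow> pf f \<in> mpolys_below (2 * d)"
          "\<And>f t. f \<in> E \<Longrightarrow> meval t (pf f) = f (u + \<Phi> t) - f (u + (\<Phi> t + \<Psi> t))" by metis
      have "\<forall>j\<in>{..<k}. \<exists>p\<in>mpolys_below (2 * d). \<forall>t. meval t p = l j (\<Phi> t)"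
        using reg(1) l unfolding V.regular_map_def by blast
      then obtain pl where pl: "\<And>j. j < k \<Longrightarrow> pl j \<in> mpolys_below (2 * d)"
          "\<And>j t. j < k \<Longrightarrow> meval t (pl j) = l j (\<Phi> t)" by (metis lessThan_iff)
      define F where "F = pf ` E \<union> pl ` {..<k}"
      have "card F \<le> card (pf ` E) + card (pl ` {..<k})" unfolding F_def by (rule card_Un_le)
      also have "\<dots> \<le> card E + k"
        using card_image_le[OF E(2), of pf] card_image_le[of "{..<k}" pl] by simp
      finally have cardF: "card F + 2 \<le> 2 * d" using kd(2) by simp
      have cover: "H \<union> (?K - H) \<union> (carrier G - ?K) = carrier G" using HK KG by blast
      have "t \<in> zeros F \<longleftrightarrow> t \<in> A \<union> B \<union> C" for t
      proof -
        have "t \<in> zeros F \<longleftrightarrow> (\<forall>f\<in>E. meval t (pf f) = 0) \<and> (\<forall>j<k. meval t (pl j) = 0)"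
          by (auto simp: zeros_def F_def)
        also have "(\<forall>j<k. meval t (pl j) = 0) \<longleftrightarrow> t \<in> L" using pl(2) by (auto simp: L_def)
        also have "(\<forall>f\<in>E. meval t (pf f) = 0) \<longleftrightarrow> (\<forall>f\<in>E. f (u + \<Phi> t) = f (u + (\<Phi> t + \<Psi> t)))"
          using pf(2) by simp
        also have "\<dots> \<longleftrightarrow> (\<exists>g\<in>carrier G. u + (\<Phi> t + \<Psi> t) = \<phi> g (u + \<Phi> t))"
          by (rule separating_set_iff[OF act E(1)])
        also have "\<dots> \<longleftrightarrow> (\<exists>g\<in>carrier G. t \<in> T g)" unfolding TT ..
        also have "\<dots> \<longleftrightarrow> t \<in> (\<Union>g\<in>H \<union> (?K - H) \<union> (carrier G - ?K). T g)"
          unfolding UN_iff cover ..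
        finally show ?thesis unfolding A_def B_def C_def UN_Un by blast
      qed
      then have ZF: "zeros F = A \<union> B \<union> C" by blast
      have F: "finite F" "F \<subseteq> mpolys_below (2 * d)" using E(2) pf(1) pl(1) by (auto simp: F_def)
      show False
      proof (rule closed_separated_zeros_contradiction[OF closed F cardF ZF])
        have zero: "\<Phi> (\<lambda>_. 0) = 0 \<and> \<Psi> (\<lambda>_. 0) = 0" using ax0[of "\<lambda>_. 0"] by simp
        show "(\<lambda>_. 0) \<notin> C" using u(2) zero by (auto simp: C_def T_def)
        fix t :: "nat \<Rightarrow> 'k"
        {
          fix i assume t: "t \<in> A" "t \<in> B" and i: "i < 2 * d"
          obtain h g where h: "h \<in> H" "t \<in> T h" and g: "g \<in> ?K - H" "t \<in> T g"
            using t unfolding A_def B_def by blast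
          have hK: "h \<in> ?K" "h \<in> carrier G" "g \<in> carrier G" using h(1) g(1) HK KG by auto
          have tL: "\<forall>j<k. l j (\<Phi> t) = 0" using t(1) by (auto simp: A_def L_def)
          \<comment> \<open>The two graphs meet where \<open>h\<close> and \<open>g\<close> agree,
            that is, at a vector fixed by the inverse of \<open>h\<close> times \<open>g\<close>.
            This element is in \<open>?K - H\<close>, and the vector is a common zero of the forms,
            hence 0.\<close>
          have eq: "\<Phi> t + \<Psi> t = \<phi> h (\<Phi> t)" "\<Phi> t + \<Psi> t = \<phi> g (\<Phi> t)"
            using TK[OF hK(1)] TK[of g] h(2) g by auto
          have "inv\<^bsub>G\<^esub> h \<otimes>\<^bsub>G\<^esub> g \<in> ?K - H"
          proof
            show "inv\<^bsub>G\<^esub> h \<otimes>\<^bsub>G\<^esub> g \<in> ?K"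
              using hK(1) g(1) K by (auto intro: subgroup.m_closed subgroup.m_inv_closed)
            show "inv\<^bsub>G\<^esub> h \<otimes>\<^bsub>G\<^esub> g \<notin> H"
            proof
              assume "inv\<^bsub>G\<^esub> h \<otimes>\<^bsub>G\<^esub> g \<in> H"
              then have "h \<otimes>\<^bsub>G\<^esub> (inv\<^bsub>G\<^esub> h \<otimes>\<^bsub>G\<^esub> g) \<in> H" using H h(1) by (auto intro: subgroup.m_closed)
              moreover have "h \<otimes>\<^bsub>G\<^esub> (inv\<^bsub>G\<^esub> h \<otimes>\<^bsub>G\<^esub> g) = g" using hK(2,3) by (simp add: m_assoc[symmetric])
              ultimately show False using g(1) by simp
            qed
          qed
          moreover have "\<phi> (inv\<^bsub>G\<^esub> h \<otimes>\<^bsub>G\<^esub> g) (\<Phi> t) = \<Phi> t"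
            using hK(2,3) actD(3)[of "inv\<^bsub>G\<^esub> h" g "\<Phi> t"] actD(4)[of h "\<Phi> t"] eq by simp
          ultimately have "\<Phi> t = 0" using free tL by blast
          moreover have "\<Psi> t = 0" using eq(1) \<open>\<Phi> t = 0\<close> lin(3)[OF hK(2)] by simp
          ultimately show "t i = 0" using inj i by blast
        }
        {
          assume "\<And>i. i < 2 * d \<Longrightarrow> i \<noteq> 0 \<Longrightarrow> t i = 0"
          \<comment> \<open>The axis of variable 0 lies on the graph of the identity.\<close>
          then have t: "\<Phi> t = scale (t 0) v0" "\<Psi> t = 0" using ax0[of t] by auto
          have "\<one>\<^bsub>G\<^esub> \<in> H" by (rule subgroup.one_closed[OF H])
          moreover have "t \<in> T \<one>\<^bsub>G\<^esub>" by (simp add: T_def actD(2) t(2))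
          moreover have "t \<in> L" using l v0(2) by (auto simp: L_def t(1) V.linear_formD(2))
          ultimately show "t \<in> A" unfolding A_def by blast
        }
        assume "\<And>i. i < 2 * d \<Longrightarrow> i \<noteq> 1 \<Longrightarrow> t i = 0"
        \<comment> \<open>The axis of variable 1 lies on the graph of \<open>g0\<close>, by the
          choice of \<open>\<delta>\<close>.\<close>
        then have t: "\<Phi> t = scale (t 1) v0" "\<Psi> t = scale (t 1) \<delta>" using ax1[of t] by auto
        have g0G: "g0 \<in> carrier G" using g0K KG by blast
        have "\<Phi> t + \<Psi> t = \<phi> g0 (\<Phi> t)"
          unfolding t lin(2)[OF g0G] by (simp add: \<delta>_def V.scale_right_diff_distrib)
        then have "t \<in> T g0" by (simp add: TK[OF g0K])
        moreover have "t \<in> L" using l v0(2) by (auto simp: L_def t(1) V.linear_formD(2))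
        ultimately show "t \<in> B" unfolding B_def using g0K g0H by blast
      qed
    qed
  qed
  then show ?thesis using HK unfolding H_def by blast
qed

theorem mainTheorem1:
  fixes G :: "('g, 'b) monoid_scheme"
    and scale :: "'k :: alg_closed_field \<Rightarrow> 'v :: ab_group_add \<Rightarrow> 'v"
    and Basis :: "'v set"
    and \<phi> :: "'g \<Rightarrow> 'v \<Rightarrow> 'v"
    and d r :: nat
  assumes "finite_dimensional_vector_space scale Basis"
    and "vector_space.dim scale UNIV = d"
    and "finite (carrier G)"
    and "linear_group_action G scale \<phi>"
    and "r \<ge> 1"
    and "\<exists>E. separating_set G scale \<phi> E \<and> finite E \<and> card E = d + r - 1"
  shows "(\<forall>U. isotropy_subgroup G \<phi> U =
              generate G {\<sigma> \<in> isotropy_subgroup G \<phi> U.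
                            codimension scale (fixed_subspace \<phi> \<sigma>) \<le> r}) \<and>
         carrier G =
              generate G {\<sigma> \<in> carrier G. codimension scale (fixed_subspace \<phi> \<sigma>) \<le> r}"
proof -
  have iso: "isotropy_subgroup G \<phi> U =
      generate G {\<sigma> \<in> isotropy_subgroup G \<phi> U. codimension scale (fixed_subspace \<phi> \<sigma>) \<le> r}" for U
    using assms(6) isotropy_subgroup_generated[OF assms(1-5)] by blast
  moreover have "isotropy_subgroup G \<phi> {} = carrier G"
    by (simp add: isotropy_subgroup_def)
  ultimately show ?thesis using iso[of "{}"] by simp
qed

end
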